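(* Let $b\equiv1$ and assume that $\tau=T/N$ is sufficiently small. Then every solution $(u_H^n)$ of the fully discrete Crank–Nicolson LOD scheme of the context satisfies the discrete energy conservation law $$E^n=E^0\qquad\text{for all }0\le n\le N-1,$$ where $$E^n:=\|\delta_tu_H^n\|^2+\frac12\left(|u_H^{n+1}|_1^2+|u_H^n|_1^2\right)+\frac12\int_\Omega V\left(|u_H^{n+1}|^2+|u_H^n|^2\right)dx+\frac12\int_\Omega\left(F(|u_H^{n+1}|^2)+F(|u_H^n|^2)\right)dx.$$
   Context: **Setting.** $\Omega\subset\mathbb R^2$ is a convex polygonal domain, $T>0$. The continuous problem is $\partial_t^2u+i\partial_tu-\mathrm{div}(b\nabla u)+Vu+f(|u|^2)u=0$ in $\Omega\times(0,T]$, $u=0$ on $\partial\Omega$, with initial data $u(\cdot,0)=u_0$, $\partial_tu(\cdot,0)=u_1$; here $b\equiv1$. $V$ is a real-valued potential with $V\in W^{2,p}(\Omega)$ for $2\le p<\infty$. $f:\mathbb R\to\mathbb R$ is $C^2$ and $f=F'$ with $F:\mathbb R\to\mathbb R$. Function spaces are complex-valued; $(u,v)=\int_\Omega u\bar v\,dx$, $\|\cdot\|$ is the $L^2(\Omega)$ norm, $|v|_1=\|\nabla v\|$. The form $a(v,w)=(b\nabla v,\nabla w)+(Vv,w)$ is assumed to be an inner product on $H^1_0(\Omega)$. **LOD space.** For a quasi-uniform simplicial partition $\mathcal T_H$ of $\Omega$ with mesh size $H$, $V_H\subset H^1_0(\Omega)$ is the $\mathbb P^1$ Lagrange finite element space;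 $P_H:L^2(\Omega)\to V_H$ is the $L^2$-projection; $W=\{w\in H^1_0(\Omega):P_Hw=0\}$; and $V_{\mathrm{LOD}}=\{v\in H^1_0(\Omega):a(v,w)=0\ \forall w\in W\}$. **Scheme.** $\tau=T/N$, $t^n=n\tau$, and $\delta_t\phi^n=\frac{\phi^{n+1}-\phi^n}\tau$, $\delta_{\hat t}\phi^n=\frac{\phi^{n+1}-\phi^{n-1}}{2\tau}$, $\delta_t^2\phi^n=\frac{\phi^{n+1}-2\phi^n+\phi^{n-1}}{\tau^2}$, $\bar\phi^n=\frac{\phi^{n+1}+\phi^{n-1}}2$. For $x,y\ge0$, $\tilde f(x,y)=\int_0^1f((1-s)x+sy)\,ds$ (which equals $\frac{F(x)-F(y)}{x-y}$ if $x\ne y$). The scheme seeks $u^n_H\in V_{\mathrm{LOD}}$, $n=1,\dots,N$, such that for $n=0,\dots,N-1$ and all $\varphi\in V_{\mathrm{LOD}}$ $$(\delta_t^2u_H^n,\varphi)+i(\delta_{\hat t}u^n_H,\varphi)+(b\nabla\bar u^n_H,\nabla\varphi)+(V\bar u_H^n,\varphi)+(\tilde f(|u_H^{n+1}|^2,|u_H^{n-1}|^2)\bar u^n_H,\varphi)=0,$$ where the initial value $u_H^0\in V_{\mathrm{LOD}}$ and an approximation $u_{1,H}\in V_{\mathrm{LOD}}$ of $u_1$ are given, and $u_H^{-1}=u_H^1-2\tau u_{1,H}$. *)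

theory Defs
  imports "HOL-Analysis.Analysis"
begin

section \<open>Function spaces\<close>

text \<open>
  Functions are total on the ambient space, and only their values on \<open>\<Omega>\<close> matter; elements of
  \<open>L\<^sup>p\<close> and Sobolev spaces are represented by all their representatives, and equality in these
  spaces is equality almost everywhere on \<open>\<Omega>\<close>.
\<close>

text \<open>The class \<open>C\<^sup>k\<close> on the whole space.\<close>

primrec C_k :: "nat \<Rightarrow> ('a::euclidean_space \<Rightarrow> 'b::real_normed_vector) \<Rightarrow> bool" where
  "C_k 0 f \<longleftrightarrow> continuous_on UNIV f"
| "C_k (Suc k) f \<longleftrightarrow> (\<forall>x. f differentiable at x) \<and>
     (\<forall>e\<in>Basis. C_k k (\<lambda>x. frechet_derivative f (at x) e))"

definition test_functions :: "'a::euclidean_space set \<Rightarrow> ('a \<Rightarrow> 'b::real_normed_vector) set" where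
  "test_functions \<Omega> = {\<phi>. (\<forall>k. C_k k \<phi>) \<and>
     compact (closure {x. \<phi> x \<noteq> 0}) \<and> closure {x. \<phi> x \<noteq> 0} \<subseteq> \<Omega>}"

definition Lp_space ::
  "real \<Rightarrow> 'a::euclidean_space set \<Rightarrow> ('a \<Rightarrow> 'b::{banach, second_countable_topology}) set" where
  "Lp_space p \<Omega> = {v \<in> borel_measurable (lebesgue_on \<Omega>).
     integrable (lebesgue_on \<Omega>) (\<lambda>x. norm (v x) powr p)}"

definition loc_integrable ::
  "'a::euclidean_space set \<Rightarrow> ('a \<Rightarrow> 'b::{banach, second_countable_topology}) \<Rightarrow> bool" where
  "loc_integrable \<Omega> v \<longleftrightarrow> (\<forall>K. compact K \<and> K \<subseteq> \<Omega> \<longrightarrow> integrable (lebesgue_on K) v)"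

text \<open>Real-valued test functions suffice also for complex-valued \<open>v\<close> and \<open>g\<close>.\<close>

definition has_weak_deriv ::
  "'a::euclidean_space set \<Rightarrow> 'a \<Rightarrow> ('a \<Rightarrow> 'b::{banach, second_countable_topology})
     \<Rightarrow> ('a \<Rightarrow> 'b) \<Rightarrow> bool" where
  "has_weak_deriv \<Omega> e v g \<longleftrightarrow> loc_integrable \<Omega> v \<and> loc_integrable \<Omega> g \<and>
     (\<forall>\<phi> \<in> test_functions \<Omega>.
        (LINT x|lebesgue_on \<Omega>. frechet_derivative \<phi> (at x) e *\<^sub>R v x)
          = - (LINT x|lebesgue_on \<Omega>. (\<phi> x :: real) *\<^sub>R g x))"

text \<open>Weak derivatives are unique up to null sets; an arbitrary representative is chosen.\<close>

definition weak_deriv ::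
  "'a::euclidean_space set \<Rightarrow> 'a \<Rightarrow> ('a \<Rightarrow> 'b::{banach, second_countable_topology}) \<Rightarrow> 'a \<Rightarrow> 'b" where
  "weak_deriv \<Omega> e v = (SOME g. has_weak_deriv \<Omega> e v g)"

text \<open>\<open>W\<^sup>k\<^sup>,\<^sup>p(\<Omega>)\<close>.\<close>

primrec sobolev_space ::
  "nat \<Rightarrow> real \<Rightarrow> 'a::euclidean_space set \<Rightarrow> ('a \<Rightarrow> 'b::{banach, second_countable_topology}) set" where
  "sobolev_space 0 p \<Omega> = Lp_space p \<Omega>"
| "sobolev_space (Suc k) p \<Omega> =
     {v \<in> Lp_space p \<Omega>. \<forall>e\<in>Basis. \<exists>g \<in> sobolev_space k p \<Omega>. has_weak_deriv \<Omega> e v g}"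

definition L2_inner ::
  "'a::euclidean_space set \<Rightarrow> ('a \<Rightarrow> complex) \<Rightarrow> ('a \<Rightarrow> complex) \<Rightarrow> complex" where
  "L2_inner \<Omega> v w = (LINT x|lebesgue_on \<Omega>. v x * cnj (w x))"

definition L2_norm :: "'a::euclidean_space set \<Rightarrow> ('a \<Rightarrow> complex) \<Rightarrow> real" where
  "L2_norm \<Omega> v = sqrt (LINT x|lebesgue_on \<Omega>. (cmod (v x))\<^sup>2)"

text \<open>\<open>(b \<nabla>v, \<nabla>w)\<close> for a scalar coefficient \<open>b\<close>.\<close>

definition grad_inner ::
  "'a::euclidean_space set \<Rightarrow> ('a \<Rightarrow> real) \<Rightarrow> ('a \<Rightarrow> complex) \<Rightarrow> ('a \<Rightarrow> complex) \<Rightarrow> complex" where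
  "grad_inner \<Omega> b v w = (LINT x|lebesgue_on \<Omega>.
     (\<Sum>e\<in>Basis. (of_real (b x) * weak_deriv \<Omega> e v x) * cnj (weak_deriv \<Omega> e w x)))"

definition H1_seminorm :: "'a::euclidean_space set \<Rightarrow> ('a \<Rightarrow> complex) \<Rightarrow> real" where
  "H1_seminorm \<Omega> v = sqrt (LINT x|lebesgue_on \<Omega>. (\<Sum>e\<in>Basis. (cmod (weak_deriv \<Omega> e v x))\<^sup>2))"

text \<open>\<open>H\<^sup>1\<^sub>0(\<Omega>)\<close>, the closure of the test functions in \<open>H\<^sup>1(\<Omega>)\<close>.\<close>

definition H10 :: "'a::euclidean_space set \<Rightarrow> ('a \<Rightarrow> complex) set" where
  "H10 \<Omega> = {v \<in> sobolev_space 1 2 \<Omega>. \<exists>\<phi>. (\<forall>k::nat. \<phi> k \<in> test_functions \<Omega>) \<and>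
     (\<lambda>k. L2_norm \<Omega> (\<lambda>x. \<phi> k x - v x)) \<longlonglongrightarrow> 0 \<and>
     (\<lambda>k. H1_seminorm \<Omega> (\<lambda>x. \<phi> k x - v x)) \<longlonglongrightarrow> 0}"

definition inner_product_on ::
  "'a::euclidean_space set \<Rightarrow> ('a \<Rightarrow> complex) set
     \<Rightarrow> (('a \<Rightarrow> complex) \<Rightarrow> ('a \<Rightarrow> complex) \<Rightarrow> complex) \<Rightarrow> bool" where
  "inner_product_on \<Omega> X ip \<longleftrightarrow>
     (\<forall>u\<in>X. \<forall>v\<in>X. \<forall>w\<in>X. \<forall>c d.
        ip (\<lambda>x. c * u x + d * v x) w = c * ip u w + d * ip v w) \<and>
     (\<forall>v\<in>X. \<forall>w\<in>X. ip w v = cnj (ip v w)) \<and>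
     (\<forall>v\<in>X. ip v v \<in> \<real> \<and> 0 \<le> Re (ip v v) \<and>
        (ip v v = 0 \<longrightarrow> (AE x in lebesgue_on \<Omega>. v x = 0)))"

definition a_form ::
  "'a::euclidean_space set \<Rightarrow> ('a \<Rightarrow> real) \<Rightarrow> ('a \<Rightarrow> real)
     \<Rightarrow> ('a \<Rightarrow> complex) \<Rightarrow> ('a \<Rightarrow> complex) \<Rightarrow> complex" where
  "a_form \<Omega> b V v w = grad_inner \<Omega> b v w + L2_inner \<Omega> (\<lambda>x. of_real (V x) * v x) w"

section \<open>Meshes and the LOD space\<close>

definition convex_polygonal_domain :: "(real \<times> real) set \<Rightarrow> bool" where
  "convex_polygonal_domain \<Omega> \<longleftrightarrow> \<Omega> \<noteq> {} \<and> (\<exists>P. polytope P \<and> \<Omega> = interior P)"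

definition simplicial_partition :: "(real \<times> real) set \<Rightarrow> (real \<times> real) set set \<Rightarrow> bool" where
  "simplicial_partition \<Omega> \<T> \<longleftrightarrow>
     triangulation \<T> \<and> (\<forall>K\<in>\<T>. 2 simplex K) \<and> \<Union>\<T> = closure \<Omega>"

definition mesh_size :: "(real \<times> real) set set \<Rightarrow> real" where
  "mesh_size \<T> = Max (diameter ` \<T>)"

text \<open>Quasi-uniformity with constant \<open>\<gamma>\<close>: every element contains a ball of diameter at least
  \<open>\<gamma>\<close> times the mesh size.\<close>

definition quasi_uniform :: "real \<Rightarrow> (real \<times> real) set set \<Rightarrow> bool" where
  "quasi_uniform \<gamma> \<T> \<longleftrightarrow> 0 < \<gamma> \<and>
     (\<forall>K\<in>\<T>. \<exists>c r. \<gamma> * mesh_size \<T> \<le> 2 * r \<and> cball c r \<subseteq> K)"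

text \<open>The elements of \<open>V\<^sub>H\<close> are given by their continuous representatives, extended by zero
  outside \<open>\<Omega>\<close>; in particular they are genuinely unique as functions.\<close>

definition P1_space :: "(real \<times> real) set \<Rightarrow> (real \<times> real) set set \<Rightarrow> (real \<times> real \<Rightarrow> complex) set" where
  "P1_space \<Omega> \<T> = {v. continuous_on (closure \<Omega>) v \<and>
     (\<forall>K\<in>\<T>. \<exists>A c. linear A \<and> (\<forall>x\<in>K. v x = A x + c)) \<and> (\<forall>x. x \<notin> \<Omega> \<longrightarrow> v x = 0)}"

definition L2_projection ::
  "(real \<times> real) set \<Rightarrow> (real \<times> real) set set
     \<Rightarrow> (real \<times> real \<Rightarrow> complex) \<Rightarrow> (real \<times> real \<Rightarrow> complex)" where
  "L2_projection \<Omega> \<T> v =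
     (THE p. p \<in> P1_space \<Omega> \<T> \<and> (\<forall>\<phi>\<in>P1_space \<Omega> \<T>. L2_inner \<Omega> (\<lambda>x. v x - p x) \<phi> = 0))"

definition W_space :: "(real \<times> real) set \<Rightarrow> (real \<times> real) set set \<Rightarrow> (real \<times> real \<Rightarrow> complex) set" where
  "W_space \<Omega> \<T> = {w \<in> H10 \<Omega>. L2_projection \<Omega> \<T> w = (\<lambda>x. 0)}"

definition V_LOD ::
  "(real \<times> real) set \<Rightarrow> (real \<times> real \<Rightarrow> real) \<Rightarrow> (real \<times> real \<Rightarrow> real) \<Rightarrow> (real \<times> real) set set
     \<Rightarrow> (real \<times> real \<Rightarrow> complex) set" where
  "V_LOD \<Omega> b V \<T> = {v \<in> H10 \<Omega>. \<forall>w \<in> W_space \<Omega> \<T>. a_form \<Omega> b V v w = 0}"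

section \<open>The fully discrete scheme and its energy\<close>

text \<open>Grid functions are indexed by \<open>int\<close> because of the ghost value at time level \<open>-1\<close>.\<close>

definition dt :: "real \<Rightarrow> (int \<Rightarrow> 'a \<Rightarrow> complex) \<Rightarrow> int \<Rightarrow> 'a \<Rightarrow> complex" where
  "dt \<tau> \<phi> n = (\<lambda>x. (\<phi> (n + 1) x - \<phi> n x) / of_real \<tau>)"

definition dt_hat :: "real \<Rightarrow> (int \<Rightarrow> 'a \<Rightarrow> complex) \<Rightarrow> int \<Rightarrow> 'a \<Rightarrow> complex" where
  "dt_hat \<tau> \<phi> n = (\<lambda>x. (\<phi> (n + 1) x - \<phi> (n - 1) x) / (2 * of_real \<tau>))"

definition dt2 :: "real \<Rightarrow> (int \<Rightarrow> 'a \<Rightarrow> complex) \<Rightarrow> int \<Rightarrow> 'a \<Rightarrow> complex" where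
  "dt2 \<tau> \<phi> n = (\<lambda>x. (\<phi> (n + 1) x - 2 * \<phi> n x + \<phi> (n - 1) x) / (of_real \<tau>)\<^sup>2)"

definition avg :: "(int \<Rightarrow> 'a \<Rightarrow> complex) \<Rightarrow> int \<Rightarrow> 'a \<Rightarrow> complex" where
  "avg \<phi> n = (\<lambda>x. (\<phi> (n + 1) x + \<phi> (n - 1) x) / 2)"

definition f_tilde :: "(real \<Rightarrow> real) \<Rightarrow> real \<Rightarrow> real \<Rightarrow> real" where
  "f_tilde f x y = integral {0..1} (\<lambda>s. f ((1 - s) * x + s * y))"

definition crank_nicolson_solution ::
  "'a::euclidean_space set \<Rightarrow> ('a \<Rightarrow> real) \<Rightarrow> ('a \<Rightarrow> real) \<Rightarrow> (real \<Rightarrow> real)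
     \<Rightarrow> ('a \<Rightarrow> complex) set \<Rightarrow> real \<Rightarrow> nat \<Rightarrow> ('a \<Rightarrow> complex) \<Rightarrow> (int \<Rightarrow> 'a \<Rightarrow> complex) \<Rightarrow> bool" where
  "crank_nicolson_solution \<Omega> b V f X \<tau> N u1H u \<longleftrightarrow>
     u 0 \<in> X \<and> u1H \<in> X \<and> (\<forall>n\<in>{1..int N}. u n \<in> X) \<and>
     u (-1) = (\<lambda>x. u 1 x - 2 * of_real \<tau> * u1H x) \<and>
     (\<forall>n\<in>{0..int N - 1}. \<forall>\<phi>\<in>X.
        L2_inner \<Omega> (dt2 \<tau> u n) \<phi> + \<i> * L2_inner \<Omega> (dt_hat \<tau> u n) \<phi>
        + grad_inner \<Omega> b (avg u n) \<phi>
        + L2_inner \<Omega> (\<lambda>x. of_real (V x) * avg u n x) \<phi>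
        + L2_inner \<Omega> (\<lambda>x. of_real (f_tilde f ((cmod (u (n + 1) x))\<^sup>2) ((cmod (u (n - 1) x))\<^sup>2))
            * avg u n x) \<phi> = 0)"

definition energy ::
  "'a::euclidean_space set \<Rightarrow> ('a \<Rightarrow> real) \<Rightarrow> (real \<Rightarrow> real) \<Rightarrow> real
     \<Rightarrow> (int \<Rightarrow> 'a \<Rightarrow> complex) \<Rightarrow> int \<Rightarrow> real" where
  "energy \<Omega> V F \<tau> u n =
     (L2_norm \<Omega> (dt \<tau> u n))\<^sup>2
     + 1/2 * ((H1_seminorm \<Omega> (u (n + 1)))\<^sup>2 + (H1_seminorm \<Omega> (u n))\<^sup>2)
     + 1/2 * (LINT x|lebesgue_on \<Omega>. V x * ((cmod (u (n + 1) x))\<^sup>2 + (cmod (u n x))\<^sup>2))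
     + 1/2 * (LINT x|lebesgue_on \<Omega>. F ((cmod (u (n + 1) x))\<^sup>2) + F ((cmod (u n x))\<^sup>2))"

end

theory Submission
  imports Defs
begin

text \<open>The energy is conserved because the scheme, tested with \<open>u\<^sup>n\<^sup>+\<^sup>1 - u\<^sup>n\<^sup>-\<^sup>1\<close>, has the real part
\<open>E\<^sup>n - E\<^sup>n\<^sup>-\<^sup>1\<close>: the second difference quotient telescopes, the term with the factor \<open>\<i>\<close> is purely
imaginary, the form \<open>a\<close> of the average against the difference has the real part
\<open>(a(u\<^sup>n\<^sup>+\<^sup>1, u\<^sup>n\<^sup>+\<^sup>1) - a(u\<^sup>n\<^sup>-\<^sup>1, u\<^sup>n\<^sup>-\<^sup>1)) / 2\<close>, and \<open>f_tilde\<close> is the difference quotient of \<open>F\<close>. This is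
\<open>energy_step\<close>, applied at the levels \<open>n \<ge> 1\<close>.

The computation splits integrals, so every term must be integrable. Since \<open>f\<close> may grow
arbitrarily fast, \<open>H\<^sup>1\<close> regularity does not make \<open>F(\<bar>u\<bar>\<^sup>2)\<close> integrable in two dimensions, and the main
work is to show that functions in the LOD space are essentially bounded (\<open>V_LOD_bounded\<close>).
A function \<open>v\<close> in this space is \<open>a\<close>-orthogonal to the kernel of the projection onto a space of finite
dimension. By linear algebra \<open>a(w, v)\<close> is then the integral of \<open>w\<close> against a bounded function \<open>g\<close>
(\<open>V_LOD_weak_equation\<close>), so that the real and imaginary part of \<open>v\<close> solve \<open>- \<Delta> u = h\<close> weakly,
where \<open>\<bar>h\<bar> \<le> M + \<bar>V\<bar> \<bar>u\<bar>\<close> and \<open>V\<close> is square-integrable.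

For such equations boundedness is proved by potential theory (\<open>weak_solution_bounded\<close>).
Kato's inequality \<open>- \<Delta> \<bar>u\<bar> \<le> \<bar>h\<bar>\<close>, valid on the whole plane for \<open>u\<close> extended by \<open>0\<close>
(\<open>Kato_inequality\<close>), is tested with smoothed logarithmic kernels, which bounds \<open>\<bar>u\<bar>\<close> almost everywhere by
the logarithmic potential of \<open>\<bar>h\<bar>\<close>. Inserting this bound into \<open>\<bar>h\<bar> \<le> M + \<bar>V\<bar> \<bar>u\<bar>\<close> once more gives a
bounded potential, because the logarithm is integrable to every power (\<open>potential_bootstrap\<close>). All test
functions used in this argument are built from the smooth functions that approximate \<open>u\<close> in
\<open>H\<^sup>1\<^sub>0\<close>, so no chain rule for Sobolev functions is involved.

Weak derivatives in the form and in the seminorm are chosen representatives. To compute with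
them, their uniqueness up to null sets is needed; it is derived from the fundamental lemma of the
calculus of variations (\<open>fundamental_lemma_real\<close>), for which explicit bump functions are built.\<close>

section \<open>Smooth functions\<close>

lemma C_k_Suc_D: "C_k (Suc k) f \<Longrightarrow> C_k k f"
proof (induction k arbitrary: f)
  case 0
  then show ?case
    by (auto simp: continuous_on_eq_continuous_at differentiable_imp_continuous_within)
next
  case (Suc k)
  then show ?case by (metis C_k.simps(2))
qed

lemma C_k_const: "C_k k (\<lambda>x. c)"
proof (induction k arbitrary: c)
  case (Suc k)
  then show ?case by (simp add: frechet_derivative_const)
qed simp

lemma C_k_bounded_linear:
  fixes f :: "'a::euclidean_space \<Rightarrow> 'b::real_normed_vector"
  assumes L: "bounded_linear L" and "C_k k f"
  shows "C_k k (\<lambda>x. L (f x))"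
  using assms(2)
proof (induction k arbitrary: f)
  case 0
  then show ?case
    using L by (auto intro: bounded_linear.continuous_on)
next
  case (Suc k)
  have der: "((\<lambda>x. L (f x)) has_derivative (\<lambda>h. L (frechet_derivative f (at x) h))) (at x)" for x
    by (rule bounded_linear.has_derivative[OF L]) (use Suc.prems in \<open>auto simp: frechet_derivative_works[symmetric]\<close>)
  have "frechet_derivative (\<lambda>x. L (f x)) (at x) = (\<lambda>h. L (frechet_derivative f (at x) h))" for x
    using frechet_derivative_at[OF der] by simp
  then show ?case
    using Suc differentiableI[OF der] by auto
qed

lemma C_k_add:
  fixes f g :: "'a::euclidean_space \<Rightarrow> 'b::real_normed_vector"
  assumes "C_k k f" "C_k k g"
  shows "C_k k (\<lambda>x. f x + g x)"
  using assms
proof (induction k arbitrary: f g)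
  case 0
  then show ?case by (auto intro: continuous_on_add)
next
  case (Suc k)
  have der: "((\<lambda>x. f x + g x) has_derivative
      (\<lambda>h. frechet_derivative f (at x) h + frechet_derivative g (at x) h)) (at x)" for x
    by (rule has_derivative_add) (use Suc.prems in \<open>auto simp: frechet_derivative_works[symmetric]\<close>)
  have "frechet_derivative (\<lambda>x. f x + g x) (at x)
      = (\<lambda>h. frechet_derivative f (at x) h + frechet_derivative g (at x) h)" for x
    using frechet_derivative_at[OF der] by simp
  then show ?case
    using Suc differentiableI[OF der] by auto
qed

lemma C_k_bounded_bilinear:
  fixes f :: "'a::euclidean_space \<Rightarrow> 'b::real_normed_vector" and g :: "'a \<Rightarrow> 'c::real_normed_vector"
  assumes B: "bounded_bilinear B" and "C_k k f" "C_k k g"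
  shows "C_k k (\<lambda>x. B (f x) (g x))"
  using assms(2,3)
proof (induction k arbitrary: f g)
  case 0
  then show ?case
    using B by (auto intro: bounded_bilinear.continuous_on)
next
  case (Suc k)
  have der: "((\<lambda>x. B (f x) (g x)) has_derivative
      (\<lambda>h. B (f x) (frechet_derivative g (at x) h) + B (frechet_derivative f (at x) h) (g x))) (at x)" for x
    by (rule bounded_bilinear.FDERIV[OF B]) (use Suc.prems in \<open>auto simp: frechet_derivative_works[symmetric]\<close>)
  have "frechet_derivative (\<lambda>x. B (f x) (g x)) (at x)
      = (\<lambda>h. B (f x) (frechet_derivative g (at x) h) + B (frechet_derivative f (at x) h) (g x))" for x
    using frechet_derivative_at[OF der] by simp
  moreover have "C_k k f" "C_k k g" using Suc.prems by (auto dest: C_k_Suc_D simp del: C_k.simps)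
  ultimately show ?case
    using Suc differentiableI[OF der] by (auto intro!: C_k_add)
qed

lemmas C_k_mult = C_k_bounded_bilinear[OF bounded_bilinear_mult]
lemmas C_k_scaleR = C_k_bounded_bilinear[OF bounded_bilinear_scaleR]

text \<open>Differentiating \<open>g \<circ> h\<close> gives \<open>g' \<circ> h\<close> times a derivative of \<open>h\<close>, so the
induction on \<open>k\<close> runs as soon as \<open>g'\<close> belongs to the same family as \<open>g\<close>. In this way powers,
the logarithm and \<open>exp (- 1 / x)\<close> are handled without formulas for their higher derivatives.
The set \<open>S\<close> is where the family is differentiable, for instance the positive half-line.\<close>

lemma C_k_compose_family:
  fixes h :: "'a::euclidean_space \<Rightarrow> real" and g :: "real \<Rightarrow> real"
  assumes closed: "\<And>g. P g \<Longrightarrow> \<exists>g'. P g' \<and> (\<forall>x\<in>S. (g has_real_derivative g' x) (at x))"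
    and "P g" and h: "\<And>x. h x \<in> S" and "C_k k h"
  shows "C_k k (\<lambda>x. g (h x))"
  using assms(2,4)
proof (induction k arbitrary: g)
  case 0
  obtain g' where g': "\<forall>x\<in>S. (g has_real_derivative g' x) (at x)"
    using closed[OF 0(1)] by blast
  then have "isCont g (h x)" for x
    using h DERIV_isCont by blast
  then show ?case
    using 0(2) by (auto simp: continuous_on_eq_continuous_at intro: isCont_o2)
next
  case (Suc k)
  obtain g' where g': "P g'" "\<forall>x\<in>S. (g has_real_derivative g' x) (at x)"
    using closed[OF Suc.prems(1)] by blast
  have der: "((\<lambda>x. g (h x)) has_derivative (\<lambda>e. g' (h x) * frechet_derivative h (at x) e)) (at x)" for x
  proof -
    have "(h has_derivative frechet_derivative h (at x)) (at x)"
      using Suc.prems by (auto simp: frechet_derivative_works[symmetric])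
    moreover have "(g has_derivative (*) (g' (h x))) (at (h x))"
      using g'(2) h by (auto simp: has_field_derivative_def)
    ultimately show ?thesis
      using diff_chain_at[of h _ x g] by (simp add: o_def)
  qed
  have fd: "frechet_derivative (\<lambda>x. g (h x)) (at x) = (\<lambda>e. g' (h x) * frechet_derivative h (at x) e)" for x
    using frechet_derivative_at[OF der] by simp
  have "C_k k (\<lambda>x. g' (h x))"
    using Suc.IH[OF g'(1)] Suc.prems(2) C_k_Suc_D by blast
  then show ?case
    using Suc.prems differentiableI[OF der] fd by (auto intro!: C_k_mult)
qed

lemma C_k_powr:
  fixes h :: "'a::euclidean_space \<Rightarrow> real"
  assumes "\<And>x. 0 < h x" "C_k k h"
  shows "C_k k (\<lambda>x. h x powr a)"
proof (rule C_k_compose_family[where g="\<lambda>x. x powr a" and h=h and S="{0<..}" and P="\<lambda>g. \<exists>c a. g = (\<lambda>x. c * x powr a)"])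
  fix g :: "real \<Rightarrow> real" assume "\<exists>c a. g = (\<lambda>x. c * x powr a)"
  then obtain c a where g: "g = (\<lambda>x. c * x powr a)" by blast
  show "\<exists>g'. (\<exists>c a. g' = (\<lambda>x. c * x powr a)) \<and> (\<forall>x\<in>{0<..}. (g has_real_derivative g' x) (at x))"
    by (rule exI[of _ "\<lambda>x. (c * a) * x powr (a - 1)"]) (auto simp: g intro!: derivative_eq_intros)
next
  show "\<exists>c b. (\<lambda>x. x powr a) = (\<lambda>x. c * x powr b)"
    by (rule exI[of _ 1]) auto
qed (use assms in \<open>auto simp del: C_k.simps\<close>)

lemma C_k_ln:
  fixes h :: "'a::euclidean_space \<Rightarrow> real"
  assumes "\<And>x. 0 < h x" "C_k k h"
  shows "C_k k (\<lambda>x. ln (h x))"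
proof (rule C_k_compose_family[where g=ln and h=h and S="{0<..}" and P="\<lambda>g. g = ln \<or> (\<exists>c a. g = (\<lambda>x. c * x powr a))"])
  fix g :: "real \<Rightarrow> real" assume "g = ln \<or> (\<exists>c a. g = (\<lambda>x. c * x powr a))"
  then consider "g = ln" | c a where "g = (\<lambda>x. c * x powr a)" by blast
  then show "\<exists>g'. (g' = ln \<or> (\<exists>c a. g' = (\<lambda>x. c * x powr a))) \<and>
      (\<forall>x\<in>{0<..}. (g has_real_derivative g' x) (at x))"
  proof cases
    case 1
    have "\<forall>x\<in>{0<..}. (ln has_real_derivative 1 * x powr (- 1)) (at x)"
      by (auto simp: powr_minus divide_simps intro!: derivative_eq_intros)
    then show ?thesis unfolding 1 by blast
  next
    case (2 c a)
    show ?thesis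
      by (rule exI[of _ "\<lambda>x. (c * a) * x powr (a - 1)"]) (auto simp: 2 intro!: derivative_eq_intros)
  qed
qed (use assms in auto)

lemma tendsto_poly_inverse_exp:
  fixes p :: "real poly"
  shows "((\<lambda>x. poly p (inverse x) * exp (- inverse x)) \<longlongrightarrow> 0) (at_right 0)"
proof -
  have "((\<lambda>y. poly p y * exp (- y)) \<longlongrightarrow> 0) at_top"
  proof -
    have "((\<lambda>y. \<Sum>i\<le>degree p. coeff p i * (y ^ i / exp y)) \<longlongrightarrow> (\<Sum>i\<le>degree p. coeff p i * 0)) at_top"
      by (intro tendsto_sum tendsto_mult tendsto_const tendsto_power_div_exp_0)
    then show ?thesis
      by (simp add: poly_altdef sum_distrib_right exp_minus field_simps sum_divide_distrib)
  qed
  from filterlim_compose[OF this filterlim_inverse_at_top_right] show ?thesis by simp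
qed

text \<open>This class contains \<open>exp (- 1 / x)\<close>, from which bump functions are built, and unlike that
single function it is closed under differentiation.\<close>

definition flat :: "real poly \<Rightarrow> real \<Rightarrow> real" where
  "flat p x = (if 0 < x then poly p (inverse x) * exp (- inverse x) else 0)"

lemma flat_has_derivative:
  "(flat p has_real_derivative flat ([:0, 0, 1:] * (p - pderiv p)) x) (at x)"
proof -
  consider "x > 0" | "x < 0" | "x = 0" by linarith
  then show ?thesis
  proof cases
    case 1
    have "((\<lambda>x. poly p (inverse x) * exp (- inverse x)) has_real_derivative
        flat ([:0, 0, 1:] * (p - pderiv p)) x) (at x)"
      using 1 unfolding flat_def
      by (auto intro!: derivative_eq_intros DERIV_chain2[OF poly_DERIV] simp: algebra_simps power2_eq_square)
    then show ?thesis
      by (rule has_field_derivative_transform_within_open[where S="{0<..}"]) (use 1 in \<open>auto simp: flat_def\<close>)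
  next
    case 2
    have "((\<lambda>x. 0) has_real_derivative 0) (at x)" by simp
    then have "(flat p has_real_derivative 0) (at x)"
      by (rule has_field_derivative_transform_within_open[where S="{..<0}"]) (use 2 in \<open>auto simp: flat_def\<close>)
    then show ?thesis using 2 by (simp add: flat_def)
  next
    case 3
    \<comment> \<open>The difference quotient at \<open>0\<close> is again of the form \<open>flat\<close>, with \<open>p\<close> multiplied by \<open>1/x\<close>.\<close>
    have "((\<lambda>h. flat p h / h) \<longlongrightarrow> 0) (at 0)"
      unfolding at_eq_sup_left_right
    proof (rule filterlim_sup)
      show "((\<lambda>h. flat p h / h) \<longlongrightarrow> 0) (at_left 0)"
        by (rule tendsto_eventually) (auto simp: eventually_at_filter flat_def)
      have "((\<lambda>x. poly ([:0,1:] * p) (inverse x) * exp (- inverse x)) \<longlongrightarrow> 0) (at_right 0)"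
        by (rule tendsto_poly_inverse_exp)
      then show "((\<lambda>h. flat p h / h) \<longlongrightarrow> 0) (at_right 0)"
        by (rule Lim_transform_eventually)
          (auto simp: eventually_at_filter flat_def field_simps)
    qed
    then show ?thesis using 3 by (simp add: DERIV_def flat_def)
  qed
qed

lemma C_k_flat: "C_k k h \<Longrightarrow> C_k k (\<lambda>x. flat p (h x))"
  by (rule C_k_compose_family[where g="flat p" and h=h and S=UNIV and P="\<lambda>g. \<exists>p. g = flat p"])
    (use flat_has_derivative in blast)+

definition smooth :: "('a::euclidean_space \<Rightarrow> 'b::real_normed_vector) \<Rightarrow> bool" where
  "smooth f \<longleftrightarrow> (\<forall>k. C_k k f)"

lemma smooth_differentiable: "smooth f \<Longrightarrow> f differentiable at x"
  unfolding smooth_def by (metis C_k.simps(2))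

lemma smooth_has_derivative: "smooth f \<Longrightarrow> (f has_derivative frechet_derivative f (at x)) (at x)"
  using smooth_differentiable frechet_derivative_works by blast

lemma smooth_continuous: "smooth f \<Longrightarrow> continuous_on A f"
  unfolding smooth_def by (metis C_k.simps(1) continuous_on_subset subset_UNIV)

lemma smooth_frechet_derivative:
  "smooth f \<Longrightarrow> e \<in> Basis \<Longrightarrow> smooth (\<lambda>x. frechet_derivative f (at x) e)"
  unfolding smooth_def by (metis C_k.simps(2))

lemma smooth_const: "smooth (\<lambda>x. c)"
  by (simp add: smooth_def C_k_const)

lemma smooth_bounded_linear: "bounded_linear L \<Longrightarrow> smooth f \<Longrightarrow> smooth (\<lambda>x. L (f x))"
  by (simp add: smooth_def C_k_bounded_linear)

lemma smooth_add: "smooth f \<Longrightarrow> smooth g \<Longrightarrow> smooth (\<lambda>x. f x + g x)"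
  by (simp add: smooth_def C_k_add)

lemma smooth_scaleR: "smooth f \<Longrightarrow> smooth g \<Longrightarrow> smooth (\<lambda>x. f x *\<^sub>R g x)"
  by (simp add: smooth_def C_k_scaleR)

lemma smooth_mult:
  fixes f g :: "'a::euclidean_space \<Rightarrow> real"
  shows "smooth f \<Longrightarrow> smooth g \<Longrightarrow> smooth (\<lambda>x. f x * g x)"
  by (simp add: smooth_def C_k_mult)

lemma smooth_ident: "smooth (\<lambda>x. x)"
  unfolding smooth_def
proof
  fix k show "C_k k (\<lambda>x::'a. x)"
    by (cases k) (auto simp: C_k_const frechet_derivative_ident)
qed

lemma smooth_inner: "smooth (\<lambda>x. x \<bullet> e)"
  by (rule smooth_bounded_linear[OF bounded_linear_inner_left smooth_ident])

lemma smooth_prod: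
  fixes f :: "'i \<Rightarrow> 'a::euclidean_space \<Rightarrow> real"
  assumes "\<And>i. i \<in> I \<Longrightarrow> smooth (f i)"
  shows "smooth (\<lambda>x. \<Prod>i\<in>I. f i x)"
  using assms by (induction I rule: infinite_finite_induct) (auto intro: smooth_mult smooth_const)

section \<open>Test functions\<close>

lemma test_smooth: "\<phi> \<in> test_functions \<Omega> \<Longrightarrow> smooth \<phi>"
  by (simp add: test_functions_def smooth_def)

lemma test_zero_outside: "\<phi> \<in> test_functions \<Omega> \<Longrightarrow> x \<notin> \<Omega> \<Longrightarrow> \<phi> x = 0"
  unfolding test_functions_def using closure_subset[of "{x. \<phi> x \<noteq> 0}"] by blast

lemma test_functions_by_support:
  assumes "\<phi> \<in> test_functions \<Omega>" "smooth \<psi>" "\<And>x. \<psi> x \<noteq> 0 \<Longrightarrow> x \<in> closure {x. \<phi> x \<noteq> 0}"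
  shows "\<psi> \<in> test_functions \<Omega>"
proof -
  let ?K = "closure {x. \<phi> x \<noteq> 0}"
  have sub: "closure {x. \<psi> x \<noteq> 0} \<subseteq> ?K"
    using assms(3) by (intro closure_minimal) auto
  have "compact ?K" "?K \<subseteq> \<Omega>" using assms(1) by (auto simp: test_functions_def)
  then have "compact (closure {x. \<psi> x \<noteq> 0})"
    using sub by (metis closed_closure inf.absorb2 inf_commute closed_Int_compact)
  then show ?thesis
    using assms(2) sub \<open>?K \<subseteq> \<Omega>\<close> by (auto simp: test_functions_def smooth_def)
qed

lemma test_derivative:
  assumes "\<phi> \<in> test_functions \<Omega>" "e \<in> Basis"
  shows "(\<lambda>x. frechet_derivative \<phi> (at x) e) \<in> test_functions \<Omega>"
proof (rule test_functions_by_support[OF assms(1)])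
  show "smooth (\<lambda>x. frechet_derivative \<phi> (at x) e)"
    using assms by (intro smooth_frechet_derivative test_smooth)
  fix x assume *: "frechet_derivative \<phi> (at x) e \<noteq> 0"
  show "x \<in> closure {x. \<phi> x \<noteq> 0}"
  proof (rule ccontr)
    assume x: "x \<notin> closure {x. \<phi> x \<noteq> 0}"
    have "(\<phi> has_derivative (\<lambda>h. 0)) (at x)"
    proof (rule has_derivative_transform_within_open[of "\<lambda>x. 0" _ _ _ "- closure {x. \<phi> x \<noteq> 0}"])
      show "0 = \<phi> y" if "y \<in> - closure {x. \<phi> x \<noteq> 0}" for y
        using that closure_subset[of "{x. \<phi> x \<noteq> 0}"] by auto
    qed (use x in \<open>auto simp: open_Compl\<close>)
    then have "frechet_derivative \<phi> (at x) = (\<lambda>h. 0)"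
      using frechet_derivative_at by metis
    then show False using * by simp
  qed
qed

lemma test_bounded:
  fixes \<phi> :: "'a::euclidean_space \<Rightarrow> 'b::real_normed_vector"
  assumes "\<phi> \<in> test_functions \<Omega>"
  obtains B where "0 < B" "\<And>x. norm (\<phi> x) \<le> B"
proof -
  let ?K = "closure {x. \<phi> x \<noteq> 0}"
  have "compact (\<phi> ` ?K)"
    using assms by (intro compact_continuous_image smooth_continuous test_smooth) (auto simp: test_functions_def)
  then obtain B where B: "0 < B" "\<And>y. y \<in> \<phi> ` ?K \<Longrightarrow> norm y \<le> B"
    using compact_imp_bounded bounded_pos by metis
  have "norm (\<phi> x) \<le> B" for x
  proof (cases "\<phi> x = 0")
    case False
    then have "x \<in> ?K" using closure_subset[of "{x. \<phi> x \<noteq> 0}"] by auto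
    then show ?thesis using B by auto
  qed (use B in auto)
  then show ?thesis using B that by blast
qed

lemma test_scaleR_smooth:
  fixes \<phi> :: "'a::euclidean_space \<Rightarrow> real"
  assumes "\<phi> \<in> test_functions \<Omega>" "smooth g"
  shows "(\<lambda>x. \<phi> x *\<^sub>R g x) \<in> test_functions \<Omega>"
proof (rule test_functions_by_support[OF assms(1)])
  show "smooth (\<lambda>x. \<phi> x *\<^sub>R g x)"
    by (rule smooth_scaleR[OF test_smooth[OF assms(1)] assms(2)])
  fix x assume "\<phi> x *\<^sub>R g x \<noteq> 0"
  then have "x \<in> {x. \<phi> x \<noteq> 0}" by simp
  then show "x \<in> closure {x. \<phi> x \<noteq> 0}" by (rule subsetD[OF closure_subset])
qed

lemma test_bounded_linear:
  assumes "\<phi> \<in> test_functions \<Omega>" "bounded_linear L"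
  shows "(\<lambda>x. L (\<phi> x)) \<in> test_functions \<Omega>"
proof (rule test_functions_by_support[OF assms(1)])
  show "smooth (\<lambda>x. L (\<phi> x))"
    by (rule smooth_bounded_linear[OF assms(2) test_smooth[OF assms(1)]])
  fix x assume "L (\<phi> x) \<noteq> 0"
  then have "\<phi> x \<noteq> 0" using linear_0[OF bounded_linear.linear[OF assms(2)]] by auto
  then show "x \<in> closure {x. \<phi> x \<noteq> 0}" using closure_subset[of "{x. \<phi> x \<noteq> 0}"] by auto
qed

lemma test_add:
  fixes \<phi> \<psi> :: "'a::euclidean_space \<Rightarrow> 'b::real_normed_vector"
  assumes "\<phi> \<in> test_functions \<Omega>" "\<psi> \<in> test_functions \<Omega>"
  shows "(\<lambda>x. \<phi> x + \<psi> x) \<in> test_functions \<Omega>"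
proof -
  let ?K = "closure {x. \<phi> x \<noteq> 0} \<union> closure {x. \<psi> x \<noteq> 0}"
  have K: "compact ?K" "?K \<subseteq> \<Omega>" using assms unfolding test_functions_def by blast+
  have "{x. \<phi> x + \<psi> x \<noteq> 0} \<subseteq> {x. \<phi> x \<noteq> 0} \<union> {x. \<psi> x \<noteq> 0}" by auto
  also have "\<dots> \<subseteq> ?K" by (intro Un_mono closure_subset)
  finally have sub: "closure {x. \<phi> x + \<psi> x \<noteq> 0} \<subseteq> ?K"
    by (intro closure_minimal) (auto simp: compact_imp_closed K)
  then have "compact (closure {x. \<phi> x + \<psi> x \<noteq> 0})"
    using compact_Int_closed[OF K(1) closed_closure[of "{x. \<phi> x + \<psi> x \<noteq> 0}"]]
    by (simp only: Int_absorb1[OF sub])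
  then show ?thesis
    using sub K(2) smooth_add[OF test_smooth[OF assms(1)] test_smooth[OF assms(2)]]
    unfolding test_functions_def smooth_def by blast
qed

lemma integrable_lebesgue_on_indicator:
  fixes f :: "'a::euclidean_space \<Rightarrow> 'b::{banach, second_countable_topology}"
  assumes "S \<in> sets lebesgue" "T \<in> sets lebesgue" "S \<subseteq> T"
  shows "integrable (lebesgue_on T) (\<lambda>x. indicator S x *\<^sub>R f x) \<longleftrightarrow> integrable (lebesgue_on S) f"
proof -
  have "(\<lambda>x. indicator T x *\<^sub>R indicator S x *\<^sub>R f x) = (\<lambda>x. indicator S x *\<^sub>R f x)"
    using assms(3) by (auto simp: fun_eq_iff indicator_def)
  then show ?thesis using assms by (simp add: integrable_restrict_space)
qed

lemma integral_lebesgue_on_indicator: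
  fixes f :: "'a::euclidean_space \<Rightarrow> 'b::{banach, second_countable_topology}"
  assumes "S \<in> sets lebesgue" "T \<in> sets lebesgue" "S \<subseteq> T"
  shows "(LINT x|lebesgue_on T. indicator S x *\<^sub>R f x) = (LINT x|lebesgue_on S. f x)"
proof -
  have "(\<lambda>x. indicator T x *\<^sub>R indicator S x *\<^sub>R f x) = (\<lambda>x. indicator S x *\<^sub>R f x)"
    using assms(3) by (auto simp: fun_eq_iff indicator_def)
  then show ?thesis using assms by (simp add: integral_restrict_space)
qed

lemma integrable_lebesgue_on_subset:
  fixes f :: "'a::euclidean_space \<Rightarrow> 'b::{banach, second_countable_topology}"
  assumes "S \<in> sets lebesgue" "T \<in> sets lebesgue" "S \<subseteq> T" "integrable (lebesgue_on T) f"
  shows "integrable (lebesgue_on S) f"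
proof -
  have "S \<in> sets (lebesgue_on T)" using assms by (simp add: sets_restrict_space_iff)
  then have "integrable (lebesgue_on T) (\<lambda>x. indicator S x *\<^sub>R f x)"
    using assms(4) by (rule integrable_mult_indicator)
  then show ?thesis using integrable_lebesgue_on_indicator[OF assms(1-3)] by blast
qed

lemma integrable_compact_support:
  fixes f :: "'a::euclidean_space \<Rightarrow> 'b::euclidean_space"
  assumes "continuous_on UNIV f" "compact K" "\<And>x. x \<notin> K \<Longrightarrow> f x = 0"
  shows "integrable lborel f"
proof -
  have "integrable lborel (\<lambda>x. indicator K x *\<^sub>R f x)"
    using assms by (intro borel_integrable_compact) (auto intro: continuous_on_subset)
  moreover have "(\<lambda>x. indicator K x *\<^sub>R f x) = f"
    using assms(3) by (auto simp: fun_eq_iff indicator_def)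
  ultimately show ?thesis by simp
qed

lemma integrable_test:
  fixes \<phi> :: "'a::euclidean_space \<Rightarrow> 'b::euclidean_space"
  assumes "\<phi> \<in> test_functions \<Omega>"
  shows "integrable lborel \<phi>"
proof (rule integrable_compact_support)
  show "compact (closure {x. \<phi> x \<noteq> 0})" using assms by (simp add: test_functions_def)
  show "\<phi> x = 0" if "x \<notin> closure {x. \<phi> x \<noteq> 0}" for x using that closure_subset[of "{x. \<phi> x \<noteq> 0}"] by auto
qed (use assms in \<open>simp add: smooth_continuous test_smooth\<close>)

lemma lborel_integral_translation:
  fixes f :: "'a::euclidean_space \<Rightarrow> 'b::{banach, second_countable_topology}"
  assumes "f \<in> borel_measurable borel"
  shows "(LINT x|lborel. f (c + x)) = (LINT x|lborel. f x)"
proof -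
  have "(LINT x|lborel. f x) = (LINT x|distr lborel borel ((+) c). f x)"
    by (simp add: lborel_distr_plus)
  also have "\<dots> = (LINT x|lborel. f (c + x))"
    using assms by (subst integral_distr) auto
  finally show ?thesis by simp
qed

text \<open>The difference quotients of a test function have integral \<open>0\<close> by translation invariance,
  and they converge boundedly to the derivative.\<close>

lemma integral_derivative_test:
  fixes \<phi> :: "'a::euclidean_space \<Rightarrow> 'b::euclidean_space"
  assumes \<phi>: "\<phi> \<in> test_functions \<Omega>" and e: "e \<in> Basis"
  shows "(LINT x|lborel. frechet_derivative \<phi> (at x) e) = 0"
proof -
  let ?D = "\<lambda>x. frechet_derivative \<phi> (at x)"
  let ?K = "closure {x. \<phi> x \<noteq> 0}"
  define s where "s = (\<lambda>n x. real (Suc n) *\<^sub>R (\<phi> (inverse (real (Suc n)) *\<^sub>R e + x) - \<phi> x))"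
  obtain B where B: "0 < B" "\<And>x. norm (?D x e) \<le> B"
    using test_bounded[OF test_derivative[OF \<phi> e]] by blast
  have [measurable]: "\<phi> \<in> borel_measurable borel"
    using smooth_continuous[OF test_smooth[OF \<phi>]] by (rule borel_measurable_continuous_onI)
  have [measurable]: "(\<lambda>x. ?D x e) \<in> borel_measurable borel"
    using smooth_continuous[OF test_smooth[OF test_derivative[OF \<phi> e]]]
    by (rule borel_measurable_continuous_onI)
  obtain R where R: "\<And>x. x \<in> ?K \<Longrightarrow> norm x \<le> R"
  proof -
    have "bounded ?K" using \<phi> by (simp add: test_functions_def compact_imp_bounded)
    then show thesis using that by (auto simp only: bounded_iff)
  qed
  have lim: "(\<lambda>n. s n x) \<longlonglongrightarrow> ?D x e" for x
  proof -
    let ?t = "\<lambda>n. inverse (real (Suc n))"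
    have d: "(\<phi> has_derivative ?D x) (at x)"
      by (rule smooth_has_derivative[OF test_smooth[OF \<phi>]])
    have "filterlim (\<lambda>n. ?t n *\<^sub>R e) (at 0) sequentially"
      unfolding filterlim_at
    proof
      show "(\<lambda>n. ?t n *\<^sub>R e) \<longlonglongrightarrow> 0"
        using tendsto_scaleR[OF LIMSEQ_inverse_real_of_nat tendsto_const[of e]] by simp
      show "\<forall>\<^sub>F n in sequentially. ?t n *\<^sub>R e \<in> UNIV \<and> ?t n *\<^sub>R e \<noteq> 0"
        using nonzero_Basis[OF e] by simp
    qed
    moreover have "((\<lambda>h. norm (\<phi> (x + h) - \<phi> x - ?D x h) / norm h) \<longlongrightarrow> 0) (at 0)"
      using d unfolding has_derivative_at by blast
    ultimately have "(\<lambda>n. norm (\<phi> (x + ?t n *\<^sub>R e) - \<phi> x - ?D x (?t n *\<^sub>R e)) / norm (?t n *\<^sub>R e)) \<longlonglongrightarrow> 0"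
      by (rule filterlim_compose[rotated])
    moreover have "norm (\<phi> (x + ?t n *\<^sub>R e) - \<phi> x - ?D x (?t n *\<^sub>R e)) / norm (?t n *\<^sub>R e)
        = norm (s n x - ?D x e)" for n
    proof -
      have "s n x - ?D x e = real (Suc n) *\<^sub>R (\<phi> (x + ?t n *\<^sub>R e) - \<phi> x - ?D x (?t n *\<^sub>R e))"
        by (simp add: s_def linear_scale[OF has_derivative_linear[OF d]] scaleR_diff_right add.commute
            del: of_nat_Suc)
      then show ?thesis
        using e by (simp add: divide_simps del: of_nat_Suc)
    qed
    ultimately show ?thesis
      by (simp add: LIM_zero_iff tendsto_norm_zero_iff)
  qed
  have bound: "norm (s n x) \<le> B * indicator (cball 0 (R + 1)) x" for n x
  proof (cases "x \<in> cball 0 (R + 1)")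
    case True
    let ?t = "inverse (real (Suc n))"
    have "norm (\<phi> (?t *\<^sub>R e + x) - \<phi> (0 *\<^sub>R e + x)) \<le> B * norm (?t - 0)"
    proof (rule differentiable_bound[where f="\<lambda>t. \<phi> (t *\<^sub>R e + x)" and S=UNIV and f'="\<lambda>t h. h *\<^sub>R ?D (t *\<^sub>R e + x) e"])
      fix t :: real
      have d: "(\<phi> has_derivative ?D (t *\<^sub>R e + x)) (at (t *\<^sub>R e + x))"
        by (rule smooth_has_derivative[OF test_smooth[OF \<phi>]])
      moreover have "((\<lambda>t. t *\<^sub>R e + x) has_derivative (\<lambda>t. t *\<^sub>R e)) (at t)"
        by (auto intro!: derivative_eq_intros)
      ultimately have "((\<lambda>t. \<phi> (t *\<^sub>R e + x)) has_derivative (\<lambda>h. ?D (t *\<^sub>R e + x) (h *\<^sub>R e))) (at t)"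
        using diff_chain_at[of "\<lambda>t. t *\<^sub>R e + x" "\<lambda>t. t *\<^sub>R e" t \<phi>] by (simp add: o_def)
      then show "((\<lambda>t. \<phi> (t *\<^sub>R e + x)) has_derivative (\<lambda>h. h *\<^sub>R ?D (t *\<^sub>R e + x) e)) (at t within UNIV)"
        using linear_scale[OF has_derivative_linear[OF d]] by simp
      show "onorm (\<lambda>h. h *\<^sub>R ?D (t *\<^sub>R e + x) e) \<le> B"
      proof (rule onorm_bound)
        show "norm (h *\<^sub>R ?D (t *\<^sub>R e + x) e) \<le> B * norm h" for h
          using mult_left_mono[OF B(2)[of "t *\<^sub>R e + x"], of "\<bar>h\<bar>"] by (simp add: mult.commute)
      qed (use B in simp)
    qed auto
    then have "norm (\<phi> (?t *\<^sub>R e + x) - \<phi> x) \<le> B * ?t"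
      by simp
    then have "real (Suc n) * norm (\<phi> (?t *\<^sub>R e + x) - \<phi> x) \<le> real (Suc n) * (B * ?t)"
      by (intro mult_left_mono) auto
    also have "\<dots> = B" by (simp del: of_nat_Suc)
    finally show ?thesis using True by (simp add: s_def del: of_nat_Suc)
  next
    case False
    let ?t = "inverse (real (Suc n))"
    have "norm (?t *\<^sub>R e) \<le> 1" using e by (simp add: divide_simps)
    then have "norm (?t *\<^sub>R e + x) \<ge> norm x - 1"
      using norm_triangle_ineq2[of x "- (?t *\<^sub>R e)"] by (simp add: add.commute)
    then have "?t *\<^sub>R e + x \<notin> ?K" "x \<notin> ?K" using False R by (force simp: dist_norm)+
    then have "\<phi> (?t *\<^sub>R e + x) = 0" "\<phi> x = 0" using closure_subset[of "{x. \<phi> x \<noteq> 0}"] by auto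
    then show ?thesis using False by (simp add: s_def)
  qed
  have "(\<lambda>n. LINT x|lborel. s n x) \<longlonglongrightarrow> (LINT x|lborel. ?D x e)"
  proof (rule integral_dominated_convergence)
    show "integrable lborel (\<lambda>x. B * indicator (cball 0 (R + 1)) x :: real)"
      by (intro integrable_mult_right integrable_real_indicator) (use emeasure_lborel_cball_finite in auto)
    show "AE x in lborel. norm (s n x) \<le> B * indicator (cball 0 (R + 1)) x" for n
      using bound by simp
    show "s n \<in> borel_measurable lborel" for n
      unfolding s_def by measurable
  qed (use lim in auto)
  moreover have "(LINT x|lborel. s n x) = 0" for n
  proof -
    have i: "integrable lborel \<phi>" by (rule integrable_test[OF \<phi>])
    then have "integrable lborel (\<lambda>x. \<phi> (inverse (real (Suc n)) *\<^sub>R e + x))"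
    proof -
      have "integrable (distr lborel borel ((+) (inverse (real (Suc n)) *\<^sub>R e))) \<phi>"
        using i by (simp add: lborel_distr_plus)
      then show ?thesis by (subst (asm) integrable_distr_eq) auto
    qed
    then show ?thesis
      using i by (simp add: s_def lborel_integral_translation[of \<phi>] del: of_nat_Suc)
  qed
  ultimately have "(\<lambda>n. 0) \<longlonglongrightarrow> (LINT x|lborel. ?D x e)" by simp
  then show ?thesis unfolding LIMSEQ_const_iff by (rule sym)
qed


lemma integral_lebesgue_on_test:
  fixes \<phi> :: "'a::euclidean_space \<Rightarrow> 'b::euclidean_space"
  assumes \<phi>: "\<phi> \<in> test_functions \<Omega>" and \<Omega>: "\<Omega> \<in> sets lebesgue"
  shows "integrable (lebesgue_on \<Omega>) \<phi>" "(LINT x|lebesgue_on \<Omega>. \<phi> x) = (LINT x|lborel. \<phi> x)"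
proof -
  have *: "(\<lambda>x. indicator \<Omega> x *\<^sub>R \<phi> x) = \<phi>"
    using test_zero_outside[OF \<phi>] by (auto simp: fun_eq_iff indicator_def)
  have i: "integrable lborel \<phi>" by (rule integrable_test[OF \<phi>])
  then show "integrable (lebesgue_on \<Omega>) \<phi>"
    using \<Omega> by (simp add: integrable_restrict_space * integrable_completion)
  show "(LINT x|lebesgue_on \<Omega>. \<phi> x) = (LINT x|lborel. \<phi> x)"
    using \<Omega> i by (simp add: integral_restrict_space * integral_completion)
qed

lemma integration_by_parts_test:
  fixes \<phi> :: "'a::euclidean_space \<Rightarrow> real" and g :: "'a \<Rightarrow> 'b::euclidean_space"
  assumes \<phi>: "\<phi> \<in> test_functions \<Omega>" and g: "smooth g" and e: "e \<in> Basis" and \<Omega>: "\<Omega> \<in> sets lebesgue"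
  shows "(LINT x|lebesgue_on \<Omega>. frechet_derivative \<phi> (at x) e *\<^sub>R g x)
    = - (LINT x|lebesgue_on \<Omega>. \<phi> x *\<^sub>R frechet_derivative g (at x) e)"
proof -
  have p: "(\<lambda>x. \<phi> x *\<^sub>R g x) \<in> test_functions \<Omega>"
    by (rule test_scaleR_smooth[OF \<phi> g])
  have der: "((\<lambda>x. \<phi> x *\<^sub>R g x) has_derivative
      (\<lambda>h. \<phi> x *\<^sub>R frechet_derivative g (at x) h + frechet_derivative \<phi> (at x) h *\<^sub>R g x)) (at x)" for x
    by (rule bounded_bilinear.FDERIV[OF bounded_bilinear_scaleR smooth_has_derivative[OF test_smooth[OF \<phi>]]
          smooth_has_derivative[OF g]])
  have eq: "frechet_derivative (\<lambda>x. \<phi> x *\<^sub>R g x) (at x)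
      = (\<lambda>h. \<phi> x *\<^sub>R frechet_derivative g (at x) h + frechet_derivative \<phi> (at x) h *\<^sub>R g x)" for x
    using frechet_derivative_at[OF der] by simp
  have t1: "(\<lambda>x. \<phi> x *\<^sub>R frechet_derivative g (at x) e) \<in> test_functions \<Omega>"
    by (rule test_scaleR_smooth[OF \<phi> smooth_frechet_derivative[OF g e]])
  have t2: "(\<lambda>x. frechet_derivative \<phi> (at x) e *\<^sub>R g x) \<in> test_functions \<Omega>"
    by (rule test_scaleR_smooth[OF test_derivative[OF \<phi> e] g])
  have "0 = (LINT x|lborel. \<phi> x *\<^sub>R frechet_derivative g (at x) e + frechet_derivative \<phi> (at x) e *\<^sub>R g x)"
    using integral_derivative_test[OF p e] by (simp add: eq)
  also have "\<dots> = (LINT x|lborel. \<phi> x *\<^sub>R frechet_derivative g (at x) e)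
      + (LINT x|lborel. frechet_derivative \<phi> (at x) e *\<^sub>R g x)"
    by (intro Bochner_Integration.integral_add integrable_test[OF t1] integrable_test[OF t2])
  finally show ?thesis
    using integral_lebesgue_on_test(2)[OF t1 \<Omega>] integral_lebesgue_on_test(2)[OF t2 \<Omega>]
    by (simp add: eq_neg_iff_add_eq_0 add.commute)
qed

lemma integrable_test_scaleR:
  fixes \<phi> :: "'a::euclidean_space \<Rightarrow> real" and g :: "'a \<Rightarrow> 'b::{banach, second_countable_topology}"
  assumes \<phi>: "\<phi> \<in> test_functions \<Omega>" and g: "loc_integrable \<Omega> g" and \<Omega>: "\<Omega> \<in> sets lebesgue"
  shows "integrable (lebesgue_on \<Omega>) (\<lambda>x. \<phi> x *\<^sub>R g x)"
proof -
  let ?K = "closure {x. \<phi> x \<noteq> 0}"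
  have K: "compact ?K" "?K \<subseteq> \<Omega>" using \<phi> unfolding test_functions_def by blast+
  then have Ks: "?K \<in> sets lebesgue" by (simp add: compact_imp_closed)
  have gK: "integrable (lebesgue_on \<Omega>) (\<lambda>x. indicator ?K x *\<^sub>R g x)"
    using g K \<Omega> Ks unfolding loc_integrable_def by (subst integrable_lebesgue_on_indicator) auto
  obtain B where B: "0 < B" "\<And>x. norm (\<phi> x) \<le> B" using test_bounded[OF \<phi>] by blast
  have "\<phi> \<in> borel_measurable borel"
    by (rule borel_measurable_continuous_onI[OF smooth_continuous[OF test_smooth[OF \<phi>]]])
  then have m: "\<phi> \<in> borel_measurable (lebesgue_on \<Omega>)"
    by (intro measurable_restrict_space1 measurable_completion) simp
  have "integrable (lebesgue_on \<Omega>) (\<lambda>x. \<phi> x *\<^sub>R (indicator ?K x *\<^sub>R g x))"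
  proof (rule Bochner_Integration.integrable_bound)
    show "integrable (lebesgue_on \<Omega>) (\<lambda>x. B *\<^sub>R norm (indicator ?K x *\<^sub>R g x))"
      using gK by (intro integrable_scaleR_right integrable_norm) auto
    show "(\<lambda>x. \<phi> x *\<^sub>R (indicator ?K x *\<^sub>R g x)) \<in> borel_measurable (lebesgue_on \<Omega>)"
      using m borel_measurable_integrable[OF gK] by (rule borel_measurable_scaleR)
    show "AE x in lebesgue_on \<Omega>. norm (\<phi> x *\<^sub>R (indicator ?K x *\<^sub>R g x))
        \<le> norm (B *\<^sub>R norm (indicator ?K x *\<^sub>R g x))"
    proof (rule AE_I2)
      fix x
      have "norm (\<phi> x *\<^sub>R (indicator ?K x *\<^sub>R g x)) = \<bar>\<phi> x\<bar> * norm (indicator ?K x *\<^sub>R g x)"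
        by (rule norm_scaleR)
      also have "\<dots> \<le> B * norm (indicator ?K x *\<^sub>R g x)"
        using B(2)[of x] by (intro mult_right_mono) auto
      finally show "norm (\<phi> x *\<^sub>R (indicator ?K x *\<^sub>R g x)) \<le> norm (B *\<^sub>R norm (indicator ?K x *\<^sub>R g x))"
        using B(1) by simp
    qed
  qed
  moreover have "(\<lambda>x. \<phi> x *\<^sub>R (indicator ?K x *\<^sub>R g x)) = (\<lambda>x. \<phi> x *\<^sub>R g x)"
  proof
    fix x
    have "x \<in> ?K" if "\<phi> x \<noteq> 0" using that closure_subset[of "{x. \<phi> x \<noteq> 0}"] by auto
    then show "\<phi> x *\<^sub>R (indicator ?K x *\<^sub>R g x) = \<phi> x *\<^sub>R g x" by (cases "\<phi> x = 0") auto
  qed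
  ultimately show ?thesis by simp
qed

section \<open>The fundamental lemma of the calculus of variations\<close>

text \<open>The function \<open>exp (- 1 / (n t))\<close>, continued by \<open>0\<close> to \<open>t \<le> 0\<close>, increases to the indicator of
\<open>t > 0\<close>. The product of such functions of the distances to all faces of a box is smooth.\<close>

lemma box_bump:
  fixes a b :: "'a::euclidean_space"
  assumes sub: "cbox a b \<subseteq> \<Omega>"
  obtains \<beta> :: "nat \<Rightarrow> 'a \<Rightarrow> real"
  where "\<And>n. \<beta> n \<in> test_functions \<Omega>" "\<And>n x. \<bar>\<beta> n x\<bar> \<le> indicator (cbox a b) x"
    "\<And>x. (\<lambda>n. \<beta> n x) \<longlonglongrightarrow> indicator (box a b) x"
proof -
  define \<beta> where "\<beta> = (\<lambda>n x. \<Prod>e\<in>Basis. flat 1 (real n * (x \<bullet> e - a \<bullet> e)) * flat 1 (real n * (b \<bullet> e - x \<bullet> e)))"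
  have flat1: "0 \<le> flat 1 t" "flat 1 t \<le> 1" "flat 1 t \<noteq> 0 \<longleftrightarrow> 0 < t" for t
    by (auto simp: flat_def)
  have outside: "\<beta> n x = 0" if x: "x \<notin> box a b" for n x
  proof -
    obtain e where e: "e \<in> Basis" "\<not> (a \<bullet> e < x \<bullet> e \<and> x \<bullet> e < b \<bullet> e)"
      using x unfolding mem_box by blast
    have z: "flat 1 (real n * t) = 0" if "t \<le> 0" for t
      using that by (simp add: flat_def zero_less_mult_iff)
    have "flat 1 (real n * (x \<bullet> e - a \<bullet> e)) * flat 1 (real n * (b \<bullet> e - x \<bullet> e)) = 0"
    proof (cases "a \<bullet> e < x \<bullet> e")
      case True
      then have "flat 1 (real n * (b \<bullet> e - x \<bullet> e)) = 0" using e(2) by (intro z) auto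
      then show ?thesis by simp
    next
      case False
      then have "flat 1 (real n * (x \<bullet> e - a \<bullet> e)) = 0" by (intro z) auto
      then show ?thesis by simp
    qed
    then show ?thesis unfolding \<beta>_def using e(1) by (intro prod_zero[OF finite_Basis]) blast
  qed
  have "smooth (\<beta> n)" for n
    unfolding \<beta>_def
  proof (intro smooth_prod smooth_mult)
    fix e :: 'a assume "e \<in> Basis"
    have "smooth (\<lambda>x. real n * (x \<bullet> e + - (a \<bullet> e)))" "smooth (\<lambda>x. real n * (b \<bullet> e + (-1) * (x \<bullet> e)))"
      by (intro smooth_mult smooth_add smooth_const smooth_inner)+
    then show "smooth (\<lambda>x. flat 1 (real n * (x \<bullet> e - a \<bullet> e)))" "smooth (\<lambda>x. flat 1 (real n * (b \<bullet> e - x \<bullet> e)))"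
      by (auto simp: smooth_def intro!: C_k_flat)
  qed
  moreover have cl: "closure {x. \<beta> n x \<noteq> 0} \<subseteq> cbox a b" for n
    using outside box_subset_cbox[of a b] by (intro closure_minimal closed_cbox) auto
  moreover have "compact (closure {x. \<beta> n x \<noteq> 0})" for n
    using bounded_subset[OF bounded_cbox cl] by (simp only: compact_eq_bounded_closed closed_closure simp_thms)
  ultimately have "\<beta> n \<in> test_functions \<Omega>" for n
    unfolding test_functions_def smooth_def using order_trans[OF cl sub] by blast
  moreover have "\<bar>\<beta> n x\<bar> \<le> indicator (cbox a b) x" for n x
  proof (cases "x \<in> box a b")
    case True
    have "0 \<le> \<beta> n x" unfolding \<beta>_def using flat1 by (intro prod_nonneg) auto
    moreover have "\<beta> n x \<le> 1" unfolding \<beta>_def using flat1 by (intro prod_le_1) (auto intro: mult_le_one)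
    ultimately show ?thesis using True box_subset_cbox[of a b] by auto
  qed (simp add: outside)
  moreover have "(\<lambda>n. \<beta> n x) \<longlonglongrightarrow> indicator (box a b) x" for x
  proof (cases "x \<in> box a b")
    case True
    have flat_lim: "(\<lambda>n. flat 1 (real n * t)) \<longlonglongrightarrow> 1" if "0 < t" for t
    proof -
      have "(\<lambda>n. exp (- (inverse (real n) * inverse t))) \<longlonglongrightarrow> exp (- (0 * inverse t))"
        by (intro tendsto_intros tendsto_inverse_0_at_top filterlim_real_sequentially)
      moreover have "\<forall>\<^sub>F n in sequentially. exp (- (inverse (real n) * inverse t)) = flat 1 (real n * t)"
        using eventually_gt_at_top[of 0] by eventually_elim (use that in \<open>simp add: flat_def\<close>)
      ultimately show ?thesis by (auto intro: Lim_transform_eventually)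
    qed
    have "(\<lambda>n. \<beta> n x) \<longlonglongrightarrow> (\<Prod>e\<in>(Basis::'a set). 1 * 1)"
      unfolding \<beta>_def using True by (intro tendsto_prod tendsto_mult flat_lim) (auto simp: mem_box)
    then show ?thesis using True by simp
  qed (simp add: outside)
  ultimately show ?thesis using that by blast
qed

text \<open>Lebesgue's differentiation theorem for the cubes with corner \<open>x\<close>: at almost every point
the averages converge to the value.\<close>

lemma box_averages_imp_AE_le:
  fixes U :: "'a::euclidean_space \<Rightarrow> real" and K :: "'a \<Rightarrow> ennreal"
  assumes U: "integrable lebesgue U"
    and avg: "\<And>x d. x \<in> \<Omega> \<Longrightarrow> 0 < d \<Longrightarrow> d \<le> 1 \<Longrightarrow>
      ennreal (integral (cbox x (x + d *\<^sub>R One)) U / d ^ DIM('a)) \<le> K x"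
  shows "AE x in lborel. x \<in> \<Omega> \<longrightarrow> ennreal (U x) \<le> K x"
proof -
  have "U absolutely_integrable_on UNIV"
    using U by (simp add: set_integrable_def)
  then have "U integrable_on cbox a b" for a b
    by (meson integrable_on_subcbox set_lebesgue_integral_eq_integral(1) subset_UNIV)
  then obtain N where N: "negligible N"
    "\<And>x e. x \<notin> N \<Longrightarrow> 0 < e \<Longrightarrow> \<exists>d>0. \<forall>h. 0 < h \<and> h < d \<longrightarrow>
        norm (integral (cbox x (x + h *\<^sub>R One)) U /\<^sub>R h ^ DIM('a) - U x) < e"
    using integrable_ccontinuous_explicit[of U] by metis
  have "ennreal (U x) \<le> K x" if "x \<notin> N" "x \<in> \<Omega>" for x
  proof (rule ennreal_le_epsilon)
    fix e :: real assume "0 < e"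
    then obtain d where d: "d > 0" "\<forall>h. 0 < h \<and> h < d \<longrightarrow>
        norm (integral (cbox x (x + h *\<^sub>R One)) U /\<^sub>R h ^ DIM('a) - U x) < e"
      using N(2)[OF \<open>x \<notin> N\<close>] by blast
    define h where "h = min (d/2) 1"
    have h: "0 < h" "h < d" "h \<le> 1" using d(1) by (auto simp: h_def)
    let ?I = "integral (cbox x (x + h *\<^sub>R One)) U / h ^ DIM('a)"
    have "norm (integral (cbox x (x + h *\<^sub>R One)) U /\<^sub>R h ^ DIM('a) - U x) < e" using d(2) h by blast
    then have "U x \<le> ?I + e" by (simp add: divide_inverse mult.commute)
    then have "ennreal (U x) \<le> ennreal (?I + e)" by (rule ennreal_leI)
    also have "\<dots> \<le> ennreal (max 0 ?I + e)" by (intro ennreal_leI) auto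
    also have "\<dots> = ennreal (max 0 ?I) + ennreal e" using \<open>0 < e\<close> by (intro ennreal_plus) auto
    also have "ennreal (max 0 ?I) = ennreal ?I" by (simp add: max_def ennreal_neg)
    also have "ennreal ?I + ennreal e \<le> K x + ennreal e" using avg[OF \<open>x \<in> \<Omega>\<close> h(1,3)] by (rule add_right_mono)
    finally show "ennreal (U x) \<le> K x + ennreal e" .
  qed
  moreover have "AE x in lebesgue. x \<notin> N"
    using N(1) by (intro AE_not_in) (simp add: negligible_iff_null_sets)
  ultimately have "AE x in lebesgue. x \<in> \<Omega> \<longrightarrow> ennreal (U x) \<le> K x"
    by (auto elim: eventually_mono)
  then show ?thesis by (simp add: AE_completion_iff)
qed

lemma box_integrals_zero_imp_AE_zero:
  fixes f :: "'a::euclidean_space \<Rightarrow> real"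
  assumes f: "integrable lebesgue f" and zero: "\<And>a b. integral (cbox a b) f = 0"
  shows "AE x in lebesgue. f x = 0"
proof -
  have "AE x in lborel. x \<in> UNIV \<longrightarrow> ennreal (f x) \<le> 0"
    by (rule box_averages_imp_AE_le[OF f]) (simp add: zero)
  moreover have "AE x in lborel. x \<in> UNIV \<longrightarrow> ennreal (- f x) \<le> 0"
    by (rule box_averages_imp_AE_le[of "\<lambda>x. - f x"]) (use f in \<open>simp_all add: zero\<close>)
  ultimately have "AE x in lborel. f x = 0"
    by eventually_elim (auto simp: ennreal_eq_0_iff)
  then show ?thesis by (rule AE_completion)
qed

text \<open>Bump functions show that the integral over every closed box in \<open>\<Omega>\<close> vanishes. As \<open>f\<close> is only
locally integrable, \<open>\<Omega>\<close> is exhausted by countably many boxes and \<open>f\<close> is cut off to one of them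
before the differentiation theorem is applied.\<close>

lemma fundamental_lemma_real:
  fixes f :: "'a::euclidean_space \<Rightarrow> real"
  assumes "open \<Omega>" and f: "loc_integrable \<Omega> f"
    and zero: "\<And>\<phi>. \<phi> \<in> test_functions \<Omega> \<Longrightarrow> (LINT x|lebesgue_on \<Omega>. \<phi> x * f x) = 0"
  shows "AE x in lebesgue_on \<Omega>. f x = 0"
proof -
  have \<Omega>: "\<Omega> \<in> sets lebesgue" using \<open>open \<Omega>\<close> by simp
  have int: "integrable (lebesgue_on (cbox a b)) f" if "cbox a b \<subseteq> \<Omega>" for a b
    using f that by (simp add: loc_integrable_def)
  have box0: "integral (cbox a b) f = 0" if sub: "cbox a b \<subseteq> \<Omega>" for a b
  proof -
    obtain \<beta> :: "nat \<Rightarrow> 'a \<Rightarrow> real" where \<beta>: "\<And>n. \<beta> n \<in> test_functions \<Omega>" "\<And>n x. \<bar>\<beta> n x\<bar> \<le> indicator (cbox a b) x"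
      "\<And>x. (\<lambda>n. \<beta> n x) \<longlonglongrightarrow> indicator (box a b) x"
      using box_bump[OF sub] by blast
    have i: "integrable (lebesgue_on \<Omega>) (\<lambda>x. indicator (cbox a b) x *\<^sub>R f x)"
      using int[OF sub] \<Omega> sub by (subst integrable_lebesgue_on_indicator) auto
    have ibox: "integrable (lebesgue_on (box a b)) f"
      by (rule integrable_lebesgue_on_subset[OF _ _ box_subset_cbox int[OF sub]]) auto
    have "(\<lambda>n. LINT x|lebesgue_on \<Omega>. \<beta> n x * f x) \<longlonglongrightarrow> (LINT x|lebesgue_on \<Omega>. indicator (box a b) x *\<^sub>R f x)"
    proof (rule integral_dominated_convergence)
      show "integrable (lebesgue_on \<Omega>) (\<lambda>x. norm (indicator (cbox a b) x *\<^sub>R f x))"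
        using i by (rule integrable_norm)
      show "(\<lambda>x. indicator (box a b) x *\<^sub>R f x) \<in> borel_measurable (lebesgue_on \<Omega>)"
        using ibox \<Omega> sub box_subset_cbox[of a b]
        by (intro borel_measurable_integrable, subst integrable_lebesgue_on_indicator) auto
      show "(\<lambda>x. \<beta> n x * f x) \<in> borel_measurable (lebesgue_on \<Omega>)" for n
        using integrable_test_scaleR[OF \<beta>(1) f \<Omega>] by (intro borel_measurable_integrable) simp
      show "AE x in lebesgue_on \<Omega>. (\<lambda>n. \<beta> n x * f x) \<longlonglongrightarrow> indicator (box a b) x *\<^sub>R f x"
        using \<beta>(3) by (auto intro!: AE_I2 tendsto_mult)
      show "AE x in lebesgue_on \<Omega>. norm (\<beta> n x * f x) \<le> norm (indicator (cbox a b) x *\<^sub>R f x)" for n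
        using \<beta>(2) by (auto intro!: AE_I2 mult_right_mono simp: abs_mult)
    qed
    then have "(LINT x|lebesgue_on \<Omega>. indicator (box a b) x *\<^sub>R f x) = 0"
      unfolding zero[OF \<beta>(1)] LIMSEQ_const_iff by (rule sym)
    then have "(LINT x|lebesgue_on (box a b). f x) = 0"
      using \<Omega> sub box_subset_cbox[of a b] by (subst (asm) integral_lebesgue_on_indicator) auto
    then have "integral (box a b) f = 0"
      using lebesgue_integral_eq_integral[OF ibox] by simp
    then show ?thesis by (simp add: integral_open_interval)
  qed
  obtain \<D> where \<D>: "countable \<D>" "\<And>X. X \<in> \<D> \<Longrightarrow> X \<subseteq> \<Omega> \<and> (\<exists>a b. X = cbox a b)" "\<Union>\<D> = \<Omega>"
  proof -
    obtain \<D> where "countable \<D>" "\<D> \<subseteq> Pow \<Omega>" "\<And>X. X \<in> \<D> \<Longrightarrow> \<exists>a b. X = cbox a b" "\<Union>\<D> = \<Omega>"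
      using open_countable_Union_open_cbox[OF \<open>open \<Omega>\<close>] by blast
    then show ?thesis using that[of \<D>] by blast
  qed
  have "AE x in lebesgue. x \<in> X \<longrightarrow> f x = 0" if "X \<in> \<D>" for X
  proof -
    obtain c d where X: "X = cbox c d" "cbox c d \<subseteq> \<Omega>" using \<D>(2)[OF \<open>X \<in> \<D>\<close>] by blast
    have "AE x in lebesgue. indicator X x *\<^sub>R f x = 0"
    proof (rule box_integrals_zero_imp_AE_zero)
      show "integrable lebesgue (\<lambda>x. indicator X x *\<^sub>R f x)"
        using int[OF X(2)] X(1) by (simp add: integrable_restrict_space)
      fix a b
      have "(\<lambda>x. indicator X x *\<^sub>R f x) = (\<lambda>x. if x \<in> cbox c d then f x else 0)"
        by (auto simp: X(1) fun_eq_iff)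
      then have "integral (cbox a b) (\<lambda>x. indicator X x *\<^sub>R f x) = integral (cbox a b \<inter> cbox c d) f"
        by (simp only: integral_restrict_Int Int_commute)
      also have "\<dots> = 0"
        unfolding Int_interval by (rule box0) (use X(2) in \<open>auto simp: Int_interval[symmetric]\<close>)
      finally show "integral (cbox a b) (\<lambda>x. indicator X x *\<^sub>R f x) = 0" .
    qed
    then show ?thesis by eventually_elim (auto simp: indicator_def split: if_splits)
  qed
  then have "AE x in lebesgue. \<forall>X\<in>\<D>. x \<in> X \<longrightarrow> f x = 0"
    unfolding AE_ball_countable[OF \<D>(1)] by blast
  then have "AE x in lebesgue. x \<in> \<Omega> \<longrightarrow> f x = 0"
    by eventually_elim (use \<D>(3) in blast)
  then show ?thesis using \<Omega> by (simp add: AE_restrict_space_iff)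
qed

lemma has_weak_deriv_unique:
  fixes v g g' :: "'a::euclidean_space \<Rightarrow> complex"
  assumes "open \<Omega>" and g: "has_weak_deriv \<Omega> e v g" and g': "has_weak_deriv \<Omega> e v g'"
  shows "AE x in lebesgue_on \<Omega>. g x = g' x"
proof -
  have \<Omega>: "\<Omega> \<in> sets lebesgue" using \<open>open \<Omega>\<close> by simp
  have loc: "loc_integrable \<Omega> g" "loc_integrable \<Omega> g'" using g g' by (auto simp: has_weak_deriv_def)
  then have l: "loc_integrable \<Omega> (\<lambda>x. g x - g' x)" by (auto simp: loc_integrable_def)
  have z: "(LINT x|lebesgue_on \<Omega>. \<phi> x *\<^sub>R (g x - g' x)) = 0" if "\<phi> \<in> test_functions \<Omega>" for \<phi> :: "'a \<Rightarrow> real"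
  proof -
    have "(LINT x|lebesgue_on \<Omega>. \<phi> x *\<^sub>R (g x - g' x))
      = (LINT x|lebesgue_on \<Omega>. \<phi> x *\<^sub>R g x) - (LINT x|lebesgue_on \<Omega>. \<phi> x *\<^sub>R g' x)"
      unfolding scaleR_diff_right
      by (intro Bochner_Integration.integral_diff integrable_test_scaleR[OF that _ \<Omega>] loc)
    also have "\<dots> = 0"
    proof -
      have "- (LINT x|lebesgue_on \<Omega>. \<phi> x *\<^sub>R g x) = - (LINT x|lebesgue_on \<Omega>. \<phi> x *\<^sub>R g' x)"
        using bspec[OF conjunct2[OF conjunct2[OF g[unfolded has_weak_deriv_def]]] that]
          bspec[OF conjunct2[OF conjunct2[OF g'[unfolded has_weak_deriv_def]]] that] by (rule trans[OF sym])
      then show ?thesis by simp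
    qed
    finally show ?thesis .
  qed
  have "AE x in lebesgue_on \<Omega>. Re (g x - g' x) = 0"
  proof (rule fundamental_lemma_real[OF \<open>open \<Omega>\<close>])
    show "loc_integrable \<Omega> (\<lambda>x. Re (g x - g' x))"
      using l integrable_Re unfolding loc_integrable_def by fast
    fix \<phi> :: "'a \<Rightarrow> real" assume "\<phi> \<in> test_functions \<Omega>"
    then have "Re (LINT x|lebesgue_on \<Omega>. \<phi> x *\<^sub>R (g x - g' x)) = 0" using z by simp
    then show "(LINT x|lebesgue_on \<Omega>. \<phi> x * Re (g x - g' x)) = 0"
      using integral_Re[OF integrable_test_scaleR[OF \<open>\<phi> \<in> test_functions \<Omega>\<close> l \<Omega>]] by simp
  qed
  moreover have "AE x in lebesgue_on \<Omega>. Im (g x - g' x) = 0"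
  proof (rule fundamental_lemma_real[OF \<open>open \<Omega>\<close>])
    show "loc_integrable \<Omega> (\<lambda>x. Im (g x - g' x))"
      using l integrable_Im unfolding loc_integrable_def by fast
    fix \<phi> :: "'a \<Rightarrow> real" assume "\<phi> \<in> test_functions \<Omega>"
    then have "Im (LINT x|lebesgue_on \<Omega>. \<phi> x *\<^sub>R (g x - g' x)) = 0" using z by simp
    then show "(LINT x|lebesgue_on \<Omega>. \<phi> x * Im (g x - g' x)) = 0"
      using integral_Im[OF integrable_test_scaleR[OF \<open>\<phi> \<in> test_functions \<Omega>\<close> l \<Omega>]] by simp
  qed
  ultimately show ?thesis by eventually_elim (simp add: complex_eq_iff)
qed

section \<open>Square-integrable functions\<close>

definition square_integrable :: "'a measure \<Rightarrow> ('a \<Rightarrow> real) \<Rightarrow> bool" where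
  "square_integrable M f \<longleftrightarrow> f \<in> borel_measurable M \<and> integrable M (\<lambda>x. (f x)\<^sup>2)"

lemma square_integrable_measurable: "square_integrable M f \<Longrightarrow> f \<in> borel_measurable M"
  by (simp add: square_integrable_def)

lemma square_integrable_bound:
  assumes "square_integrable M g" "f \<in> borel_measurable M" "AE x in M. \<bar>f x\<bar> \<le> \<bar>g x\<bar>"
  shows "square_integrable M f"
  unfolding square_integrable_def
proof
  have "integrable M (\<lambda>x. (g x)\<^sup>2)" using assms(1) by (simp add: square_integrable_def)
  then show "integrable M (\<lambda>x. (f x)\<^sup>2)"
  proof (rule Bochner_Integration.integrable_bound)
    show "AE x in M. norm ((f x)\<^sup>2) \<le> norm ((g x)\<^sup>2)"
      using assms(3) by eventually_elim (simp add: abs_le_square_iff)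
  qed (use assms(2) in measurable)
qed (rule assms(2))

lemma integrable_mult_square_integrable:
  assumes "square_integrable M f" "square_integrable M g"
  shows "integrable M (\<lambda>x. f x * g x)"
proof (rule Bochner_Integration.integrable_bound)
  show "integrable M (\<lambda>x. (f x)\<^sup>2 + (g x)\<^sup>2)"
    using assms by (intro Bochner_Integration.integrable_add) (auto simp: square_integrable_def)
  show "AE x in M. norm (f x * g x) \<le> norm ((f x)\<^sup>2 + (g x)\<^sup>2)"
  proof (rule AE_I2)
    fix x
    have "2 * \<bar>f x\<bar> * \<bar>g x\<bar> \<le> (f x)\<^sup>2 + (g x)\<^sup>2"
      using sum_squares_bound[of "\<bar>f x\<bar>" "\<bar>g x\<bar>"] by simp
    moreover have "0 \<le> \<bar>f x\<bar> * \<bar>g x\<bar>" by simp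
    ultimately have "\<bar>f x\<bar> * \<bar>g x\<bar> \<le> (f x)\<^sup>2 + (g x)\<^sup>2" by linarith
    then show "norm (f x * g x) \<le> norm ((f x)\<^sup>2 + (g x)\<^sup>2)"
      by (simp add: abs_mult)
  qed
qed (use assms in \<open>auto simp: square_integrable_def\<close>)

lemma square_integrable_add:
  assumes "square_integrable M f" "square_integrable M g"
  shows "square_integrable M (\<lambda>x. f x + g x)"
  using assms integrable_mult_square_integrable[OF assms]
  by (auto simp: square_integrable_def power2_sum mult.assoc)

lemma square_integrable_cmult:
  "square_integrable M f \<Longrightarrow> square_integrable M (\<lambda>x. c * f x)"
  by (auto simp: square_integrable_def power_mult_distrib)

lemma square_integrable_diff:
  assumes "square_integrable M f" "square_integrable M g"
  shows "square_integrable M (\<lambda>x. f x - g x)"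
  using square_integrable_add[OF assms(1) square_integrable_cmult[OF assms(2), of "-1"]] by simp

lemma square_integrable_abs:
  "square_integrable M f \<Longrightarrow> square_integrable M (\<lambda>x. \<bar>f x\<bar>)"
  by (auto simp: square_integrable_def)

lemma square_integrable_bounded_mult:
  assumes "square_integrable M f" "b \<in> borel_measurable M" "AE x in M. \<bar>b x\<bar> \<le> B"
  shows "square_integrable M (\<lambda>x. b x * f x)"
proof (rule square_integrable_bound[OF square_integrable_cmult[OF assms(1), of B]])
  show "AE x in M. \<bar>b x * f x\<bar> \<le> \<bar>B * f x\<bar>"
    using assms(3) by eventually_elim (auto simp: abs_mult intro!: mult_right_mono)
qed (use assms in \<open>auto simp: square_integrable_def\<close>)

lemma (in finite_measure) square_integrable_bounded:
  fixes f :: "'a \<Rightarrow> real"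
  assumes "f \<in> borel_measurable M" "AE x in M. \<bar>f x\<bar> \<le> B"
  shows "square_integrable M f"
proof (rule square_integrable_bound)
  show "square_integrable M (\<lambda>x. B)" by (simp add: square_integrable_def)
  show "AE x in M. \<bar>f x\<bar> \<le> \<bar>B\<bar>" using assms(2) by eventually_elim simp
qed (rule assms(1))

lemma (in finite_measure) integrable_square_integrable:
  fixes f :: "'a \<Rightarrow> real"
  assumes "square_integrable M f"
  shows "integrable M f"
  using integrable_mult_square_integrable[OF assms, of "\<lambda>x. 1"] by (simp add: square_integrable_def)

lemma Cauchy_Schwarz_integral:
  assumes f: "square_integrable M f" and g: "square_integrable M g"
  shows "\<bar>LINT x|M. f x * g x\<bar> \<le> sqrt (LINT x|M. (f x)\<^sup>2) * sqrt (LINT x|M. (g x)\<^sup>2)"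
proof -
  let ?A = "LINT x|M. (f x)\<^sup>2" and ?B = "LINT x|M. f x * g x" and ?C = "LINT x|M. (g x)\<^sup>2"
  have fg: "integrable M (\<lambda>x. f x * g x)" by (rule integrable_mult_square_integrable[OF f g])
  have quad: "0 \<le> ?A * s\<^sup>2 + 2 * s * t * ?B + ?C * t\<^sup>2" for s t
  proof -
    have "0 \<le> (LINT x|M. (s * f x + t * g x)\<^sup>2)" by (rule Bochner_Integration.integral_nonneg) simp
    also have "\<dots> = (LINT x|M. s\<^sup>2 * (f x)\<^sup>2 + (2 * s * t) * (f x * g x) + t\<^sup>2 * (g x)\<^sup>2)"
      by (intro Bochner_Integration.integral_cong) (auto simp: power2_eq_square algebra_simps)
    also have "\<dots> = s\<^sup>2 * ?A + (2 * s * t) * ?B + t\<^sup>2 * ?C"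
      using f g fg by (simp add: square_integrable_def)
    finally show ?thesis by (simp add: algebra_simps)
  qed
  have AC: "0 \<le> ?A" "0 \<le> ?C" by (auto intro: Bochner_Integration.integral_nonneg)
  have "?B\<^sup>2 \<le> ?A * ?C"
  proof (cases "?C = 0")
    case True
    have "?B = 0"
    proof (rule ccontr)
      assume "?B \<noteq> 0"
      have "0 \<le> ?A * 1\<^sup>2 + 2 * 1 * (- (?A + 1) / (2 * ?B)) * ?B + ?C * (- (?A + 1) / (2 * ?B))\<^sup>2"
        by (rule quad)
      also have "\<dots> = - 1" using True \<open>?B \<noteq> 0\<close> by (simp add: field_simps)
      finally show False by simp
    qed
    then show ?thesis using True by simp
  next
    case False
    then have C: "0 < ?C" using AC(2) by (metis order_less_le)
    have "0 \<le> ?A * ?C\<^sup>2 + 2 * ?C * (- ?B) * ?B + ?C * (- ?B)\<^sup>2" by (rule quad)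
    also have "\<dots> = ?C * (?A * ?C - ?B\<^sup>2)" by (simp add: power2_eq_square algebra_simps)
    finally show ?thesis using C by (simp add: zero_le_mult_iff)
  qed
  then have "sqrt (?B\<^sup>2) \<le> sqrt (?A * ?C)" by (rule real_sqrt_le_mono)
  then show ?thesis by (simp add: real_sqrt_mult)
qed

lemma integral_mult_tendsto_zero:
  assumes f: "\<And>k. square_integrable M (f k)" and g: "\<And>k. square_integrable M (g k)"
    and lim: "(\<lambda>k. LINT x|M. (f k x)\<^sup>2) \<longlonglongrightarrow> 0" and bound: "\<And>k. (LINT x|M. (g k x)\<^sup>2) \<le> C"
  shows "(\<lambda>k. LINT x|M. f k x * g k x) \<longlonglongrightarrow> 0"
proof (rule Lim_null_comparison)
  show "\<forall>\<^sub>F k in sequentially. norm (LINT x|M. f k x * g k x) \<le> sqrt (LINT x|M. (f k x)\<^sup>2) * sqrt C"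
  proof (rule always_eventually, rule allI)
    fix k
    have "norm (LINT x|M. f k x * g k x) \<le> sqrt (LINT x|M. (f k x)\<^sup>2) * sqrt (LINT x|M. (g k x)\<^sup>2)"
      using Cauchy_Schwarz_integral[OF f g] by simp
    also have "\<dots> \<le> sqrt (LINT x|M. (f k x)\<^sup>2) * sqrt C"
      using bound by (intro mult_left_mono) (auto intro: Bochner_Integration.integral_nonneg)
    finally show "norm (LINT x|M. f k x * g k x) \<le> sqrt (LINT x|M. (f k x)\<^sup>2) * sqrt C" .
  qed
  show "(\<lambda>k. sqrt (LINT x|M. (f k x)\<^sup>2) * sqrt C) \<longlonglongrightarrow> 0"
    using tendsto_mult_left_zero[OF tendsto_real_sqrt[OF lim, simplified]] .
qed

section \<open>Weak derivatives\<close>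

lemma Lp_space_2_iff:
  fixes v :: "'a::euclidean_space \<Rightarrow> 'b::{banach, second_countable_topology}"
  shows "v \<in> Lp_space 2 \<Omega> \<longleftrightarrow> v \<in> borel_measurable (lebesgue_on \<Omega>) \<and> integrable (lebesgue_on \<Omega>) (\<lambda>x. (norm (v x))\<^sup>2)"
  by (simp add: Lp_space_def)

text \<open>Lebesgue measure is complete. This is what makes the chosen representative in
\<open>weak_deriv\<close> measurable, which agrees with a square-integrable one only almost everywhere.\<close>

lemma borel_measurable_lebesgue_on_AE:
  fixes f g :: "'a::euclidean_space \<Rightarrow> 'b::{second_countable_topology, metric_space}"
  assumes \<Omega>: "\<Omega> \<in> sets lebesgue" and f: "f \<in> borel_measurable (lebesgue_on \<Omega>)"
    and eq: "AE x in lebesgue_on \<Omega>. f x = g x"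
  shows "g \<in> borel_measurable (lebesgue_on \<Omega>)"
proof (rule measurableI)
  fix S :: "'b set" assume "S \<in> sets borel"
  then have "f -` S \<inter> \<Omega> \<in> sets lebesgue"
    using measurable_sets[OF f] \<Omega> by (simp add: sets_restrict_space_iff)
  moreover have "AE x in lebesgue. x \<in> f -` S \<inter> \<Omega> \<longleftrightarrow> x \<in> g -` S \<inter> \<Omega>"
  proof -
    have "AE x in lebesgue. x \<in> \<Omega> \<longrightarrow> f x = g x" using eq \<Omega> by (simp add: AE_restrict_space_iff)
    then show ?thesis by eventually_elim auto
  qed
  ultimately have "g -` S \<inter> \<Omega> \<in> sets lebesgue"
    using completion.in_sets_AE[of "f -` S \<inter> \<Omega>" "g -` S \<inter> \<Omega>" lborel] by simp
  then show "g -` S \<inter> space (lebesgue_on \<Omega>) \<in> sets (lebesgue_on \<Omega>)"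
    using \<Omega> by (simp add: sets_restrict_space_iff)
qed simp

lemma has_weak_deriv_test:
  fixes \<phi> :: "'a::euclidean_space \<Rightarrow> complex"
  assumes \<phi>: "\<phi> \<in> test_functions \<Omega>" and e: "e \<in> Basis" and "open \<Omega>"
  shows "has_weak_deriv \<Omega> e \<phi> (\<lambda>x. frechet_derivative \<phi> (at x) e)"
proof -
  have \<Omega>: "\<Omega> \<in> sets lebesgue" using \<open>open \<Omega>\<close> by simp
  have loc: "loc_integrable \<Omega> \<psi>" if "\<psi> \<in> test_functions \<Omega>" for \<psi> :: "'a \<Rightarrow> complex"
    unfolding loc_integrable_def
    using integrable_lebesgue_on_subset[OF _ \<Omega> _ integral_lebesgue_on_test(1)[OF that \<Omega>]]
    by (auto simp: compact_imp_closed)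
  show ?thesis
    unfolding has_weak_deriv_def
    using loc[OF \<phi>] loc[OF test_derivative[OF \<phi> e]] integration_by_parts_test[OF _ test_smooth[OF \<phi>] e \<Omega>]
    by blast
qed

lemma has_weak_deriv_weak_deriv:
  "has_weak_deriv \<Omega> e v g \<Longrightarrow> has_weak_deriv \<Omega> e v (weak_deriv \<Omega> e v)"
  unfolding weak_deriv_def by (rule someI[where P="has_weak_deriv \<Omega> e v"])

lemma weak_deriv_AE_eq:
  fixes v g :: "'a::euclidean_space \<Rightarrow> complex"
  assumes "open \<Omega>" "has_weak_deriv \<Omega> e v g"
  shows "AE x in lebesgue_on \<Omega>. weak_deriv \<Omega> e v x = g x"
  using has_weak_deriv_unique[OF assms(1) has_weak_deriv_weak_deriv[OF assms(2)] assms(2)] .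

lemma has_weak_deriv_diff:
  fixes u v g h :: "'a::euclidean_space \<Rightarrow> complex"
  assumes "open \<Omega>" and e: "e \<in> Basis" and u: "has_weak_deriv \<Omega> e u g" and v: "has_weak_deriv \<Omega> e v h"
  shows "has_weak_deriv \<Omega> e (\<lambda>x. u x - v x) (\<lambda>x. g x - h x)"
  unfolding has_weak_deriv_def
proof (intro conjI ballI)
  have \<Omega>: "\<Omega> \<in> sets lebesgue" using \<open>open \<Omega>\<close> by simp
  have loc: "loc_integrable \<Omega> u" "loc_integrable \<Omega> g" "loc_integrable \<Omega> v" "loc_integrable \<Omega> h"
    using u v by (auto simp: has_weak_deriv_def)
  then show "loc_integrable \<Omega> (\<lambda>x. u x - v x)" "loc_integrable \<Omega> (\<lambda>x. g x - h x)"
    by (auto simp: loc_integrable_def)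
  fix \<phi> :: "'a \<Rightarrow> real" assume \<phi>: "\<phi> \<in> test_functions \<Omega>"
  have 1: "(LINT x|lebesgue_on \<Omega>. frechet_derivative \<phi> (at x) e *\<^sub>R u x) = - (LINT x|lebesgue_on \<Omega>. \<phi> x *\<^sub>R g x)"
    using u \<phi> unfolding has_weak_deriv_def by blast
  have 2: "(LINT x|lebesgue_on \<Omega>. frechet_derivative \<phi> (at x) e *\<^sub>R v x) = - (LINT x|lebesgue_on \<Omega>. \<phi> x *\<^sub>R h x)"
    using v \<phi> unfolding has_weak_deriv_def by blast
  have "(LINT x|lebesgue_on \<Omega>. frechet_derivative \<phi> (at x) e *\<^sub>R (u x - v x))
      = (LINT x|lebesgue_on \<Omega>. frechet_derivative \<phi> (at x) e *\<^sub>R u x) - (LINT x|lebesgue_on \<Omega>. frechet_derivative \<phi> (at x) e *\<^sub>R v x)"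
    unfolding scaleR_diff_right
    by (intro Bochner_Integration.integral_diff integrable_test_scaleR[OF test_derivative[OF \<phi> e] _ \<Omega>] loc)
  also have "\<dots> = - ((LINT x|lebesgue_on \<Omega>. \<phi> x *\<^sub>R g x) - (LINT x|lebesgue_on \<Omega>. \<phi> x *\<^sub>R h x))"
    unfolding 1 2 by simp
  also have "\<dots> = - (LINT x|lebesgue_on \<Omega>. \<phi> x *\<^sub>R (g x - h x))"
    unfolding scaleR_diff_right
    by (subst Bochner_Integration.integral_diff) (auto intro!: integrable_test_scaleR[OF \<phi> _ \<Omega>] loc)
  finally show "(LINT x|lebesgue_on \<Omega>. frechet_derivative \<phi> (at x) e *\<^sub>R (u x - v x)) = - (LINT x|lebesgue_on \<Omega>. \<phi> x *\<^sub>R (g x - h x))" .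
qed

lemma sobolev_space_1_2D:
  fixes v :: "'a::euclidean_space \<Rightarrow> complex"
  assumes "open \<Omega>" and v: "v \<in> sobolev_space 1 2 \<Omega>"
  shows "v \<in> Lp_space 2 \<Omega>"
    and "e \<in> Basis \<Longrightarrow> has_weak_deriv \<Omega> e v (weak_deriv \<Omega> e v)"
    and "e \<in> Basis \<Longrightarrow> weak_deriv \<Omega> e v \<in> Lp_space 2 \<Omega>"
proof -
  have \<Omega>: "\<Omega> \<in> sets lebesgue" using \<open>open \<Omega>\<close> by simp
  have *: "v \<in> Lp_space 2 \<Omega>" "\<And>e. e \<in> Basis \<Longrightarrow> \<exists>g\<in>Lp_space 2 \<Omega>. has_weak_deriv \<Omega> e v g"
    using v by auto
  show "v \<in> Lp_space 2 \<Omega>" by (rule *)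
  show "e \<in> Basis \<Longrightarrow> has_weak_deriv \<Omega> e v (weak_deriv \<Omega> e v)"
    using *(2) has_weak_deriv_weak_deriv by blast
  show "weak_deriv \<Omega> e v \<in> Lp_space 2 \<Omega>" if e: "e \<in> Basis"
  proof -
    obtain g where g: "g \<in> Lp_space 2 \<Omega>" "has_weak_deriv \<Omega> e v g" using *(2)[OF e] by blast
    have eq: "AE x in lebesgue_on \<Omega>. g x = weak_deriv \<Omega> e v x"
      using weak_deriv_AE_eq[OF \<open>open \<Omega>\<close> g(2)] by (auto elim: eventually_mono)
    have gm: "g \<in> borel_measurable (lebesgue_on \<Omega>)" using g(1) by (simp add: Lp_space_2_iff)
    have m: "weak_deriv \<Omega> e v \<in> borel_measurable (lebesgue_on \<Omega>)"
      by (rule borel_measurable_lebesgue_on_AE[OF \<Omega> gm eq])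
    have "integrable (lebesgue_on \<Omega>) (\<lambda>x. (norm (weak_deriv \<Omega> e v x))\<^sup>2)"
    proof (rule integrable_cong_AE_imp)
      show "integrable (lebesgue_on \<Omega>) (\<lambda>x. (norm (g x))\<^sup>2)" using g(1) by (simp add: Lp_space_2_iff)
      show "AE x in lebesgue_on \<Omega>. (norm (g x))\<^sup>2 = (norm (weak_deriv \<Omega> e v x))\<^sup>2"
        using eq by eventually_elim simp
    qed (use m in measurable)
    then show ?thesis using m by (simp add: Lp_space_2_iff)
  qed
qed

lemma test_Lp_2:
  fixes \<phi> :: "'a::euclidean_space \<Rightarrow> 'b::euclidean_space"
  assumes \<phi>: "\<phi> \<in> test_functions \<Omega>" and \<Omega>: "\<Omega> \<in> sets lebesgue"
  shows "\<phi> \<in> Lp_space 2 \<Omega>"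
  unfolding Lp_space_2_iff
proof
  have i: "integrable (lebesgue_on \<Omega>) \<phi>" by (rule integral_lebesgue_on_test(1)[OF \<phi> \<Omega>])
  then show m: "\<phi> \<in> borel_measurable (lebesgue_on \<Omega>)" by (rule borel_measurable_integrable)
  obtain B where B: "0 < B" "\<And>x. norm (\<phi> x) \<le> B" using test_bounded[OF \<phi>] by blast
  show "integrable (lebesgue_on \<Omega>) (\<lambda>x. (norm (\<phi> x))\<^sup>2)"
  proof (rule Bochner_Integration.integrable_bound)
    show "integrable (lebesgue_on \<Omega>) (\<lambda>x. B * norm (\<phi> x))" using i by simp
    show "AE x in lebesgue_on \<Omega>. norm ((norm (\<phi> x))\<^sup>2) \<le> norm (B * norm (\<phi> x))"
    proof (rule AE_I2)
      fix x
      have "norm (\<phi> x) * norm (\<phi> x) \<le> B * norm (\<phi> x)" using B by (intro mult_right_mono) auto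
      then show "norm ((norm (\<phi> x))\<^sup>2) \<le> norm (B * norm (\<phi> x))" using B(1) by (simp add: power2_eq_square)
    qed
  qed (use m in measurable)
qed

text \<open>The constant sequence approximates \<open>\<phi>\<close>; its error has weak derivative \<open>0\<close> only almost
everywhere, because a weak derivative of \<open>0\<close> is chosen arbitrarily.\<close>

lemma test_in_H10:
  fixes \<phi> :: "'a::euclidean_space \<Rightarrow> complex"
  assumes \<phi>: "\<phi> \<in> test_functions \<Omega>" and "open \<Omega>"
  shows "\<phi> \<in> H10 \<Omega>"
proof -
  have \<Omega>: "\<Omega> \<in> sets lebesgue" using \<open>open \<Omega>\<close> by simp
  have "\<phi> \<in> sobolev_space 1 2 \<Omega>"
    using test_Lp_2[OF \<phi> \<Omega>] test_Lp_2[OF test_derivative[OF \<phi>] \<Omega>] has_weak_deriv_test[OF \<phi> _ \<open>open \<Omega>\<close>]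
    by auto
  moreover have "H1_seminorm \<Omega> (\<lambda>x. \<phi> x - \<phi> x) = 0"
  proof -
    have "AE x in lebesgue_on \<Omega>. \<forall>e\<in>Basis. weak_deriv \<Omega> e (\<lambda>x. \<phi> x - \<phi> x) x = 0"
    proof (subst AE_ball_countable)
      show "\<forall>e\<in>Basis. AE x in lebesgue_on \<Omega>. weak_deriv \<Omega> e (\<lambda>x. \<phi> x - \<phi> x) x = 0"
      proof
        fix e :: 'a assume e: "e \<in> Basis"
        note d = has_weak_deriv_test[OF \<phi> e \<open>open \<Omega>\<close>]
        show "AE x in lebesgue_on \<Omega>. weak_deriv \<Omega> e (\<lambda>x. \<phi> x - \<phi> x) x = 0"
          using weak_deriv_AE_eq[OF \<open>open \<Omega>\<close> has_weak_deriv_diff[OF \<open>open \<Omega>\<close> e d d]] by simp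
      qed
    qed (simp add: countable_finite)
    then have "AE x in lebesgue_on \<Omega>. (\<Sum>e\<in>Basis. (cmod (weak_deriv \<Omega> e (\<lambda>x. \<phi> x - \<phi> x) x))\<^sup>2) = 0"
      by eventually_elim simp
    then show ?thesis unfolding H1_seminorm_def by (simp add: integral_eq_zero_AE)
  qed
  ultimately show ?thesis
    unfolding H10_def using \<phi> by (auto simp: L2_norm_def intro!: exI[of _ "\<lambda>k. \<phi>"])
qed

lemma frechet_derivative_bounded_linear:
  assumes "smooth f" "bounded_linear L"
  shows "frechet_derivative (\<lambda>x. L (f x)) (at x) = (\<lambda>h. L (frechet_derivative f (at x) h))"
  using frechet_derivative_at[OF bounded_linear.has_derivative[OF assms(2) smooth_has_derivative[OF assms(1)]]]
  by simp

lemma square_integrable_Lp_2: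
  fixes v :: "'a::euclidean_space \<Rightarrow> complex"
  assumes v: "v \<in> Lp_space 2 \<Omega>" and L: "bounded_linear L" "\<And>z. \<bar>L z :: real\<bar> \<le> cmod z"
  shows "square_integrable (lebesgue_on \<Omega>) (\<lambda>x. L (v x))"
proof (rule square_integrable_bound)
  show "square_integrable (lebesgue_on \<Omega>) (\<lambda>x. cmod (v x))"
    using v by (auto simp: Lp_space_2_iff square_integrable_def)
  have "continuous_on UNIV L" using L(1) by (rule linear_continuous_on)
  then show "(\<lambda>x. L (v x)) \<in> borel_measurable (lebesgue_on \<Omega>)"
    using v by (auto simp: Lp_space_2_iff intro: borel_measurable_continuous_on)
qed (use L(2) in auto)

text \<open>The lemma serves for \<open>L = Re\<close> and \<open>L = Im\<close>. The seminorm of \<open>\<phi> k - v\<close> in the definition of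
\<open>H\<^sup>1\<^sub>0\<close> refers to a weak derivative of the difference, which by uniqueness is almost everywhere the
difference of the derivatives.\<close>

lemma H10_approximation:
  fixes v :: "'a::euclidean_space \<Rightarrow> complex"
  assumes "open \<Omega>" and v: "v \<in> H10 \<Omega>" and L: "bounded_linear L" "\<And>z. \<bar>L z :: real\<bar> \<le> cmod z"
  obtains \<phi> :: "nat \<Rightarrow> 'a \<Rightarrow> real" where "\<And>k. \<phi> k \<in> test_functions \<Omega>"
    "(\<lambda>k. LINT x|lebesgue_on \<Omega>. (\<phi> k x - L (v x))\<^sup>2) \<longlonglongrightarrow> 0"
    "\<And>e. e \<in> Basis \<Longrightarrow>
       (\<lambda>k. LINT x|lebesgue_on \<Omega>. (frechet_derivative (\<phi> k) (at x) e - L (weak_deriv \<Omega> e v x))\<^sup>2) \<longlonglongrightarrow> 0"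
proof -
  have \<Omega>: "\<Omega> \<in> sets lebesgue" using \<open>open \<Omega>\<close> by simp
  interpret L: bounded_linear L by (rule L(1))
  have v1: "v \<in> sobolev_space 1 2 \<Omega>" using v by (simp only: H10_def mem_Collect_eq)
  obtain \<phi> where \<phi>: "\<And>k. \<phi> k \<in> test_functions \<Omega>"
    "(\<lambda>k. L2_norm \<Omega> (\<lambda>x. \<phi> k x - v x)) \<longlonglongrightarrow> 0" "(\<lambda>k. H1_seminorm \<Omega> (\<lambda>x. \<phi> k x - v x)) \<longlonglongrightarrow> 0"
    using v unfolding H10_def by blast
  note D = sobolev_space_1_2D[OF \<open>open \<Omega>\<close> v1]
  have Lp_diff: "(\<lambda>x. a x - b x) \<in> Lp_space 2 \<Omega>" if "a \<in> Lp_space 2 \<Omega>" "b \<in> Lp_space 2 \<Omega>" for a b :: "'a \<Rightarrow> complex"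
  proof -
    have "square_integrable (lebesgue_on \<Omega>) (\<lambda>x. cmod (a x))" "square_integrable (lebesgue_on \<Omega>) (\<lambda>x. cmod (b x))"
      using that by (auto simp: Lp_space_2_iff square_integrable_def)
    then have "square_integrable (lebesgue_on \<Omega>) (\<lambda>x. cmod (a x) + cmod (b x))" by (rule square_integrable_add)
    then have "square_integrable (lebesgue_on \<Omega>) (\<lambda>x. cmod (a x - b x))"
      by (rule square_integrable_bound) (use that in \<open>auto simp: Lp_space_2_iff norm_triangle_ineq4\<close>)
    then show ?thesis using that by (auto simp: Lp_space_2_iff square_integrable_def)
  qed
  have comp: "(\<lambda>k. LINT x|lebesgue_on \<Omega>. (L (d k x))\<^sup>2) \<longlonglongrightarrow> 0"
    if d: "\<And>k. d k \<in> Lp_space 2 \<Omega>" and S: "\<And>k. integrable (lebesgue_on \<Omega>) (S k)"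
      "\<And>k. AE x in lebesgue_on \<Omega>. (cmod (d k x))\<^sup>2 \<le> S k x"
      and lim: "(\<lambda>k. sqrt (LINT x|lebesgue_on \<Omega>. S k x)) \<longlonglongrightarrow> 0" for d :: "nat \<Rightarrow> 'a \<Rightarrow> complex" and S
  proof (rule tendsto_sandwich[where f="\<lambda>_. 0" and h="\<lambda>k. (sqrt (LINT x|lebesgue_on \<Omega>. S k x))\<^sup>2"])
    have nn: "0 \<le> (LINT x|lebesgue_on \<Omega>. S k x)" for k
      by (rule integral_nonneg_AE) (use S(2)[of k] in \<open>eventually_elim, meson order_trans zero_le_power2\<close>)
    show "\<forall>\<^sub>F k in sequentially. (LINT x|lebesgue_on \<Omega>. (L (d k x))\<^sup>2) \<le> (sqrt (LINT x|lebesgue_on \<Omega>. S k x))\<^sup>2"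
    proof (rule always_eventually, rule allI)
      fix k
      have "(LINT x|lebesgue_on \<Omega>. (L (d k x))\<^sup>2) \<le> (LINT x|lebesgue_on \<Omega>. S k x)"
      proof (rule integral_mono_AE)
        show "integrable (lebesgue_on \<Omega>) (\<lambda>x. (L (d k x))\<^sup>2)"
          using square_integrable_Lp_2[OF d L] by (simp add: square_integrable_def)
        show "AE x in lebesgue_on \<Omega>. (L (d k x))\<^sup>2 \<le> S k x"
          using S(2)[of k]
        proof eventually_elim
          case (elim x)
          have "(L (d k x))\<^sup>2 \<le> (cmod (d k x))\<^sup>2" using L(2) by (simp add: abs_le_square_iff[symmetric])
          then show ?case using elim by simp
        qed
      qed (rule S(1))
      then show "(LINT x|lebesgue_on \<Omega>. (L (d k x))\<^sup>2) \<le> (sqrt (LINT x|lebesgue_on \<Omega>. S k x))\<^sup>2"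
        using nn by simp
    qed
    show "(\<lambda>k. (sqrt (LINT x|lebesgue_on \<Omega>. S k x))\<^sup>2) \<longlonglongrightarrow> 0"
      using tendsto_power[OF lim, of 2] by simp
  qed (auto intro!: always_eventually Bochner_Integration.integral_nonneg)
  show ?thesis
  proof
    show "(\<lambda>x. L (\<phi> k x)) \<in> test_functions \<Omega>" for k
      by (rule test_bounded_linear[OF \<phi>(1) L(1)])
    have d0: "(\<lambda>x. \<phi> k x - v x) \<in> Lp_space 2 \<Omega>" for k
      by (rule Lp_diff[OF test_Lp_2[OF \<phi>(1) \<Omega>] D(1)])
    have "(\<lambda>k. LINT x|lebesgue_on \<Omega>. (L (\<phi> k x - v x))\<^sup>2) \<longlonglongrightarrow> 0"
      by (rule comp[OF d0, where S="\<lambda>k x. (cmod (\<phi> k x - v x))\<^sup>2"])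
        (use d0 \<phi>(2) in \<open>auto simp: Lp_space_2_iff L2_norm_def\<close>)
    then show "(\<lambda>k. LINT x|lebesgue_on \<Omega>. (L (\<phi> k x) - L (v x))\<^sup>2) \<longlonglongrightarrow> 0"
      by (simp add: L.diff)
    fix e :: 'a assume e: "e \<in> Basis"
    let ?w = "\<lambda>e k x. frechet_derivative (\<phi> k) (at x) e - weak_deriv \<Omega> e v x"
    have dw: "?w e k \<in> Lp_space 2 \<Omega>" if "e \<in> Basis" for e k
      by (rule Lp_diff[OF test_Lp_2[OF test_derivative[OF \<phi>(1) that] \<Omega>] D(3)[OF that]])
    have eq: "AE x in lebesgue_on \<Omega>. weak_deriv \<Omega> e (\<lambda>x. \<phi> k x - v x) x = ?w e k x" if "e \<in> Basis" for e k
      by (rule weak_deriv_AE_eq[OF \<open>open \<Omega>\<close>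
            has_weak_deriv_diff[OF \<open>open \<Omega>\<close> that has_weak_deriv_test[OF \<phi>(1) that \<open>open \<Omega>\<close>] D(2)[OF that]]])
    have eq': "AE x in lebesgue_on \<Omega>. \<forall>e\<in>Basis. weak_deriv \<Omega> e (\<lambda>x. \<phi> k x - v x) x = ?w e k x" for k
      using eq by (subst AE_ball_countable) (auto simp: countable_finite)
    have "(\<lambda>k. LINT x|lebesgue_on \<Omega>. (L (?w e k x))\<^sup>2) \<longlonglongrightarrow> 0"
    proof (rule comp[OF dw[OF e], where S="\<lambda>k x. \<Sum>e\<in>Basis. (cmod (?w e k x))\<^sup>2"])
      show "integrable (lebesgue_on \<Omega>) (\<lambda>x. \<Sum>e\<in>Basis. (cmod (?w e k x))\<^sup>2)" for k
        using dw by (intro Bochner_Integration.integrable_sum) (auto simp: Lp_space_2_iff)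
      show "AE x in lebesgue_on \<Omega>. (cmod (?w e k x))\<^sup>2 \<le> (\<Sum>e\<in>Basis. (cmod (?w e k x))\<^sup>2)" for k
        using member_le_sum[OF e, of "\<lambda>e. (cmod (?w e k _))\<^sup>2"] by (intro AE_I2) auto
      have "H1_seminorm \<Omega> (\<lambda>x. \<phi> k x - v x) = sqrt (LINT x|lebesgue_on \<Omega>. (\<Sum>e\<in>Basis. (cmod (?w e k x))\<^sup>2))" for k
      proof -
        have "weak_deriv \<Omega> e (\<lambda>x. \<phi> k x - v x) \<in> borel_measurable (lebesgue_on \<Omega>)" if "e \<in> Basis" for e
          by (rule borel_measurable_lebesgue_on_AE[OF \<Omega>, of "?w e k"])
            (use dw[OF that] eq[OF that, of k] in \<open>auto simp: Lp_space_2_iff elim: eventually_mono\<close>)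
        moreover have "?w e k \<in> borel_measurable (lebesgue_on \<Omega>)" if "e \<in> Basis" for e
          using dw[OF that] by (simp add: Lp_space_2_iff)
        moreover have "AE x in lebesgue_on \<Omega>. (\<Sum>e\<in>Basis. (cmod (weak_deriv \<Omega> e (\<lambda>x. \<phi> k x - v x) x))\<^sup>2)
            = (\<Sum>e\<in>Basis. (cmod (?w e k x))\<^sup>2)"
          using eq'[of k] by eventually_elim (auto intro!: sum.cong)
        ultimately show ?thesis
          unfolding H1_seminorm_def
          by (intro arg_cong[where f=sqrt] integral_cong_AE borel_measurable_sum borel_measurable_power borel_measurable_norm)
             auto
      qed
      then show "(\<lambda>k. sqrt (LINT x|lebesgue_on \<Omega>. (\<Sum>e\<in>Basis. (cmod (?w e k x))\<^sup>2))) \<longlonglongrightarrow> 0"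
        using \<phi>(3) by simp
    qed
    then show "(\<lambda>k. LINT x|lebesgue_on \<Omega>. (frechet_derivative (\<lambda>x. L (\<phi> k x)) (at x) e - L (weak_deriv \<Omega> e v x))\<^sup>2) \<longlonglongrightarrow> 0"
      by (simp add: L.diff frechet_derivative_bounded_linear[OF test_smooth[OF \<phi>(1)] L(1)])
  qed
qed

section \<open>Kato's inequality\<close>

definition laplacian :: "('a::euclidean_space \<Rightarrow> real) \<Rightarrow> 'a \<Rightarrow> real" where
  "laplacian f x = (\<Sum>e\<in>Basis. frechet_derivative (\<lambda>y. frechet_derivative f (at y) e) (at x) e)"

text \<open>A smooth convex approximation of \<open>\<bar>s\<bar>\<close> and its derivative. Both vanish at \<open>0\<close>, so that
compositions with test functions are test functions.\<close>

definition soft_abs :: "real \<Rightarrow> real \<Rightarrow> real" where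
  "soft_abs \<epsilon> s = (s\<^sup>2 + \<epsilon>\<^sup>2) powr (1/2) - \<epsilon>"

definition soft_sgn :: "real \<Rightarrow> real \<Rightarrow> real" where
  "soft_sgn \<epsilon> s = s * (s\<^sup>2 + \<epsilon>\<^sup>2) powr (-1/2)"

lemma square_sum_pos: "0 < \<epsilon> \<Longrightarrow> 0 < s\<^sup>2 + \<epsilon>\<^sup>2" for \<epsilon> s :: real
  by (simp add: add_nonneg_pos)

lemma soft_abs_sqrt: "0 < \<epsilon> \<Longrightarrow> soft_abs \<epsilon> s = sqrt (s\<^sup>2 + \<epsilon>\<^sup>2) - \<epsilon>"
  using square_sum_pos[of \<epsilon> s] by (simp add: soft_abs_def powr_half_sqrt)

lemma soft_sgn_sqrt: "0 < \<epsilon> \<Longrightarrow> soft_sgn \<epsilon> s = s / sqrt (s\<^sup>2 + \<epsilon>\<^sup>2)"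
  using square_sum_pos[of \<epsilon> s] by (simp add: soft_sgn_def powr_half_sqrt powr_minus divide_simps)

lemma DERIV_soft_abs:
  assumes "0 < \<epsilon>"
  shows "(soft_abs \<epsilon> has_real_derivative soft_sgn \<epsilon> s) (at s)"
  unfolding soft_abs_def soft_sgn_def
  using square_sum_pos[OF assms, of s] by (auto intro!: derivative_eq_intros)

lemma DERIV_soft_sgn:
  assumes "0 < \<epsilon>"
  shows "(soft_sgn \<epsilon> has_real_derivative \<epsilon>\<^sup>2 * (s\<^sup>2 + \<epsilon>\<^sup>2) powr (-3/2)) (at s)"
proof -
  let ?r = "s\<^sup>2 + \<epsilon>\<^sup>2"
  have r: "0 < ?r" by (rule square_sum_pos[OF assms])
  have "(soft_sgn \<epsilon> has_real_derivative ?r powr (-1/2) - s\<^sup>2 * ?r powr (-3/2)) (at s)"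
    unfolding soft_sgn_def using r by (auto intro!: derivative_eq_intros simp: power2_eq_square)
  moreover have "?r powr (-1/2) = ?r * ?r powr (-3/2)"
    using r powr_mult_base[of ?r "-3/2"] by simp
  ultimately show ?thesis by (simp add: algebra_simps)
qed

lemma soft_sgn_deriv_bounds:
  fixes s :: real
  assumes "0 < \<epsilon>"
  shows "0 \<le> \<epsilon>\<^sup>2 * (s\<^sup>2 + \<epsilon>\<^sup>2) powr (-3/2)" "\<epsilon>\<^sup>2 * (s\<^sup>2 + \<epsilon>\<^sup>2) powr (-3/2) \<le> 1 / \<epsilon>"
proof -
  show "0 \<le> \<epsilon>\<^sup>2 * (s\<^sup>2 + \<epsilon>\<^sup>2) powr (-3/2)" by simp
  have "(s\<^sup>2 + \<epsilon>\<^sup>2) powr (-3/2) \<le> (\<epsilon>\<^sup>2) powr (-3/2)"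
    using assms by (intro powr_mono2') auto
  also have "(\<epsilon>\<^sup>2) powr (-3/2) = \<epsilon> powr (-3)"
    using assms by (simp add: powr_powr flip: powr_numeral)
  also have "\<dots> = 1 / \<epsilon> ^ 3" using assms by (simp add: powr_minus divide_simps)
  finally have "\<epsilon>\<^sup>2 * (s\<^sup>2 + \<epsilon>\<^sup>2) powr (-3/2) \<le> \<epsilon>\<^sup>2 * (1 / \<epsilon> ^ 3)" by (intro mult_left_mono) auto
  then show "\<epsilon>\<^sup>2 * (s\<^sup>2 + \<epsilon>\<^sup>2) powr (-3/2) \<le> 1 / \<epsilon>"
    using assms by (simp add: power2_eq_square power3_eq_cube)
qed

lemma soft_sgn_bound: "0 < \<epsilon> \<Longrightarrow> \<bar>soft_sgn \<epsilon> s\<bar> \<le> 1"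
  using square_sum_pos[of \<epsilon> s] real_sqrt_le_mono[of "s\<^sup>2" "s\<^sup>2 + \<epsilon>\<^sup>2"]
  by (simp add: soft_sgn_sqrt abs_mult)

lemma soft_abs_lipschitz: "0 < \<epsilon> \<Longrightarrow> \<bar>soft_abs \<epsilon> s - soft_abs \<epsilon> t\<bar> \<le> \<bar>s - t\<bar>"
  using field_differentiable_bound[of UNIV "soft_abs \<epsilon>" "soft_sgn \<epsilon>" 1 s t] DERIV_soft_abs soft_sgn_bound
  by (auto simp: abs_minus_commute)

lemma soft_abs_approx: "0 < \<epsilon> \<Longrightarrow> \<bar>soft_abs \<epsilon> s - \<bar>s\<bar>\<bar> \<le> \<epsilon>"
proof -
  assume e: "0 < \<epsilon>"
  have "sqrt (s\<^sup>2 + \<epsilon>\<^sup>2) \<le> \<bar>s\<bar> + \<epsilon>"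
    using e sqrt_sum_squares_le_sum_abs[of s \<epsilon>] by simp
  moreover have "\<bar>s\<bar> \<le> sqrt (s\<^sup>2 + \<epsilon>\<^sup>2)" using real_sqrt_le_mono[of "s\<^sup>2" "s\<^sup>2 + \<epsilon>\<^sup>2"] by simp
  ultimately show ?thesis using e by (auto simp: soft_abs_sqrt)
qed

lemma smooth_powr:
  fixes h :: "'a::euclidean_space \<Rightarrow> real"
  shows "(\<And>x. 0 < h x) \<Longrightarrow> smooth h \<Longrightarrow> smooth (\<lambda>x. h x powr a)"
  unfolding smooth_def using C_k_powr[of h] by blast

lemma smooth_soft:
  assumes "0 < \<epsilon>" "smooth \<phi>"
  shows "smooth (\<lambda>x. soft_abs \<epsilon> (\<phi> x))" "smooth (\<lambda>x. soft_sgn \<epsilon> (\<phi> x))"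
proof -
  have s: "smooth (\<lambda>x. (\<phi> x)\<^sup>2 + \<epsilon>\<^sup>2)"
    unfolding power2_eq_square using assms by (intro smooth_add smooth_mult smooth_const)
  have "smooth (\<lambda>x. ((\<phi> x)\<^sup>2 + \<epsilon>\<^sup>2) powr (1/2) + (- \<epsilon>))"
    by (intro smooth_add smooth_const smooth_powr s square_sum_pos assms)
  then show "smooth (\<lambda>x. soft_abs \<epsilon> (\<phi> x))" by (simp add: soft_abs_def)
  show "smooth (\<lambda>x. soft_sgn \<epsilon> (\<phi> x))"
    unfolding soft_sgn_def by (intro smooth_mult smooth_powr s square_sum_pos assms)
qed

lemma frechet_derivative_compose_real:
  assumes "(g has_real_derivative g') (at (\<phi> x))" "smooth \<phi>"
  shows "frechet_derivative (\<lambda>x. g (\<phi> x)) (at x) = (\<lambda>h. g' * frechet_derivative \<phi> (at x) h)"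
proof -
  have "(g has_derivative (*) g') (at (\<phi> x))" using assms(1) by (simp add: has_field_derivative_def)
  from diff_chain_at[OF smooth_has_derivative[OF assms(2)] this]
  have "((\<lambda>x. g (\<phi> x)) has_derivative (\<lambda>h. g' * frechet_derivative \<phi> (at x) h)) (at x)"
    by (simp add: o_def)
  then show ?thesis using frechet_derivative_at by metis
qed

lemma frechet_derivative_mult_smooth:
  fixes f g :: "'a::euclidean_space \<Rightarrow> real"
  assumes "smooth f" "smooth g"
  shows "frechet_derivative (\<lambda>x. f x * g x) (at x)
    = (\<lambda>h. f x * frechet_derivative g (at x) h + frechet_derivative f (at x) h * g x)"
  using frechet_derivative_at[OF has_derivative_mult[OF smooth_has_derivative[OF assms(1)] smooth_has_derivative[OF assms(2)]]]
  by simp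

lemma smooth_bounded_on:
  fixes g :: "'a::euclidean_space \<Rightarrow> real"
  assumes "smooth g" "bounded \<Omega>"
  obtains B where "0 \<le> B" "\<And>x. x \<in> \<Omega> \<Longrightarrow> \<bar>g x\<bar> \<le> B"
proof -
  have "compact (g ` closure \<Omega>)"
    using assms by (intro compact_continuous_image smooth_continuous) (auto simp: compact_closure)
  then obtain B where B: "0 < B" "\<And>y. y \<in> g ` closure \<Omega> \<Longrightarrow> norm y \<le> B"
    using compact_imp_bounded bounded_pos by metis
  have "\<bar>g x\<bar> \<le> B" if "x \<in> \<Omega>" for x
    using B(2)[of "g x"] that closure_subset[of \<Omega>] by auto
  then show ?thesis using that B(1) by (metis less_imp_le)
qed

lemma smooth_measurable:
  fixes g :: "'a::euclidean_space \<Rightarrow> real"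
  shows "smooth g \<Longrightarrow> g \<in> borel_measurable (lebesgue_on \<Omega>)"
  by (intro measurable_restrict_space1 measurable_completion)
    (simp add: borel_measurable_continuous_onI smooth_continuous)

lemma square_integrable_test:
  fixes \<phi> :: "'a::euclidean_space \<Rightarrow> real"
  assumes "\<phi> \<in> test_functions \<Omega>" "\<Omega> \<in> sets lebesgue"
  shows "square_integrable (lebesgue_on \<Omega>) \<phi>"
  using test_Lp_2[OF assms] by (simp add: Lp_space_2_iff square_integrable_def)

text \<open>Formally one tests the equation \<open>- \<Delta> u = h\<close> with \<open>sgn u * \<Gamma>\<close>. To stay with smooth functions, \<open>sgn u\<close> is
replaced by the smooth function \<open>soft_sgn \<epsilon> (\<phi> k)\<close>. In the gradient of
\<open>w = soft_sgn \<epsilon> (\<phi> k) * \<Gamma>\<close>, paired with the gradient of \<open>\<phi> k\<close>, the derivative of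
\<open>soft_sgn \<epsilon>\<close> contributes a nonnegative multiple of \<open>\<bar>\<nabla> \<phi> k\<bar>\<^sup>2\<close> and can be dropped; the remaining
part is \<open>\<nabla> (soft_abs \<epsilon> (\<phi> k)) \<bullet> \<nabla> \<Gamma>\<close>, to which integration by parts applies.
Replacing \<open>\<nabla> \<phi> k\<close> by \<open>D\<close> costs an error that tends to \<open>0\<close> as \<open>k \<rightarrow> \<infinity>\<close>, since for fixed \<open>\<epsilon>\<close>
the gradients of \<open>w\<close> are bounded in \<open>L\<^sup>2\<close>. Afterwards \<open>\<epsilon> \<rightarrow> 0\<close>.

The hypotheses say that \<open>u\<close> lies in \<open>H\<^sup>1\<^sub>0\<close> with gradient \<open>D\<close>, as the limit of \<open>\<phi> k\<close>, and
satisfies \<open>- \<Delta> u = h\<close> weakly. The conclusion is \<open>- \<Delta> \<bar>u\<bar> \<le> \<bar>h\<bar>\<close> tested with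
\<open>\<Gamma> \<ge> 0\<close>, where \<open>\<Gamma>\<close> may be different from \<open>0\<close> on the boundary.\<close>

lemma Kato_inequality:
  fixes \<Omega> :: "'a::euclidean_space set" and u h \<Gamma> :: "'a \<Rightarrow> real" and D :: "'a \<Rightarrow> 'a \<Rightarrow> real"
    and \<phi> :: "nat \<Rightarrow> 'a \<Rightarrow> real"
  assumes "open \<Omega>" "bounded \<Omega>"
    and u: "square_integrable (lebesgue_on \<Omega>) u"
    and D: "\<And>e. e \<in> Basis \<Longrightarrow> square_integrable (lebesgue_on \<Omega>) (D e)"
    and h: "integrable (lebesgue_on \<Omega>) h"
    and \<phi>: "\<And>k. \<phi> k \<in> test_functions \<Omega>"
    and lim: "(\<lambda>k. LINT x|lebesgue_on \<Omega>. (\<phi> k x - u x)\<^sup>2) \<longlonglongrightarrow> 0"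
    and limD: "\<And>e. e \<in> Basis \<Longrightarrow>
      (\<lambda>k. LINT x|lebesgue_on \<Omega>. (frechet_derivative (\<phi> k) (at x) e - D e x)\<^sup>2) \<longlonglongrightarrow> 0"
    and weak: "\<And>w. w \<in> test_functions \<Omega> \<Longrightarrow>
      (LINT x|lebesgue_on \<Omega>. (\<Sum>e\<in>Basis. frechet_derivative w (at x) e * D e x)) = (LINT x|lebesgue_on \<Omega>. w x * h x)"
    and \<Gamma>: "smooth \<Gamma>" "\<And>x. x \<in> \<Omega> \<Longrightarrow> 0 \<le> \<Gamma> x"
  shows "(LINT x|lebesgue_on \<Omega>. \<bar>u x\<bar> * (- laplacian \<Gamma> x)) \<le> (LINT x|lebesgue_on \<Omega>. \<bar>h x\<bar> * \<Gamma> x)"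
proof -
  have \<Omega>: "\<Omega> \<in> sets lebesgue" using \<open>open \<Omega>\<close> by simp
  let ?M = "lebesgue_on \<Omega>"
  have lm: "\<Omega> \<in> lmeasurable" using \<open>open \<Omega>\<close> \<open>bounded \<Omega>\<close> by (rule lmeasurable_open[rotated])
  interpret finite_measure ?M by (rule finite_measure_lebesgue_on[OF lm])
  define \<Gamma>' where "\<Gamma>' = (\<lambda>e x. frechet_derivative \<Gamma> (at x) e)"
  define \<Gamma>'' where "\<Gamma>'' = (\<lambda>e x. frechet_derivative (\<Gamma>' e) (at x) e)"
  define \<phi>' where "\<phi>' = (\<lambda>k e x. frechet_derivative (\<phi> k) (at x) e)"
  have lap: "laplacian \<Gamma> x = (\<Sum>e\<in>Basis. \<Gamma>'' e x)" for x
    by (simp add: laplacian_def \<Gamma>'_def \<Gamma>''_def)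
  have sm\<Gamma>': "smooth (\<Gamma>' e)" and sm\<Gamma>'': "smooth (\<Gamma>'' e)" if "e \<in> Basis" for e
    using smooth_frechet_derivative[OF \<Gamma>(1) that] smooth_frechet_derivative[OF _ that]
    unfolding \<Gamma>''_def \<Gamma>'_def by blast+
  have sm_lap: "smooth (\<lambda>x. laplacian \<Gamma> x)"
    unfolding lap smooth_def
  proof
    fix k
    have "C_k k (\<lambda>x. \<Sum>e\<in>E. \<Gamma>'' e x)" if "finite E" "E \<subseteq> Basis" for E
      using that by (induction E rule: finite_induct) (use sm\<Gamma>'' in \<open>auto simp: smooth_def C_k_const intro!: C_k_add simp del: C_k.simps\<close>)
    then show "C_k k (\<lambda>x. \<Sum>e\<in>Basis. \<Gamma>'' e x)" by simp
  qed
  obtain B0 where B0: "0 \<le> B0" "\<And>x. x \<in> \<Omega> \<Longrightarrow> \<bar>\<Gamma> x\<bar> \<le> B0"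
    using smooth_bounded_on[OF \<Gamma>(1) \<open>bounded \<Omega>\<close>] by blast
  obtain B2 where B2: "0 \<le> B2" "\<And>x. x \<in> \<Omega> \<Longrightarrow> \<bar>laplacian \<Gamma> x\<bar> \<le> B2"
    using smooth_bounded_on[OF sm_lap \<open>bounded \<Omega>\<close>] by blast
  have \<phi>'_test: "\<phi>' k e \<in> test_functions \<Omega>" if "e \<in> Basis" for k e
    unfolding \<phi>'_def by (rule test_derivative[OF \<phi> that])
  have sq\<phi>': "square_integrable ?M (\<phi>' k e)" if "e \<in> Basis" for k e
    by (rule square_integrable_test[OF \<phi>'_test[OF that] \<Omega>])
  have sq\<phi>: "square_integrable ?M (\<phi> k)" for k by (rule square_integrable_test[OF \<phi> \<Omega>])
  have lap_m: "(\<lambda>x. laplacian \<Gamma> x) \<in> borel_measurable ?M" by (rule smooth_measurable[OF sm_lap])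
  have sq_lap: "square_integrable ?M (\<lambda>x. - laplacian \<Gamma> x)"
    using lap_m B2 by (intro square_integrable_bounded[where B=B2]) (auto intro!: AE_I2)
  have h\<Gamma>: "integrable ?M (\<lambda>x. \<bar>h x\<bar> * \<Gamma> x)"
  proof (rule Bochner_Integration.integrable_bound)
    show "integrable ?M (\<lambda>x. B0 * h x)" using h by simp
    show "AE x in ?M. norm (\<bar>h x\<bar> * \<Gamma> x) \<le> norm (B0 * h x)"
    proof (rule AE_I2)
      fix x assume "x \<in> space ?M"
      then have "\<bar>h x\<bar> * \<bar>\<Gamma> x\<bar> \<le> \<bar>h x\<bar> * B0" using B0 by (intro mult_left_mono) auto
      then show "norm (\<bar>h x\<bar> * \<Gamma> x) \<le> norm (B0 * h x)" using B0(1) by (simp add: abs_mult mult.commute)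
    qed
    show "(\<lambda>x. \<bar>h x\<bar> * \<Gamma> x) \<in> borel_measurable ?M"
      using h smooth_measurable[OF \<Gamma>(1)] by (intro borel_measurable_times borel_measurable_abs) auto
  qed

  have soft: "(LINT x|?M. soft_abs \<epsilon> (u x) * (- laplacian \<Gamma> x)) \<le> (LINT x|?M. \<bar>h x\<bar> * \<Gamma> x)" if \<epsilon>: "0 < \<epsilon>" for \<epsilon>
  proof -
    define q' where "q' = (\<lambda>s. \<epsilon>\<^sup>2 * (s\<^sup>2 + \<epsilon>\<^sup>2) powr (-3/2))"
    define w where "w = (\<lambda>k x. soft_sgn \<epsilon> (\<phi> k x) * \<Gamma> x)"
    define w' where "w' = (\<lambda>k e x. soft_sgn \<epsilon> (\<phi> k x) * \<Gamma>' e x + q' (\<phi> k x) * \<phi>' k e x * \<Gamma> x)"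
    have smq: "smooth (\<lambda>x. soft_sgn \<epsilon> (\<phi> k x))" "smooth (\<lambda>x. soft_abs \<epsilon> (\<phi> k x))" for k
      using smooth_soft[OF \<epsilon> test_smooth[OF \<phi>]] by auto
    have w_test: "w k \<in> test_functions \<Omega>" for k
    proof (rule test_functions_by_support[OF \<phi>])
      show "smooth (w k)" unfolding w_def by (intro smooth_mult smq \<Gamma>)
      show "x \<in> closure {x. \<phi> k x \<noteq> 0}" if "w k x \<noteq> 0" for x
      proof (rule subsetD[OF closure_subset])
        show "x \<in> {x. \<phi> k x \<noteq> 0}" using that by (auto simp: w_def soft_sgn_def)
      qed
    qed
    have abs_test: "(\<lambda>x. soft_abs \<epsilon> (\<phi> k x)) \<in> test_functions \<Omega>" for k
    proof (rule test_functions_by_support[OF \<phi>])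
      show "smooth (\<lambda>x. soft_abs \<epsilon> (\<phi> k x))" by (rule smq)
      show "x \<in> closure {x. \<phi> k x \<noteq> 0}" if "soft_abs \<epsilon> (\<phi> k x) \<noteq> 0" for x
      proof (rule subsetD[OF closure_subset])
        show "x \<in> {x. \<phi> k x \<noteq> 0}" using that \<epsilon> by (auto simp: soft_abs_sqrt)
      qed
    qed
    have w'_eq: "frechet_derivative (w k) (at x) e = w' k e x" for k e x
      unfolding w_def w'_def q'_def \<Gamma>'_def \<phi>'_def
      by (simp add: frechet_derivative_mult_smooth[OF smq(1) \<Gamma>(1)]
          frechet_derivative_compose_real[OF DERIV_soft_sgn[OF \<epsilon>] test_smooth[OF \<phi>]])
    have w'_test: "w' k e \<in> test_functions \<Omega>" if "e \<in> Basis" for k e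
      using test_derivative[OF w_test that] by (simp add: w'_eq)
    have sqw': "square_integrable ?M (w' k e)" if "e \<in> Basis" for k e
      by (rule square_integrable_test[OF w'_test[OF that] \<Omega>])
    have sqd: "square_integrable ?M (\<lambda>x. \<phi>' k e x - D e x)" if "e \<in> Basis" for k e
      by (rule square_integrable_diff[OF sq\<phi>'[OF that] D[OF that]])

    have key: "(LINT x|?M. soft_abs \<epsilon> (\<phi> k x) * (- laplacian \<Gamma> x))
        \<le> (\<Sum>e\<in>Basis. LINT x|?M. (\<phi>' k e x - D e x) * w' k e x) + (LINT x|?M. \<bar>h x\<bar> * \<Gamma> x)" for k
    proof -
      have i1: "integrable ?M (\<lambda>x. soft_abs \<epsilon> (\<phi> k x) * \<Gamma>'' e x)" if "e \<in> Basis" for e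
        using integral_lebesgue_on_test(1)[OF test_scaleR_smooth[OF abs_test sm\<Gamma>''[OF that]] \<Omega>] by simp
      have t2: "(\<lambda>x. (soft_sgn \<epsilon> (\<phi> k x) * \<phi>' k e x) * \<Gamma>' e x) \<in> test_functions \<Omega>" if "e \<in> Basis" for e
      proof (rule test_functions_by_support[OF \<phi>'_test[OF that]])
        show "smooth (\<lambda>x. (soft_sgn \<epsilon> (\<phi> k x) * \<phi>' k e x) * \<Gamma>' e x)"
          by (intro smooth_mult smq test_smooth[OF \<phi>'_test[OF that]] sm\<Gamma>'[OF that])
        show "x \<in> closure {x. \<phi>' k e x \<noteq> 0}" if "(soft_sgn \<epsilon> (\<phi> k x) * \<phi>' k e x) * \<Gamma>' e x \<noteq> 0" for x
        proof (rule subsetD[OF closure_subset])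
          show "x \<in> {x. \<phi>' k e x \<noteq> 0}" using that by auto
        qed
      qed
      have "(LINT x|?M. soft_abs \<epsilon> (\<phi> k x) * (- laplacian \<Gamma> x))
          = - (\<Sum>e\<in>Basis. LINT x|?M. soft_abs \<epsilon> (\<phi> k x) * \<Gamma>'' e x)"
        using i1 by (simp add: lap sum_distrib_left)
      also have "\<dots> = (\<Sum>e\<in>Basis. LINT x|?M. (soft_sgn \<epsilon> (\<phi> k x) * \<phi>' k e x) * \<Gamma>' e x)"
        unfolding sum_negf[symmetric]
      proof (rule sum.cong[OF refl])
        fix e :: 'a assume e: "e \<in> Basis"
        show "- (LINT x|?M. soft_abs \<epsilon> (\<phi> k x) * \<Gamma>'' e x) = (LINT x|?M. (soft_sgn \<epsilon> (\<phi> k x) * \<phi>' k e x) * \<Gamma>' e x)"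
          using integration_by_parts_test[OF abs_test[of k] sm\<Gamma>'[OF e] e \<Omega>]
            frechet_derivative_compose_real[OF DERIV_soft_abs[OF \<epsilon>] test_smooth[OF \<phi>[of k]]]
          by (simp add: \<Gamma>''_def \<phi>'_def)
      qed
      also have "\<dots> \<le> (\<Sum>e\<in>Basis. LINT x|?M. \<phi>' k e x * w' k e x)"
      proof (rule sum_mono)
        fix e :: 'a assume e: "e \<in> Basis"
        show "(LINT x|?M. (soft_sgn \<epsilon> (\<phi> k x) * \<phi>' k e x) * \<Gamma>' e x) \<le> (LINT x|?M. \<phi>' k e x * w' k e x)"
        proof (rule integral_mono_AE)
          show "integrable ?M (\<lambda>x. (soft_sgn \<epsilon> (\<phi> k x) * \<phi>' k e x) * \<Gamma>' e x)"
            by (rule integral_lebesgue_on_test(1)[OF t2[OF e] \<Omega>])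
          show "integrable ?M (\<lambda>x. \<phi>' k e x * w' k e x)"
            by (rule integrable_mult_square_integrable[OF sq\<phi>'[OF e] sqw'[OF e]])
          show "AE x in ?M. (soft_sgn \<epsilon> (\<phi> k x) * \<phi>' k e x) * \<Gamma>' e x \<le> \<phi>' k e x * w' k e x"
          proof (rule AE_I2)
            fix x assume x: "x \<in> space ?M"
            have "\<phi>' k e x * w' k e x = (soft_sgn \<epsilon> (\<phi> k x) * \<phi>' k e x) * \<Gamma>' e x + q' (\<phi> k x) * \<Gamma> x * (\<phi>' k e x)\<^sup>2"
              by (simp add: w'_def algebra_simps power2_eq_square)
            moreover have "0 \<le> q' (\<phi> k x) * \<Gamma> x * (\<phi>' k e x)\<^sup>2"
              using x \<Gamma>(2) soft_sgn_deriv_bounds(1)[OF \<epsilon>] by (simp add: q'_def)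
            ultimately show "(soft_sgn \<epsilon> (\<phi> k x) * \<phi>' k e x) * \<Gamma>' e x \<le> \<phi>' k e x * w' k e x" by linarith
          qed
        qed
      qed
      also have "\<dots> = (\<Sum>e\<in>Basis. (LINT x|?M. (\<phi>' k e x - D e x) * w' k e x) + (LINT x|?M. w' k e x * D e x))"
      proof (rule sum.cong[OF refl])
        fix e :: 'a assume e: "e \<in> Basis"
        have "(LINT x|?M. \<phi>' k e x * w' k e x) = (LINT x|?M. (\<phi>' k e x - D e x) * w' k e x + w' k e x * D e x)"
          by (simp add: algebra_simps)
        also have "\<dots> = (LINT x|?M. (\<phi>' k e x - D e x) * w' k e x) + (LINT x|?M. w' k e x * D e x)"
          by (intro Bochner_Integration.integral_add integrable_mult_square_integrable sqd sqw' D e)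
        finally show "(LINT x|?M. \<phi>' k e x * w' k e x)
            = (LINT x|?M. (\<phi>' k e x - D e x) * w' k e x) + (LINT x|?M. w' k e x * D e x)" .
      qed
      also have "\<dots> = (\<Sum>e\<in>Basis. LINT x|?M. (\<phi>' k e x - D e x) * w' k e x) + (LINT x|?M. w k x * h x)"
      proof -
        have "(\<Sum>e\<in>Basis. LINT x|?M. w' k e x * D e x) = (LINT x|?M. (\<Sum>e\<in>Basis. w' k e x * D e x))"
          by (intro Bochner_Integration.integral_sum[symmetric] integrable_mult_square_integrable sqw' D)
        also have "\<dots> = (LINT x|?M. w k x * h x)" using weak[OF w_test] by (simp add: w'_eq)
        finally show ?thesis by (simp add: sum.distrib)
      qed
      also have "(LINT x|?M. w k x * h x) \<le> (LINT x|?M. \<bar>h x\<bar> * \<Gamma> x)"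
      proof (rule integral_mono_AE[OF _ h\<Gamma>])
        have pt: "\<bar>w k x * h x\<bar> \<le> \<bar>h x\<bar> * \<Gamma> x" if "x \<in> \<Omega>" for x
        proof -
          have "\<bar>soft_sgn \<epsilon> (\<phi> k x)\<bar> * (\<bar>h x\<bar> * \<Gamma> x) \<le> 1 * (\<bar>h x\<bar> * \<Gamma> x)"
            using soft_sgn_bound[OF \<epsilon>] \<Gamma>(2)[OF that] by (intro mult_right_mono) auto
          then show ?thesis using \<Gamma>(2)[OF that] by (simp add: w_def abs_mult ac_simps)
        qed
        show "integrable ?M (\<lambda>x. w k x * h x)"
        proof (rule Bochner_Integration.integrable_bound[OF h\<Gamma>])
          show "(\<lambda>x. w k x * h x) \<in> borel_measurable ?M"
            using h smooth_measurable[OF test_smooth[OF w_test]] by (intro borel_measurable_times) auto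
          show "AE x in ?M. norm (w k x * h x) \<le> norm (\<bar>h x\<bar> * \<Gamma> x)"
          proof (rule AE_I2)
            fix x assume "x \<in> space ?M"
            then show "norm (w k x * h x) \<le> norm (\<bar>h x\<bar> * \<Gamma> x)" using pt[of x] by simp
          qed
        qed
        show "AE x in ?M. w k x * h x \<le> \<bar>h x\<bar> * \<Gamma> x"
          by (rule AE_I2, rule abs_le_D1, rule pt) simp
      qed
      finally show ?thesis by simp
    qed

    \<comment> \<open>The bound \<open>1 / \<epsilon>\<close> of the derivative of \<open>soft_sgn \<epsilon>\<close> enters here.\<close>
    have err: "(\<lambda>k. LINT x|?M. (\<phi>' k e x - D e x) * w' k e x) \<longlonglongrightarrow> 0" if e: "e \<in> Basis" for e
    proof -
      have lim_e: "(\<lambda>k. LINT x|?M. (\<phi>' k e x - D e x)\<^sup>2) \<longlonglongrightarrow> 0"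
        using limD[OF e] by (simp add: \<phi>'_def)
      obtain B1 where B1: "0 \<le> B1" "\<And>x. x \<in> \<Omega> \<Longrightarrow> \<bar>\<Gamma>' e x\<bar> \<le> B1"
        using smooth_bounded_on[OF sm\<Gamma>'[OF e] \<open>bounded \<Omega>\<close>] by blast
      obtain A where A': "\<And>k. norm (LINT x|?M. (\<phi>' k e x - D e x)\<^sup>2) \<le> A"
        using convergent_imp_Bseq[OF convergentI[OF lim_e]] unfolding Bseq_def by blast
      have A: "(LINT x|?M. (\<phi>' k e x - D e x)\<^sup>2) \<le> A" for k
        using A'[of k] by simp
      let ?b = "\<lambda>k x. 2 * B1\<^sup>2 + 4 * (B0/\<epsilon>)\<^sup>2 * (\<phi>' k e x - D e x)\<^sup>2 + 4 * (B0/\<epsilon>)\<^sup>2 * (D e x)\<^sup>2"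
      have ib: "integrable ?M (?b k)" for k
        using sqd[OF e, of k] D[OF e] by (auto simp: square_integrable_def)
      have "(LINT x|?M. (w' k e x)\<^sup>2) \<le> 2 * B1\<^sup>2 * measure ?M (space ?M) + 4 * (B0/\<epsilon>)\<^sup>2 * A + 4 * (B0/\<epsilon>)\<^sup>2 * (LINT x|?M. (D e x)\<^sup>2)" for k
      proof -
        have "(LINT x|?M. (w' k e x)\<^sup>2) \<le> (LINT x|?M. ?b k x)"
        proof (rule integral_mono_AE[OF _ ib])
          show "integrable ?M (\<lambda>x. (w' k e x)\<^sup>2)" using sqw'[OF e] by (simp add: square_integrable_def)
          show "AE x in ?M. (w' k e x)\<^sup>2 \<le> ?b k x"
          proof (rule AE_I2)
            fix x assume "x \<in> space ?M"
            then have x: "x \<in> \<Omega>" by simp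
            let ?a = "soft_sgn \<epsilon> (\<phi> k x) * \<Gamma>' e x" and ?c = "q' (\<phi> k x) * \<Gamma> x"
            have sq: "(a + b)\<^sup>2 \<le> 2 * a\<^sup>2 + 2 * b\<^sup>2" for a b :: real
              using sum_squares_bound[of a b] by (simp add: power2_sum)
            have "\<bar>?a\<bar> \<le> 1 * B1" unfolding abs_mult
              using soft_sgn_bound[OF \<epsilon>] B1 x by (intro mult_mono) auto
            then have a: "?a\<^sup>2 \<le> B1\<^sup>2" by (metis abs_le_square_iff abs_of_nonneg B1(1) mult_1)
            have "\<bar>?c\<bar> \<le> 1/\<epsilon> * B0" unfolding abs_mult
              using soft_sgn_deriv_bounds[OF \<epsilon>, of "\<phi> k x"] B0 x less_imp_le[OF \<epsilon>] by (intro mult_mono) (auto simp: q'_def)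
            then have c: "?c\<^sup>2 \<le> (B0/\<epsilon>)\<^sup>2" using B0(1) \<epsilon> abs_le_square_iff[of ?c "B0/\<epsilon>"] by simp
            have "(w' k e x)\<^sup>2 = (?a + ?c * \<phi>' k e x)\<^sup>2" by (simp add: w'_def ac_simps)
            also have "\<dots> \<le> 2 * ?a\<^sup>2 + 2 * (?c\<^sup>2 * (\<phi>' k e x)\<^sup>2)" using sq[of ?a "?c * \<phi>' k e x"] by (simp add: power_mult_distrib)
            also have "\<dots> \<le> 2 * B1\<^sup>2 + 2 * ((B0/\<epsilon>)\<^sup>2 * (\<phi>' k e x)\<^sup>2)"
              using a c by (intro add_mono mult_left_mono mult_right_mono) auto
            also have "(\<phi>' k e x)\<^sup>2 \<le> 2 * (\<phi>' k e x - D e x)\<^sup>2 + 2 * (D e x)\<^sup>2"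
              using sq[of "\<phi>' k e x - D e x" "D e x"] by simp
            then have "2 * B1\<^sup>2 + 2 * ((B0/\<epsilon>)\<^sup>2 * (\<phi>' k e x)\<^sup>2) \<le> 2 * B1\<^sup>2 + 2 * ((B0/\<epsilon>)\<^sup>2 * (2 * (\<phi>' k e x - D e x)\<^sup>2 + 2 * (D e x)\<^sup>2))"
              by (intro add_mono mult_left_mono) auto
            also have "\<dots> = ?b k x" by (simp add: algebra_simps)
            finally show "(w' k e x)\<^sup>2 \<le> ?b k x" .
          qed
        qed
        also have "\<dots> = 2 * B1\<^sup>2 * measure ?M (space ?M) + 4 * (B0/\<epsilon>)\<^sup>2 * (LINT x|?M. (\<phi>' k e x - D e x)\<^sup>2) + 4 * (B0/\<epsilon>)\<^sup>2 * (LINT x|?M. (D e x)\<^sup>2)"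
          using sqd[OF e, of k] D[OF e] by (simp add: square_integrable_def mult.commute)
        also have "\<dots> \<le> 2 * B1\<^sup>2 * measure ?M (space ?M) + 4 * (B0/\<epsilon>)\<^sup>2 * A + 4 * (B0/\<epsilon>)\<^sup>2 * (LINT x|?M. (D e x)\<^sup>2)"
          using A by (intro add_mono mult_left_mono) auto
        finally show ?thesis .
      qed
      then show ?thesis
        by (intro integral_mult_tendsto_zero[OF sqd[OF e] sqw'[OF e] lim_e])
    qed

    have lhs: "(\<lambda>k. LINT x|?M. soft_abs \<epsilon> (\<phi> k x) * (- laplacian \<Gamma> x)) \<longlonglongrightarrow> (LINT x|?M. soft_abs \<epsilon> (u x) * (- laplacian \<Gamma> x))"
    proof -
      have cont: "continuous_on UNIV (soft_abs \<epsilon>)"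
        using DERIV_soft_abs[OF \<epsilon>] by (meson DERIV_isCont continuous_at_imp_continuous_on)
      have sq_abs: "square_integrable ?M (\<lambda>x. soft_abs \<epsilon> (v x))" if "square_integrable ?M v" for v
      proof (rule square_integrable_bound)
        have "square_integrable ?M (\<lambda>x. \<epsilon>)" by (simp add: square_integrable_def)
        then show "square_integrable ?M (\<lambda>x. \<bar>v x\<bar> + \<epsilon>)" by (intro square_integrable_add square_integrable_abs that)
        show "(\<lambda>x. soft_abs \<epsilon> (v x)) \<in> borel_measurable ?M"
          by (rule borel_measurable_continuous_on[OF cont square_integrable_measurable[OF that]])
        show "AE x in ?M. \<bar>soft_abs \<epsilon> (v x)\<bar> \<le> \<bar>\<bar>v x\<bar> + \<epsilon>\<bar>"
        proof (rule AE_I2)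
          fix x show "\<bar>soft_abs \<epsilon> (v x)\<bar> \<le> \<bar>\<bar>v x\<bar> + \<epsilon>\<bar>"
            using soft_abs_approx[OF \<epsilon>, of "v x"] by linarith
        qed
      qed
      let ?d = "\<lambda>k x. soft_abs \<epsilon> (\<phi> k x) - soft_abs \<epsilon> (u x)"
      have sqd': "square_integrable ?M (?d k)" for k by (intro square_integrable_diff sq_abs sq\<phi> u)
      have limd: "(\<lambda>k. LINT x|?M. (?d k x)\<^sup>2) \<longlonglongrightarrow> 0"
      proof (rule tendsto_sandwich[OF _ _ tendsto_const lim])
        show "\<forall>\<^sub>F k in sequentially. 0 \<le> (LINT x|?M. (?d k x)\<^sup>2)"
          by (intro always_eventually allI Bochner_Integration.integral_nonneg) simp
        show "\<forall>\<^sub>F k in sequentially. (LINT x|?M. (?d k x)\<^sup>2) \<le> (LINT x|?M. (\<phi> k x - u x)\<^sup>2)"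
        proof (rule always_eventually, rule allI, rule integral_mono_AE)
          fix k
          show "integrable ?M (\<lambda>x. (?d k x)\<^sup>2)" using sqd' by (simp add: square_integrable_def)
          show "integrable ?M (\<lambda>x. (\<phi> k x - u x)\<^sup>2)" using square_integrable_diff[OF sq\<phi> u] by (simp add: square_integrable_def)
          show "AE x in ?M. (?d k x)\<^sup>2 \<le> (\<phi> k x - u x)\<^sup>2"
            using soft_abs_lipschitz[OF \<epsilon>] by (intro AE_I2) (simp add: abs_le_square_iff[symmetric])
        qed
      qed
      have "(\<lambda>k. LINT x|?M. ?d k x * (- laplacian \<Gamma> x)) \<longlonglongrightarrow> 0"
        by (rule integral_mult_tendsto_zero[OF sqd' sq_lap limd order_refl])
      moreover have "(LINT x|?M. ?d k x * (- laplacian \<Gamma> x))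
          = (LINT x|?M. soft_abs \<epsilon> (\<phi> k x) * (- laplacian \<Gamma> x)) - (LINT x|?M. soft_abs \<epsilon> (u x) * (- laplacian \<Gamma> x))" for k
        unfolding left_diff_distrib
        by (intro Bochner_Integration.integral_diff integrable_mult_square_integrable sq_abs sq\<phi> u sq_lap)
      ultimately show ?thesis by (simp only: LIM_zero_iff)
    qed
    have "(\<lambda>k. (\<Sum>e\<in>Basis. LINT x|?M. (\<phi>' k e x - D e x) * w' k e x) + (LINT x|?M. \<bar>h x\<bar> * \<Gamma> x))
        \<longlonglongrightarrow> (\<Sum>e\<in>(Basis::'a set). 0) + (LINT x|?M. \<bar>h x\<bar> * \<Gamma> x)"
      by (intro tendsto_add tendsto_sum err tendsto_const)
    then show ?thesis
      using LIMSEQ_le[OF lhs] key by auto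
  qed

  have iu: "integrable ?M (\<lambda>x. \<bar>u x\<bar> * (- laplacian \<Gamma> x))"
    by (intro integrable_mult_square_integrable square_integrable_abs u sq_lap)
  have "(LINT x|?M. \<bar>u x\<bar> * (- laplacian \<Gamma> x)) \<le> (LINT x|?M. \<bar>h x\<bar> * \<Gamma> x) + \<epsilon> * (B2 * measure ?M (space ?M))"
    if \<epsilon>: "0 < \<epsilon>" for \<epsilon>
  proof -
    have m: "(\<lambda>x. soft_abs \<epsilon> (u x)) \<in> borel_measurable ?M"
      using DERIV_soft_abs[OF \<epsilon>] square_integrable_measurable[OF u]
      by (intro borel_measurable_continuous_on[of "soft_abs \<epsilon>"]) (meson DERIV_isCont continuous_at_imp_continuous_on)
    have pt: "\<bar>\<bar>u x\<bar> * (- laplacian \<Gamma> x) - soft_abs \<epsilon> (u x) * (- laplacian \<Gamma> x)\<bar> \<le> \<epsilon> * B2" if "x \<in> \<Omega>" for x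
    proof -
      have "\<bar>soft_abs \<epsilon> (u x) - \<bar>u x\<bar>\<bar> * \<bar>laplacian \<Gamma> x\<bar> \<le> \<epsilon> * B2"
        using soft_abs_approx[OF \<epsilon>] B2(2)[OF that] \<epsilon> by (intro mult_mono) auto
      then show ?thesis by (simp add: abs_mult[symmetric] algebra_simps)
    qed
    have ic: "integrable ?M (\<lambda>x. \<epsilon> * B2)" by simp
    have isoft: "integrable ?M (\<lambda>x. soft_abs \<epsilon> (u x) * (- laplacian \<Gamma> x))"
    proof (rule Bochner_Integration.integrable_bound[OF Bochner_Integration.integrable_add[OF integrable_abs[OF iu] ic]])
      show "(\<lambda>x. soft_abs \<epsilon> (u x) * (- laplacian \<Gamma> x)) \<in> borel_measurable ?M"
        using m lap_m by simp
      show "AE x in ?M. norm (soft_abs \<epsilon> (u x) * (- laplacian \<Gamma> x)) \<le> norm (\<bar>\<bar>u x\<bar> * (- laplacian \<Gamma> x)\<bar> + \<epsilon> * B2)"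
      proof (rule AE_I2)
        fix x assume "x \<in> space ?M"
        then show "norm (soft_abs \<epsilon> (u x) * (- laplacian \<Gamma> x)) \<le> norm (\<bar>\<bar>u x\<bar> * (- laplacian \<Gamma> x)\<bar> + \<epsilon> * B2)"
          using pt[of x] by simp
      qed
    qed
    have "(LINT x|?M. \<bar>u x\<bar> * (- laplacian \<Gamma> x)) \<le> (LINT x|?M. soft_abs \<epsilon> (u x) * (- laplacian \<Gamma> x) + \<epsilon> * B2)"
    proof (rule integral_mono_AE[OF iu Bochner_Integration.integrable_add[OF isoft ic]], rule AE_I2)
      fix x assume "x \<in> space ?M"
      then show "\<bar>u x\<bar> * (- laplacian \<Gamma> x) \<le> soft_abs \<epsilon> (u x) * (- laplacian \<Gamma> x) + \<epsilon> * B2"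
        using pt[of x] by simp
    qed
    also have "\<dots> = (LINT x|?M. soft_abs \<epsilon> (u x) * (- laplacian \<Gamma> x)) + \<epsilon> * (B2 * measure ?M (space ?M))"
      using isoft by (subst Bochner_Integration.integral_add) auto
    finally show ?thesis using soft[OF \<epsilon>] by simp
  qed
  then have *: "(LINT x|?M. \<bar>u x\<bar> * (- laplacian \<Gamma> x)) \<le> (LINT x|?M. \<bar>h x\<bar> * \<Gamma> x) + \<epsilon> * (B2 * measure ?M (space ?M))"
    if "0 < \<epsilon>" for \<epsilon> using that .
  have "((\<lambda>\<epsilon>. (LINT x|?M. \<bar>h x\<bar> * \<Gamma> x) + \<epsilon> * (B2 * measure ?M (space ?M))) \<longlongrightarrow>
      (LINT x|?M. \<bar>h x\<bar> * \<Gamma> x) + 0 * (B2 * measure ?M (space ?M))) (at_right 0)"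
    by (intro tendsto_intros)
  then have "(LINT x|?M. \<bar>u x\<bar> * (- laplacian \<Gamma> x)) \<le> (LINT x|?M. \<bar>h x\<bar> * \<Gamma> x) + 0 * (B2 * measure ?M (space ?M))"
  proof (rule tendsto_lowerbound)
    show "\<forall>\<^sub>F \<epsilon> in at_right 0. (LINT x|?M. \<bar>u x\<bar> * (- laplacian \<Gamma> x))
        \<le> (LINT x|?M. \<bar>h x\<bar> * \<Gamma> x) + \<epsilon> * (B2 * measure ?M (space ?M))"
      unfolding eventually_at_filter using * by (intro always_eventually) simp
  qed simp
  then show ?thesis by simp
qed

section \<open>The logarithmic potential in the plane\<close>

text \<open>Up to the factor \<open>2 \<pi>\<close> and a constant, the fundamental solution of \<open>- \<Delta>\<close> in the plane with pole \<open>a\<close>, smoothed at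
the scale \<open>d\<close>. The constant \<open>ln (R\<^sup>2)\<close> makes it nonnegative on the disc where
\<open>\<bar>y - a\<bar>\<^sup>2 + d\<^sup>2 \<le> R\<^sup>2\<close>.\<close>

definition log_kernel :: "real \<Rightarrow> real \<Rightarrow> 'a::euclidean_space \<Rightarrow> 'a \<Rightarrow> real" where
  "log_kernel R d a y = (ln (R\<^sup>2) - ln ((y - a) \<bullet> (y - a) + d\<^sup>2)) / 2"

lemma log_kernel_smooth_laplacian:
  fixes a y :: "real \<times> real"
  assumes d: "0 < d"
  shows "smooth (log_kernel R d a)"
    and "laplacian (log_kernel R d a) y = - (2 * d\<^sup>2 / ((y - a) \<bullet> (y - a) + d\<^sup>2)\<^sup>2)"
proof -
  define s where "s = (\<lambda>y::real \<times> real. (y - a) \<bullet> (y - a) + d\<^sup>2)"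
  have s_pos: "0 < s y" for y unfolding s_def using d by (simp add: add_nonneg_pos)
  have "smooth s"
  proof -
    have "C_k k (\<lambda>y. y + (- a))" for k
      using smooth_add[OF smooth_ident smooth_const[of "- a"]] unfolding smooth_def by blast
    then have "C_k k (\<lambda>y. (y + (- a)) \<bullet> (y + (- a)))" for k
      by (intro C_k_bounded_bilinear[OF bounded_bilinear_inner])
    then have "C_k k (\<lambda>y. (y + (- a)) \<bullet> (y + (- a)) + d\<^sup>2)" for k
      by (intro C_k_add C_k_const)
    then show ?thesis by (simp add: smooth_def s_def)
  qed
  then have "C_k k (\<lambda>y. (1/2) * (ln (R\<^sup>2) + (-1) * ln (s y)))" for k
    by (intro C_k_mult C_k_add C_k_const C_k_ln s_pos) (simp add: smooth_def)
  moreover have "log_kernel R d a = (\<lambda>y. (1/2) * (ln (R\<^sup>2) + (-1) * ln (s y)))"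
    by (simp add: fun_eq_iff log_kernel_def s_def)
  ultimately show "smooth (log_kernel R d a)" by (simp add: smooth_def)
  have D1: "frechet_derivative (log_kernel R d a) (at y) = (\<lambda>h. - ((y - a) \<bullet> h) / s y)" for y
  proof (rule frechet_derivative_at[symmetric])
    show "(log_kernel R d a has_derivative (\<lambda>h. - ((y - a) \<bullet> h) / s y)) (at y)"
      unfolding log_kernel_def s_def[symmetric]
      using s_pos[of y] by (auto intro!: derivative_eq_intros simp: s_def inner_commute field_simps)
  qed
  have D2: "frechet_derivative (\<lambda>y. - ((y - a) \<bullet> e) / s y) (at y) e
      = - (e \<bullet> e) / s y + 2 * ((y - a) \<bullet> e)\<^sup>2 / (s y)\<^sup>2" for y e
  proof -
    have "(s has_derivative (\<lambda>h. 2 * ((y - a) \<bullet> h))) (at y)"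
      unfolding s_def by (auto intro!: derivative_eq_intros simp: inner_commute)
    moreover have "((\<lambda>y. - ((y - a) \<bullet> e)) has_derivative (\<lambda>h. - (h \<bullet> e))) (at y)"
      by (auto intro!: derivative_eq_intros)
    ultimately have "((\<lambda>y. - ((y - a) \<bullet> e) / s y) has_derivative
        (\<lambda>h. (- (h \<bullet> e) * s y - - ((y - a) \<bullet> e) * (2 * ((y - a) \<bullet> h))) / (s y * s y))) (at y)"
      using s_pos[of y] by (intro has_derivative_divide') auto
    from frechet_derivative_at[OF this, symmetric] show ?thesis
      using s_pos[of y] by (simp add: field_simps power2_eq_square)
  qed
  have "laplacian (log_kernel R d a) y = (\<Sum>e\<in>Basis. - 1 / s y + 2 * ((y - a) \<bullet> e)\<^sup>2 / (s y)\<^sup>2)"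
    unfolding laplacian_def D1 D2 by (intro sum.cong) auto
  also have "\<dots> = - 2 / s y + 2 * (\<Sum>e\<in>Basis. ((y - a) \<bullet> e)\<^sup>2) / (s y)\<^sup>2"
    by (simp add: sum.distrib sum_subtractf sum_distrib_left sum_divide_distrib)
  also have "(\<Sum>e\<in>Basis. ((y - a) \<bullet> e)\<^sup>2) = s y - d\<^sup>2"
    by (simp add: s_def euclidean_inner[of "y - a" "y - a"] power2_eq_square)
  also have "- 2 / s y + 2 * (s y - d\<^sup>2) / (s y)\<^sup>2 = - (2 * d\<^sup>2 / (s y)\<^sup>2)"
    using s_pos[of y] by (simp add: field_simps power2_eq_square)
  finally show "laplacian (log_kernel R d a) y = - (2 * d\<^sup>2 / ((y - a) \<bullet> (y - a) + d\<^sup>2)\<^sup>2)"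
    by (simp add: s_def)
qed

text \<open>A majorant of the logarithmic kernels for all \<open>d\<close>. Its fourth power is a product of functions
\<open>\<bar>t\<bar> powr (- 1/2)\<close> of the single coordinates, so that it is integrable by Tonelli's theorem.\<close>

definition root_kernel :: "real \<Rightarrow> real \<times> real \<Rightarrow> real" where
  "root_kernel R z = 4 * (R\<^sup>2) powr (1/8) * (\<bar>fst z\<bar> * \<bar>snd z\<bar>) powr (-1/8)"

text \<open>This combines \<open>\<bar>z\<bar>\<^sup>2 \<ge> \<bar>fst z\<bar> * \<bar>snd z\<bar>\<close> with \<open>ln t \<le> 8 * t powr (1/8)\<close>; every
positive power dominates the logarithm, and the exponent \<open>1/8\<close> is small enough for integrability of
the fourth power. Points on the two lines through \<open>a\<close> parallel to the axes are excluded because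
\<open>0 powr (- 1/8) = 0\<close>.\<close>

lemma log_kernel_le_root_kernel:
  assumes "0 < R" "fst y \<noteq> fst a" "snd y \<noteq> snd a"
  shows "log_kernel R d a y \<le> root_kernel R (a - y)"
proof -
  define p where "p = \<bar>fst (a - y)\<bar> * \<bar>snd (a - y)\<bar>"
  define s where "s = (y - a) \<bullet> (y - a) + d\<^sup>2"
  have p: "0 < p" using assms(2,3) by (simp add: p_def)
  have "(y - a) \<bullet> (y - a) = (\<bar>fst (a - y)\<bar>)\<^sup>2 + (\<bar>snd (a - y)\<bar>)\<^sup>2"
    by (simp add: inner_prod_def power2_eq_square algebra_simps)
  moreover have "2 * p \<le> (\<bar>fst (a - y)\<bar>)\<^sup>2 + (\<bar>snd (a - y)\<bar>)\<^sup>2"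
    unfolding p_def using sum_squares_bound[of "\<bar>fst (a - y)\<bar>" "\<bar>snd (a - y)\<bar>"] by (simp add: mult.assoc)
  ultimately have sp: "p \<le> s" using p by (simp add: s_def add.commute add_increasing)
  have "log_kernel R d a y = (ln (R\<^sup>2) - ln s) / 2" by (simp add: log_kernel_def s_def)
  also have "\<dots> \<le> (ln (R\<^sup>2) - ln p) / 2" using p sp by simp
  also have "\<dots> = 4 * ln ((R\<^sup>2 / p) powr (1/8))"
    using p assms(1) by (simp add: ln_powr ln_div)
  also have "\<dots> \<le> 4 * (R\<^sup>2 / p) powr (1/8)"
    using p assms(1) ln_le_minus_one[of "(R\<^sup>2 / p) powr (1/8)"] by simp
  also have "\<dots> = root_kernel R (a - y)"
    using p assms(1) by (simp add: root_kernel_def p_def powr_divide powr_minus divide_simps)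
  finally show ?thesis .
qed

lemma root_kernel_nonneg: "0 \<le> root_kernel R z"
  by (simp add: root_kernel_def)

lemma root_kernel_minus: "root_kernel R (a - b) = root_kernel R (b - a)"
  by (simp add: root_kernel_def abs_minus_commute)

lemma root_kernel_measurable [measurable]: "root_kernel R \<in> borel_measurable borel"
  unfolding root_kernel_def by (simp add: borel_prod[symmetric])

lemma root_kernel_power4:
  assumes "0 < R"
  shows "root_kernel R z ^ 4 = 256 * R * (\<Prod>b\<in>Basis. \<bar>z \<bullet> b\<bar> powr (-1/2))"
proof -
  have "(\<Prod>b\<in>(Basis::(real\<times>real) set). \<bar>z \<bullet> b\<bar> powr (-1/2)) = \<bar>fst z\<bar> powr (-1/2) * \<bar>snd z\<bar> powr (-1/2)"
    by (simp add: Basis_prod_def inner_prod_def prod.union_disjoint)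
  moreover have "((R\<^sup>2) powr (1/8)) ^ 4 = R"
  proof -
    have "((R\<^sup>2) powr (1/8)) ^ 4 = (R\<^sup>2) powr (1/2)" by (simp add: powr_powr flip: powr_numeral)
    then show ?thesis using assms by (simp add: powr_half_sqrt)
  qed
  moreover have "((\<bar>fst z\<bar> * \<bar>snd z\<bar>) powr (-1/8)) ^ 4 = \<bar>fst z\<bar> powr (-1/2) * \<bar>snd z\<bar> powr (-1/2)"
    by (simp add: powr_powr powr_mult flip: powr_numeral)
  ultimately show ?thesis by (simp add: root_kernel_def power_mult_distrib)
qed

lemma root_kernel_power4_integral:
  assumes R: "0 < R"
  obtains B :: ennreal where "B < \<infinity>"
    "\<And>\<Omega> x. (\<And>y. y \<in> \<Omega> \<Longrightarrow> norm (x - y) \<le> R) \<Longrightarrow> \<Omega> \<in> sets borel \<Longrightarrow>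
       (\<integral>\<^sup>+y. indicator \<Omega> y * ennreal (root_kernel R (x - y)) ^ 4 \<partial>lborel) \<le> B"
proof -
  define g :: "real \<Rightarrow> ennreal" where "g = (\<lambda>t. indicator {-R..R} t * ennreal (\<bar>t\<bar> powr (-1/2)))"
  define g0 :: "real \<Rightarrow> ennreal" where "g0 = (\<lambda>t. indicator {0..R} t * ennreal (t powr (-1/2)))"
  have [measurable]: "g \<in> borel_measurable borel" "g0 \<in> borel_measurable borel"
    unfolding g_def g0_def by measurable
  define G where "G = (\<integral>\<^sup>+t. g t \<partial>lborel)"
  have "G < \<infinity>"
  proof -
    have "G \<le> (\<integral>\<^sup>+t. g0 t + g0 (- t) \<partial>lborel)"
      unfolding G_def by (intro nn_integral_mono) (auto simp: g_def g0_def indicator_def)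
    also have "\<dots> = (\<integral>\<^sup>+t. g0 t \<partial>lborel) + (\<integral>\<^sup>+t. g0 (- t) \<partial>lborel)"
      by (rule nn_integral_add) auto
    also have "(\<integral>\<^sup>+t. g0 (- t) \<partial>lborel) = (\<integral>\<^sup>+t. g0 t \<partial>lborel)"
      using nn_integral_real_affine[of g0 "-1" 0] by simp
    also have "(\<integral>\<^sup>+t. g0 t \<partial>lborel) = ennreal (R powr (-1/2 + 1) / (-1/2 + 1))"
    proof -
      have "((\<lambda>x. x powr (-1/2)) has_integral (R powr (-1/2 + 1) / (-1/2 + 1))) {0..R}"
        by (rule has_integral_powr_from_0) (use R in auto)
      from nn_integral_has_integral_lebesgue[OF _ this]
      have "(\<integral>\<^sup>+x. ennreal (indicator {0..R} x * x powr (-1/2)) \<partial>lborel) = ennreal (R powr (-1/2 + 1) / (-1/2 + 1))"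
        by simp
      then show ?thesis unfolding g0_def by (simp add: ennreal_mult' ennreal_indicator[symmetric])
    qed
    finally show ?thesis by (auto simp: top_unique less_top[symmetric])
  qed
  have trans: "(\<integral>\<^sup>+t. g (c - t) \<partial>lborel) = G" for c
    using nn_integral_real_affine[of g "-1" c] by (simp add: G_def)
  define B where "B = ennreal (256 * R) * (G * G)"
  have "(\<integral>\<^sup>+y. indicator \<Omega> y * ennreal (root_kernel R (x - y)) ^ 4 \<partial>lborel) \<le> B"
    if near: "\<And>y. y \<in> \<Omega> \<Longrightarrow> norm (x - y) \<le> R" and [measurable]: "\<Omega> \<in> sets borel" for \<Omega> and x :: "real \<times> real"
  proof -
    have "(\<integral>\<^sup>+y. indicator \<Omega> y * ennreal (root_kernel R (x - y)) ^ 4 \<partial>lborel)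
        \<le> (\<integral>\<^sup>+y. ennreal (256 * R) * (\<Prod>b\<in>Basis. g (x \<bullet> b - y \<bullet> b)) \<partial>lborel)"
    proof (rule nn_integral_mono)
      fix y :: "real \<times> real"
      show "indicator \<Omega> y * ennreal (root_kernel R (x - y)) ^ 4 \<le> ennreal (256 * R) * (\<Prod>b\<in>Basis. g (x \<bullet> b - y \<bullet> b))"
      proof (cases "y \<in> \<Omega>")
        case True
        have "g (x \<bullet> b - y \<bullet> b) = ennreal (\<bar>(x - y) \<bullet> b\<bar> powr (-1/2))" if "b \<in> Basis" for b
        proof -
          have "\<bar>(x - y) \<bullet> b\<bar> \<le> R" using Basis_le_norm[OF that, of "x - y"] near[OF True] by linarith
          then have "x \<bullet> b - y \<bullet> b \<in> {-R..R}" by (simp add: inner_diff_left abs_le_iff)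
          then show ?thesis by (simp add: g_def inner_diff_left)
        qed
        then have "(\<Prod>b\<in>Basis. g (x \<bullet> b - y \<bullet> b)) = (\<Prod>b\<in>Basis. ennreal (\<bar>(x - y) \<bullet> b\<bar> powr (-1/2)))"
          by (intro prod.cong) auto
        also have "\<dots> = ennreal (\<Prod>b\<in>Basis. \<bar>(x - y) \<bullet> b\<bar> powr (-1/2))"
          by (rule prod_ennreal) simp
        finally have "ennreal (256 * R) * (\<Prod>b\<in>Basis. g (x \<bullet> b - y \<bullet> b)) = ennreal (root_kernel R (x - y) ^ 4)"
          unfolding root_kernel_power4[OF R] using R by (simp add: ennreal_mult')
        then show ?thesis using True by (simp add: ennreal_power root_kernel_nonneg)
      qed simp
    qed
    also have "\<dots> = ennreal (256 * R) * (\<integral>\<^sup>+y. (\<Prod>b\<in>Basis. g (x \<bullet> b - y \<bullet> b)) \<partial>lborel)"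
      by (rule nn_integral_cmult) measurable
    also have "(\<integral>\<^sup>+y. (\<Prod>b\<in>Basis. g (x \<bullet> b - y \<bullet> b)) \<partial>lborel) = (\<Prod>b\<in>(Basis::(real\<times>real) set). \<integral>\<^sup>+t. g (x \<bullet> b - t) \<partial>lborel)"
      by (rule nn_integral_lborel_prod) auto
    also have "\<dots> = G * G" by (simp add: trans power2_eq_square)
    finally show ?thesis by (simp add: B_def)
  qed
  moreover have "B < \<infinity>" using \<open>G < \<infinity>\<close> by (simp add: B_def ennreal_mult_less_top)
  ultimately show ?thesis using that by blast
qed

lemma ennreal_mult_le_sum_squares: "a * b \<le> a\<^sup>2 + b\<^sup>2" for a b :: ennreal
proof (cases "a \<le> b")
  case True
  then have "a * b \<le> b * b" by (rule mult_right_mono) simp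
  then show ?thesis by (simp add: power2_eq_square add_increasing)
next
  case False
  then have "a * b \<le> a * a" by (intro mult_left_mono) auto
  then show ?thesis by (simp add: power2_eq_square add_increasing2)
qed

text \<open>Inserting the bound of \<open>U\<close> by the potential of \<open>H\<close> into the bound of \<open>H\<close> by \<open>M + W * U\<close>, and this into
the potential of \<open>H\<close>, gives a double integral in which, after Tonelli's theorem, \<open>H z\<close> is multiplied by the integral of \<open>W y * Q (x - y) * Q (y - z)\<close> over \<open>y\<close>.
By \<open>a * b * c \<le> a\<^sup>2 + b^4 + c^4\<close> this integral is bounded uniformly in \<open>x\<close> and \<open>z\<close>, and \<open>H\<close> is
integrable.\<close>

lemma potential_bootstrap:
  fixes U H W :: "'a::euclidean_space \<Rightarrow> ennreal" and Q :: "'a \<Rightarrow> ennreal"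
  assumes [measurable]: "U \<in> borel_measurable borel" "H \<in> borel_measurable borel" "W \<in> borel_measurable borel"
      "Q \<in> borel_measurable borel" "\<Omega> \<in> sets borel"
    and even: "\<And>a b. Q (a - b) = Q (b - a)"
    and U: "AE x in lborel. x \<in> \<Omega> \<longrightarrow> U x \<le> C * (\<integral>\<^sup>+y. H y * Q (x - y) \<partial>lborel)"
    and H: "AE y in lborel. H y \<le> M * indicator \<Omega> y + W y * U y"
    and H0: "\<And>y. y \<notin> \<Omega> \<Longrightarrow> H y = 0" and W0: "\<And>y. y \<notin> \<Omega> \<Longrightarrow> W y = 0"
    and fin: "C < \<infinity>" "M < \<infinity>" "(\<integral>\<^sup>+y. H y \<partial>lborel) < \<infinity>" "(\<integral>\<^sup>+y. (W y)\<^sup>2 \<partial>lborel) < \<infinity>"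
      "emeasure lborel \<Omega> < \<infinity>" "B < \<infinity>"
    and Q: "\<And>x. x \<in> \<Omega> \<Longrightarrow> (\<integral>\<^sup>+y. indicator \<Omega> y * Q (x - y) ^ 4 \<partial>lborel) \<le> B"
  obtains K where "K < \<infinity>" "AE x in lborel. x \<in> \<Omega> \<longrightarrow> U x \<le> K"
proof -
  define P where "P = (\<lambda>x. \<integral>\<^sup>+y. H y * Q (x - y) \<partial>lborel)"
  define W2 where "W2 = (\<integral>\<^sup>+y. (W y)\<^sup>2 \<partial>lborel)"
  define L where "L = M * (emeasure lborel \<Omega> + B) + C * ((\<integral>\<^sup>+z. H z \<partial>lborel) * (W2 + (B + B)))"
  have [measurable]: "P \<in> borel_measurable borel" unfolding P_def by measurable
  have pow4: "q \<le> 1 + q ^ 4" for q :: ennreal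
  proof (cases "q \<le> 1")
    case False
    then have "1 \<le> q" by simp
    then have "q ^ 1 \<le> q ^ 4" by (rule power_increasing[rotated]) simp
    then show ?thesis by (simp add: add_increasing)
  qed (simp add: add_increasing2)
  have inner: "(\<integral>\<^sup>+y. W y * Q (x - y) * Q (y - z) \<partial>lborel) \<le> W2 + (B + B)" if "x \<in> \<Omega>" "z \<in> \<Omega>" for x z
  proof -
    have "(\<integral>\<^sup>+y. W y * Q (x - y) * Q (y - z) \<partial>lborel)
        \<le> (\<integral>\<^sup>+y. (W y)\<^sup>2 + (indicator \<Omega> y * Q (x - y) ^ 4 + indicator \<Omega> y * Q (z - y) ^ 4) \<partial>lborel)"
    proof (rule nn_integral_mono)
      fix y
      show "W y * Q (x - y) * Q (y - z) \<le> (W y)\<^sup>2 + (indicator \<Omega> y * Q (x - y) ^ 4 + indicator \<Omega> y * Q (z - y) ^ 4)"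
      proof (cases "y \<in> \<Omega>")
        case True
        have "W y * (Q (x - y) * Q (z - y)) \<le> (W y)\<^sup>2 + (Q (x - y) * Q (z - y))\<^sup>2"
          by (rule ennreal_mult_le_sum_squares)
        also have "(Q (x - y) * Q (z - y))\<^sup>2 \<le> ((Q (x - y))\<^sup>2)\<^sup>2 + ((Q (z - y))\<^sup>2)\<^sup>2"
          unfolding power_mult_distrib by (rule ennreal_mult_le_sum_squares)
        finally show ?thesis using True by (simp add: even[of y z] mult.assoc add_left_mono)
      qed (simp add: W0)
    qed
    also have "\<dots> = W2 + ((\<integral>\<^sup>+y. indicator \<Omega> y * Q (x - y) ^ 4 \<partial>lborel) + (\<integral>\<^sup>+y. indicator \<Omega> y * Q (z - y) ^ 4 \<partial>lborel))"
      unfolding W2_def by (simp add: nn_integral_add)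
    also have "\<dots> \<le> W2 + (B + B)"
      using Q that by (intro add_mono) auto
    finally show ?thesis .
  qed
  have bound: "P x \<le> L" if x: "x \<in> \<Omega>" for x
  proof -
    have "P x \<le> (\<integral>\<^sup>+y. M * (indicator \<Omega> y * Q (x - y)) + W y * U y * Q (x - y) \<partial>lborel)"
      unfolding P_def
    proof (rule nn_integral_mono_AE)
      show "AE y in lborel. H y * Q (x - y) \<le> M * (indicator \<Omega> y * Q (x - y)) + W y * U y * Q (x - y)"
        using H
      proof eventually_elim
        case (elim y)
        then have "H y * Q (x - y) \<le> (M * indicator \<Omega> y + W y * U y) * Q (x - y)" by (rule mult_right_mono) simp
        then show ?case by (simp add: distrib_right mult.assoc)
      qed
    qed
    also have "\<dots> = M * (\<integral>\<^sup>+y. indicator \<Omega> y * Q (x - y) \<partial>lborel) + (\<integral>\<^sup>+y. W y * U y * Q (x - y) \<partial>lborel)"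
      by (simp add: nn_integral_add nn_integral_cmult)
    also have "\<dots> \<le> M * (emeasure lborel \<Omega> + B) + C * ((\<integral>\<^sup>+z. H z \<partial>lborel) * (W2 + (B + B)))"
    proof (intro add_mono mult_left_mono)
      have "(\<integral>\<^sup>+y. indicator \<Omega> y * Q (x - y) \<partial>lborel) \<le> (\<integral>\<^sup>+y. indicator \<Omega> y + indicator \<Omega> y * Q (x - y) ^ 4 \<partial>lborel)"
        using pow4 by (intro nn_integral_mono) (auto simp: indicator_def)
      also have "\<dots> = emeasure lborel \<Omega> + (\<integral>\<^sup>+y. indicator \<Omega> y * Q (x - y) ^ 4 \<partial>lborel)"
        by (subst nn_integral_add) auto
      also have "\<dots> \<le> emeasure lborel \<Omega> + B" using Q[OF x] by (rule add_left_mono)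
      finally show "(\<integral>\<^sup>+y. indicator \<Omega> y * Q (x - y) \<partial>lborel) \<le> emeasure lborel \<Omega> + B" .
      have "(\<integral>\<^sup>+y. W y * U y * Q (x - y) \<partial>lborel) \<le> (\<integral>\<^sup>+y. C * (W y * Q (x - y) * P y) \<partial>lborel)"
      proof (rule nn_integral_mono_AE)
        show "AE y in lborel. W y * U y * Q (x - y) \<le> C * (W y * Q (x - y) * P y)"
          using U
        proof eventually_elim
          case (elim y)
          show ?case
          proof (cases "y \<in> \<Omega>")
            case True
            then have "(W y * Q (x - y)) * U y \<le> (W y * Q (x - y)) * (C * P y)"
              using elim by (intro mult_left_mono) (auto simp: P_def)
            then show ?thesis by (simp add: ac_simps)
          qed (simp add: W0)
        qed
      qed
      also have "\<dots> = C * (\<integral>\<^sup>+y. W y * Q (x - y) * P y \<partial>lborel)"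
        by (rule nn_integral_cmult) measurable
      also have "(\<integral>\<^sup>+y. W y * Q (x - y) * P y \<partial>lborel)
          = (\<integral>\<^sup>+y. (\<integral>\<^sup>+z. W y * Q (x - y) * (H z * Q (y - z)) \<partial>lborel) \<partial>lborel)"
        unfolding P_def by (intro nn_integral_cong, subst nn_integral_cmult) auto
      also have "\<dots> = (\<integral>\<^sup>+z. (\<integral>\<^sup>+y. W y * Q (x - y) * (H z * Q (y - z)) \<partial>lborel) \<partial>lborel)"
        by (rule lborel_pair.Fubini'[symmetric]) measurable
      also have "\<dots> = (\<integral>\<^sup>+z. H z * (\<integral>\<^sup>+y. W y * Q (x - y) * Q (y - z) \<partial>lborel) \<partial>lborel)"
      proof (rule nn_integral_cong)
        fix z
        have "(\<integral>\<^sup>+y. W y * Q (x - y) * (H z * Q (y - z)) \<partial>lborel) = (\<integral>\<^sup>+y. H z * (W y * Q (x - y) * Q (y - z)) \<partial>lborel)"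
          by (simp add: ac_simps)
        also have "\<dots> = H z * (\<integral>\<^sup>+y. W y * Q (x - y) * Q (y - z) \<partial>lborel)"
          by (rule nn_integral_cmult) measurable
        finally show "(\<integral>\<^sup>+y. W y * Q (x - y) * (H z * Q (y - z)) \<partial>lborel)
            = H z * (\<integral>\<^sup>+y. W y * Q (x - y) * Q (y - z) \<partial>lborel)" .
      qed
      also have "\<dots> \<le> (\<integral>\<^sup>+z. H z * (W2 + (B + B)) \<partial>lborel)"
      proof (rule nn_integral_mono)
        fix z show "H z * (\<integral>\<^sup>+y. W y * Q (x - y) * Q (y - z) \<partial>lborel) \<le> H z * (W2 + (B + B))"
          by (cases "z \<in> \<Omega>") (auto simp: H0 intro!: mult_left_mono inner x)
      qed
      also have "\<dots> = (\<integral>\<^sup>+z. H z \<partial>lborel) * (W2 + (B + B))"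
        by (rule nn_integral_multc) measurable
      finally show "(\<integral>\<^sup>+y. W y * U y * Q (x - y) \<partial>lborel) \<le> C * ((\<integral>\<^sup>+z. H z \<partial>lborel) * (W2 + (B + B)))"
        by (simp add: mult_left_mono)
    qed simp
    finally show ?thesis by (simp add: L_def)
  qed
  have "L < \<infinity>"
    using fin unfolding L_def W2_def by (simp add: ennreal_mult_less_top)
  then have "C * L < \<infinity>" using fin by (simp add: ennreal_mult_less_top)
  moreover have "AE x in lborel. x \<in> \<Omega> \<longrightarrow> U x \<le> C * L"
    using U
  proof eventually_elim
    case (elim x)
    show ?case
    proof
      assume "x \<in> \<Omega>"
      then have "U x \<le> C * P x" using elim by (simp add: P_def)
      also have "\<dots> \<le> C * L" using bound[OF \<open>x \<in> \<Omega>\<close>] by (rule mult_left_mono) simp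
      finally show "U x \<le> C * L" .
    qed
  qed
  ultimately show ?thesis using that by blast
qed

section \<open>Boundedness of weak solutions\<close>

text \<open>Tonelli's theorem needs functions that are Borel measurable, since Lebesgue measure in the plane
is not a product measure.\<close>

lemma borel_representative:
  fixes f :: "'a::euclidean_space \<Rightarrow> real"
  assumes f: "f \<in> borel_measurable (lebesgue_on \<Omega>)" and \<Omega>: "\<Omega> \<in> sets borel"
  obtains g :: "'a \<Rightarrow> ennreal" where "g \<in> borel_measurable borel" "\<And>x. x \<notin> \<Omega> \<Longrightarrow> g x = 0"
    "AE x in lborel. x \<in> \<Omega> \<longrightarrow> g x = ennreal \<bar>f x\<bar>"
proof -
  have "(\<lambda>x. if x \<in> \<Omega> then f x else 0) \<in> borel_measurable lebesgue"
    using f \<Omega> by (simp add: borel_measurable_if)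
  then have "(\<lambda>x. ennreal \<bar>if x \<in> \<Omega> then f x else 0\<bar>) \<in> borel_measurable lebesgue"
    by measurable
  then obtain g where g: "g \<in> borel_measurable lborel" "AE x in lborel. ennreal \<bar>if x \<in> \<Omega> then f x else 0\<bar> = g x"
    using completion_ex_borel_measurable by blast
  have [measurable]: "g \<in> borel_measurable borel" "\<Omega> \<in> sets borel" using g(1) \<Omega> by auto
  show ?thesis
  proof (rule that[of "\<lambda>x. indicator \<Omega> x * g x"])
    show "(\<lambda>x. indicator \<Omega> x * g x) \<in> borel_measurable borel" by measurable
    show "AE x in lborel. x \<in> \<Omega> \<longrightarrow> indicator \<Omega> x * g x = ennreal \<bar>f x\<bar>"
      using g(2) by eventually_elim auto
  qed simp
qed

lemma nn_integral_lebesgue_on_lborel: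
  fixes f :: "'a::euclidean_space \<Rightarrow> ennreal"
  assumes "\<Omega> \<in> sets borel"
  shows "(\<integral>\<^sup>+x. f x \<partial>lebesgue_on \<Omega>) = (\<integral>\<^sup>+x. f x * indicator \<Omega> x \<partial>lborel)"
  using assms by (simp add: nn_integral_restrict_space nn_integral_completion)

lemma AE_off_axes: "AE y in lborel. fst y \<noteq> fst x \<and> snd y \<noteq> snd x" for x :: "real \<times> real"
proof -
  have "negligible {y::real \<times> real. y \<bullet> (1, 0) = fst x}" "negligible {y::real \<times> real. y \<bullet> (0, 1) = snd x}"
    by (rule negligible_standard_hyperplane, simp add: Basis_prod_def)+
  then have "AE y in lebesgue. y \<notin> {y::real \<times> real. y \<bullet> (1, 0) = fst x}" "AE y in lebesgue. y \<notin> {y::real \<times> real. y \<bullet> (0, 1) = snd x}"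
    by (simp_all only: negligible_iff_null_sets AE_not_in)
  then have "AE y in lebesgue. fst y \<noteq> fst x \<and> snd y \<noteq> snd x"
    by eventually_elim (simp add: inner_prod_def)
  then show ?thesis by (simp add: AE_completion_iff)
qed

text \<open>Kato's inequality with the kernel \<open>log_kernel R d x\<close> bounds \<open>\<integral> \<bar>u\<bar> * \<rho>\<close>, where \<open>\<rho>\<close> is the
smoothed point mass \<open>2 d\<^sup>2 / (\<bar>y - x\<bar>\<^sup>2 + d\<^sup>2)\<^sup>2\<close>, by the potential of \<open>\<bar>h\<bar>\<close> at \<open>x\<close>, uniformly in \<open>d\<close>.
On the cube with corner \<open>x\<close> and side \<open>d\<close> one has \<open>\<bar>y - x\<bar>\<^sup>2 + d\<^sup>2 \<le> 3 d\<^sup>2\<close>, so \<open>\<rho>\<close> is at least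
\<open>2 / (9 d\<^sup>2)\<close> there and the averages of \<open>\<bar>u\<bar>\<close> over these cubes are bounded by \<open>9/2\<close> times the
potential. By Lebesgue's differentiation theorem so is \<open>\<bar>u\<bar>\<close> almost everywhere, and
\<open>potential_bootstrap\<close> turns this into a constant bound.\<close>

lemma weak_solution_bounded:
  fixes \<Omega> :: "(real \<times> real) set" and u h V :: "real \<times> real \<Rightarrow> real" and D :: "real \<times> real \<Rightarrow> real \<times> real \<Rightarrow> real"
    and \<phi> :: "nat \<Rightarrow> real \<times> real \<Rightarrow> real"
  assumes "open \<Omega>" "bounded \<Omega>"
    and u: "square_integrable (lebesgue_on \<Omega>) u"
    and D: "\<And>e. e \<in> Basis \<Longrightarrow> square_integrable (lebesgue_on \<Omega>) (D e)"
    and V: "square_integrable (lebesgue_on \<Omega>) V"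
    and h: "h \<in> borel_measurable (lebesgue_on \<Omega>)" "AE x in lebesgue_on \<Omega>. \<bar>h x\<bar> \<le> M + \<bar>V x\<bar> * \<bar>u x\<bar>"
    and \<phi>: "\<And>k. \<phi> k \<in> test_functions \<Omega>"
    and lim: "(\<lambda>k. LINT x|lebesgue_on \<Omega>. (\<phi> k x - u x)\<^sup>2) \<longlonglongrightarrow> 0"
    and limD: "\<And>e. e \<in> Basis \<Longrightarrow>
      (\<lambda>k. LINT x|lebesgue_on \<Omega>. (frechet_derivative (\<phi> k) (at x) e - D e x)\<^sup>2) \<longlonglongrightarrow> 0"
    and weak: "\<And>w. w \<in> test_functions \<Omega> \<Longrightarrow>
      (LINT x|lebesgue_on \<Omega>. (\<Sum>e\<in>Basis. frechet_derivative w (at x) e * D e x)) = (LINT x|lebesgue_on \<Omega>. w x * h x)"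
  shows "\<exists>C. AE x in lebesgue_on \<Omega>. \<bar>u x\<bar> \<le> C"
proof -
  let ?M = "lebesgue_on \<Omega>"
  have \<Omega>b: "\<Omega> \<in> sets borel" and \<Omega>: "\<Omega> \<in> sets lebesgue" using \<open>open \<Omega>\<close> by auto
  have lm: "\<Omega> \<in> lmeasurable" using \<open>open \<Omega>\<close> \<open>bounded \<Omega>\<close> by (rule lmeasurable_open[rotated])
  interpret finite_measure ?M by (rule finite_measure_lebesgue_on[OF lm])
  define M' where "M' = max M 0"
  have M': "0 \<le> M'" "AE x in ?M. \<bar>h x\<bar> \<le> M' + \<bar>V x\<bar> * \<bar>u x\<bar>"
    using h(2) by (auto simp: M'_def elim!: eventually_mono)
  have hi: "integrable ?M h"
  proof (rule Bochner_Integration.integrable_bound)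
    show "integrable ?M (\<lambda>x. M' + \<bar>V x\<bar> * \<bar>u x\<bar>)"
      using integrable_mult_square_integrable[OF square_integrable_abs[OF V] square_integrable_abs[OF u]]
      by (intro Bochner_Integration.integrable_add) auto
    show "AE x in ?M. norm (h x) \<le> norm (M' + \<bar>V x\<bar> * \<bar>u x\<bar>)"
      using M'(2) by eventually_elim simp
  qed (rule h(1))
  obtain r where r: "0 < r" "\<And>x. x \<in> \<Omega> \<Longrightarrow> norm x \<le> r"
    using \<open>bounded \<Omega>\<close> by (auto simp: bounded_pos)
  define R where "R = 2 * r + 1"
  have R: "0 < R" using r by (simp add: R_def)
  have diam: "norm (x - y) \<le> 2 * r" if "x \<in> \<Omega>" "y \<in> \<Omega>" for x y
    using norm_triangle_ineq4[of x y] r(2)[OF that(1)] r(2)[OF that(2)] by linarith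
  obtain B where B: "B < \<infinity>"
    "\<And>\<Omega> x. (\<And>y. y \<in> \<Omega> \<Longrightarrow> norm (x - y) \<le> R) \<Longrightarrow> \<Omega> \<in> sets borel \<Longrightarrow>
       (\<integral>\<^sup>+y. indicator \<Omega> y * ennreal (root_kernel R (x - y)) ^ 4 \<partial>lborel) \<le> B"
    using root_kernel_power4_integral[OF R] by blast
  obtain H where H: "H \<in> borel_measurable borel" "\<And>x. x \<notin> \<Omega> \<Longrightarrow> H x = 0"
    "AE x in lborel. x \<in> \<Omega> \<longrightarrow> H x = ennreal \<bar>h x\<bar>"
    using borel_representative[OF h(1) \<Omega>b] by blast
  obtain U where U: "U \<in> borel_measurable borel" "\<And>x. x \<notin> \<Omega> \<Longrightarrow> U x = 0"
    "AE x in lborel. x \<in> \<Omega> \<longrightarrow> U x = ennreal \<bar>u x\<bar>"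
    using borel_representative[OF square_integrable_measurable[OF u] \<Omega>b] by blast
  obtain W where W: "W \<in> borel_measurable borel" "\<And>x. x \<notin> \<Omega> \<Longrightarrow> W x = 0"
    "AE x in lborel. x \<in> \<Omega> \<longrightarrow> W x = ennreal \<bar>V x\<bar>"
    using borel_representative[OF square_integrable_measurable[OF V] \<Omega>b] by blast
  define Q where "Q = (\<lambda>z. ennreal (root_kernel R z))"
  have [measurable]: "H \<in> borel_measurable borel" "U \<in> borel_measurable borel" "W \<in> borel_measurable borel"
    "Q \<in> borel_measurable borel" "\<Omega> \<in> sets borel"
    using H U W \<Omega>b by (auto simp: Q_def)
  define C where "C = ennreal (9/2)"
  define U0 where "U0 = (\<lambda>x. indicator \<Omega> x *\<^sub>R \<bar>u x\<bar>)"
  have iu: "integrable ?M (\<lambda>x. \<bar>u x\<bar>)"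
    by (rule integrable_square_integrable[OF square_integrable_abs[OF u]])
  have iU0: "integrable lebesgue U0"
    using iu \<Omega> by (simp add: U0_def integrable_restrict_space)
  have AE_lb: "AE x in lborel. x \<in> \<Omega> \<longrightarrow> P x" if "AE x in ?M. P x" for P
    using that \<Omega> by (simp add: AE_restrict_space_iff AE_completion_iff)

  have avg: "ennreal (integral (cbox x (x + d *\<^sub>R One)) U0 / d ^ DIM(real \<times> real))
      \<le> C * (\<integral>\<^sup>+y. H y * Q (x - y) \<partial>lborel)" if x: "x \<in> \<Omega>" and d: "0 < d" "d \<le> 1" for x d
  proof -
    let ?\<Gamma> = "log_kernel R d x" and ?s = "\<lambda>y. (y - x) \<bullet> (y - x) + d\<^sup>2" and ?X = "cbox x (x + d *\<^sub>R One)"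
    have spos: "0 < ?s y" for y using d by (simp add: add_nonneg_pos)
    have \<Gamma>_nn: "0 \<le> ?\<Gamma> y" if "y \<in> \<Omega>" for y
    proof -
      have "(y - x) \<bullet> (y - x) \<le> (2 * r)\<^sup>2"
        using power_mono[OF diam[OF that x] norm_ge_zero, of 2] by (simp add: power2_norm_eq_inner)
      moreover have "d\<^sup>2 \<le> 1" using d by (simp add: power_le_one)
      ultimately have "?s y \<le> R\<^sup>2" using r(1) by (simp add: R_def power2_sum)
      then have "ln (?s y) \<le> ln (R\<^sup>2)" using spos[of y] by (subst ln_le_cancel_iff) auto
      then show ?thesis by (simp add: log_kernel_def)
    qed
    have "(LINT y|?M. \<bar>u y\<bar> * (- laplacian ?\<Gamma> y)) \<le> (LINT y|?M. \<bar>h y\<bar> * ?\<Gamma> y)"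
      by (rule Kato_inequality[OF \<open>open \<Omega>\<close> \<open>bounded \<Omega>\<close> u D hi \<phi> lim limD weak log_kernel_smooth_laplacian(1)[OF d(1)] \<Gamma>_nn])
    then have kato: "(LINT y|?M. \<bar>u y\<bar> * (2 * d\<^sup>2 / (?s y)\<^sup>2)) \<le> (LINT y|?M. \<bar>h y\<bar> * ?\<Gamma> y)"
      by (simp add: log_kernel_smooth_laplacian(2)[OF d(1)])
    have m_u: "u \<in> borel_measurable ?M" by (rule square_integrable_measurable[OF u])
    have near: "2 / (9 * d\<^sup>2) \<le> 2 * d\<^sup>2 / (?s y)\<^sup>2" if "y \<in> ?X" for y
    proof -
      have "((y - x) \<bullet> b)\<^sup>2 \<le> d\<^sup>2" if "b \<in> Basis" for b
      proof -
        have "x \<bullet> b \<le> y \<bullet> b" "y \<bullet> b \<le> x \<bullet> b + d"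
          using \<open>y \<in> ?X\<close> that by (auto simp: mem_box inner_add_left)
        then have "\<bar>(y - x) \<bullet> b\<bar> \<le> \<bar>d\<bar>" by (simp add: inner_diff_left)
        then show ?thesis by (simp add: abs_le_square_iff)
      qed
      then have "(\<Sum>b\<in>Basis. ((y - x) \<bullet> b)\<^sup>2) \<le> (\<Sum>b\<in>(Basis::(real \<times> real) set). d\<^sup>2)"
        by (rule sum_mono)
      then have "?s y \<le> 3 * d\<^sup>2"
        by (simp add: euclidean_inner[of "y - x" "y - x"] power2_eq_square)
      then have "(?s y)\<^sup>2 \<le> (3 * d\<^sup>2)\<^sup>2" using spos[of y] by (intro power_mono) auto
      then have "2 * d\<^sup>2 / (3 * d\<^sup>2)\<^sup>2 \<le> 2 * d\<^sup>2 / (?s y)\<^sup>2"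
        using spos[of y] d by (intro divide_left_mono mult_pos_pos zero_less_power) auto
      moreover have "2 * d\<^sup>2 / (3 * d\<^sup>2)\<^sup>2 = 2 / (9 * d\<^sup>2)" using d by (simp add: power2_eq_square field_simps)
      ultimately show ?thesis by simp
    qed
    have far: "\<bar>2 * d\<^sup>2 / (?s y)\<^sup>2\<bar> \<le> 2 / d\<^sup>2" for y
    proof -
      have "(d\<^sup>2)\<^sup>2 \<le> (?s y)\<^sup>2" by (intro power_mono) auto
      then have "2 * d\<^sup>2 / (?s y)\<^sup>2 \<le> 2 * d\<^sup>2 / (d\<^sup>2)\<^sup>2" using d spos[of y] by (intro divide_left_mono mult_pos_pos zero_less_power) auto
      also have "\<dots> = 2 / d\<^sup>2" using d by (simp add: power2_eq_square field_simps)
      finally show ?thesis by simp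
    qed
    have i_rho: "integrable ?M (\<lambda>y. \<bar>u y\<bar> * (2 * d\<^sup>2 / (?s y)\<^sup>2))"
    proof (rule integrable_mult_square_integrable[OF square_integrable_abs[OF u] square_integrable_bounded])
      have "continuous_on UNIV (\<lambda>y. 2 * d\<^sup>2 / (?s y)\<^sup>2)"
        using spos by (intro continuous_intros) (auto simp: less_imp_neq[symmetric])
      then show "(\<lambda>y. 2 * d\<^sup>2 / (?s y)\<^sup>2) \<in> borel_measurable ?M"
        by (intro measurable_restrict_space1 measurable_completion) (simp add: borel_measurable_continuous_onI)
      show "AE y in ?M. \<bar>2 * d\<^sup>2 / (?s y)\<^sup>2\<bar> \<le> 2 / d\<^sup>2" using far by (intro AE_I2)
    qed
    have box_eq: "integral ?X U0 = (LINT y|?M. indicator ?X y * \<bar>u y\<bar>)"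
    proof -
      have "integrable (lebesgue_on ?X) U0"
        using integrable_lebesgue_on_subset[of ?X UNIV U0] iU0 by (simp add: lebesgue_on_UNIV_eq)
      then have "integral ?X U0 = (LINT y|lebesgue_on ?X. U0 y)" by (simp add: lebesgue_integral_eq_integral)
      also have "\<dots> = (LINT y|lebesgue. indicator ?X y *\<^sub>R U0 y)" by (simp add: integral_restrict_space)
      also have "\<dots> = (LINT y|lebesgue. indicator \<Omega> y *\<^sub>R (indicator ?X y * \<bar>u y\<bar>))"
        by (simp add: U0_def ac_simps)
      also have "\<dots> = (LINT y|?M. indicator ?X y * \<bar>u y\<bar>)" using \<Omega> by (simp add: integral_restrict_space)
      finally show ?thesis .
    qed
    have "2 / (9 * d\<^sup>2) * integral ?X U0 = (LINT y|?M. 2 / (9 * d\<^sup>2) * (indicator ?X y * \<bar>u y\<bar>))"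
      by (simp only: box_eq integral_mult_right_zero)
    also have "\<dots> \<le> (LINT y|?M. \<bar>u y\<bar> * (2 * d\<^sup>2 / (?s y)\<^sup>2))"
    proof (rule integral_mono_AE[OF _ i_rho])
      show "integrable ?M (\<lambda>y. 2 / (9 * d\<^sup>2) * (indicator ?X y * \<bar>u y\<bar>))"
      proof (rule integrable_mult_right)
        have "integrable ?M (\<lambda>y. indicator (?X \<inter> \<Omega>) y *\<^sub>R \<bar>u y\<bar>)"
          using iu \<Omega> by (intro integrable_mult_indicator) (auto simp: sets_restrict_space_iff)
        then show "integrable ?M (\<lambda>y. indicator ?X y * \<bar>u y\<bar>)"
        proof (rule Bochner_Integration.integrable_bound)
          have "(indicator ?X :: real \<times> real \<Rightarrow> real) \<in> borel_measurable borel" by simp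
          then have "(indicator ?X :: real \<times> real \<Rightarrow> real) \<in> borel_measurable ?M"
            by (intro measurable_restrict_space1 measurable_completion) simp
          then show "(\<lambda>y. indicator ?X y * \<bar>u y\<bar>) \<in> borel_measurable ?M"
            using m_u by (intro borel_measurable_times borel_measurable_abs)
        qed (auto intro!: AE_I2 simp: indicator_def)
      qed
      show "AE y in ?M. 2 / (9 * d\<^sup>2) * (indicator ?X y * \<bar>u y\<bar>) \<le> \<bar>u y\<bar> * (2 * d\<^sup>2 / (?s y)\<^sup>2)"
      proof (rule AE_I2)
        fix y
        show "2 / (9 * d\<^sup>2) * (indicator ?X y * \<bar>u y\<bar>) \<le> \<bar>u y\<bar> * (2 * d\<^sup>2 / (?s y)\<^sup>2)"
        proof (cases "y \<in> ?X")
          case True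
          have "2 / (9 * d\<^sup>2) * \<bar>u y\<bar> \<le> 2 * d\<^sup>2 / (?s y)\<^sup>2 * \<bar>u y\<bar>"
            using near[OF True] by (rule mult_right_mono) simp
          then show ?thesis using True by (simp add: mult.commute)
        qed simp
      qed
    qed
    also note kato
    finally have "integral ?X U0 / d\<^sup>2 \<le> 9/2 * (LINT y|?M. \<bar>h y\<bar> * ?\<Gamma> y)"
      by (simp add: field_simps)
    then have "ennreal (integral ?X U0 / d\<^sup>2) \<le> ennreal (9/2 * (LINT y|?M. \<bar>h y\<bar> * ?\<Gamma> y))"
      by (rule ennreal_leI)
    also have "\<dots> = C * ennreal (LINT y|?M. \<bar>h y\<bar> * ?\<Gamma> y)"
      unfolding C_def by (rule ennreal_mult'') (auto intro!: integral_nonneg_AE AE_I2 simp: \<Gamma>_nn)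
    also have "ennreal (LINT y|?M. \<bar>h y\<bar> * ?\<Gamma> y) \<le> (\<integral>\<^sup>+y. ennreal (\<bar>h y\<bar> * ?\<Gamma> y) \<partial>?M)"
    proof (cases "integrable ?M (\<lambda>y. \<bar>h y\<bar> * ?\<Gamma> y)")
      case True
      have "AE y in ?M. 0 \<le> \<bar>h y\<bar> * ?\<Gamma> y" using \<Gamma>_nn by (auto intro!: AE_I2)
      then show ?thesis using nn_integral_eq_integral[OF True] by simp
    qed (simp add: not_integrable_integral_eq)
    also have "(\<integral>\<^sup>+y. ennreal (\<bar>h y\<bar> * ?\<Gamma> y) \<partial>?M) = (\<integral>\<^sup>+y. ennreal (\<bar>h y\<bar> * ?\<Gamma> y) * indicator \<Omega> y \<partial>lborel)"
      by (rule nn_integral_lebesgue_on_lborel[OF \<Omega>b])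
    also have "\<dots> \<le> (\<integral>\<^sup>+y. H y * Q (x - y) \<partial>lborel)"
    proof (rule nn_integral_mono_AE)
      show "AE y in lborel. ennreal (\<bar>h y\<bar> * ?\<Gamma> y) * indicator \<Omega> y \<le> H y * Q (x - y)"
        using H(3) AE_off_axes[of x]
      proof eventually_elim
        case (elim y)
        show ?case
        proof (cases "y \<in> \<Omega>")
          case True
          have "?\<Gamma> y \<le> root_kernel R (x - y)"
            using elim by (intro log_kernel_le_root_kernel R) auto
          then have "\<bar>h y\<bar> * ?\<Gamma> y \<le> \<bar>h y\<bar> * root_kernel R (x - y)" by (rule mult_left_mono) simp
          then have "ennreal (\<bar>h y\<bar> * ?\<Gamma> y) \<le> ennreal (\<bar>h y\<bar> * root_kernel R (x - y))" by (rule ennreal_leI)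
          then show ?thesis using True elim by (simp add: Q_def ennreal_mult' root_kernel_nonneg)
        qed simp
      qed
    qed
    finally show ?thesis by (simp add: mult_left_mono power2_eq_square)
  qed
  have U_le: "AE x in lborel. x \<in> \<Omega> \<longrightarrow> U x \<le> C * (\<integral>\<^sup>+y. H y * Q (x - y) \<partial>lborel)"
  proof -
    have "AE x in lborel. x \<in> \<Omega> \<longrightarrow> ennreal (U0 x) \<le> C * (\<integral>\<^sup>+y. H y * Q (x - y) \<partial>lborel)"
      by (rule box_averages_imp_AE_le[OF iU0 avg])
    then show ?thesis using U(3) by eventually_elim (auto simp: U0_def)
  qed
  obtain K where K: "K < \<infinity>" "AE x in lborel. x \<in> \<Omega> \<longrightarrow> U x \<le> K"
  proof (rule potential_bootstrap[of U H W Q \<Omega> C "ennreal M'" B])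
    show "Q (a - b) = Q (b - a)" for a b by (simp add: Q_def root_kernel_minus)
    show "AE y in lborel. H y \<le> ennreal M' * indicator \<Omega> y + W y * U y"
      using H(3) U(3) W(3) AE_lb[OF M'(2)]
    proof eventually_elim
      case (elim y)
      show ?case
      proof (cases "y \<in> \<Omega>")
        case True
        then have "ennreal \<bar>h y\<bar> \<le> ennreal (M' + \<bar>V y\<bar> * \<bar>u y\<bar>)" using elim by (intro ennreal_leI) auto
        then show ?thesis using True elim M'(1) by (simp add: ennreal_mult')
      qed (simp add: H(2))
    qed
    show "(\<integral>\<^sup>+y. H y \<partial>lborel) < \<infinity>"
    proof -
      have "(\<integral>\<^sup>+y. H y \<partial>lborel) = (\<integral>\<^sup>+y. ennreal (norm (h y)) * indicator \<Omega> y \<partial>lborel)"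
      proof (rule nn_integral_cong_AE)
        show "AE y in lborel. H y = ennreal (norm (h y)) * indicator \<Omega> y"
          using H(3) by eventually_elim (auto simp: H(2) indicator_def)
      qed
      also have "\<dots> = (\<integral>\<^sup>+y. ennreal (norm (h y)) \<partial>?M)"
        by (rule nn_integral_lebesgue_on_lborel[OF \<Omega>b, symmetric])
      also have "\<dots> < \<infinity>" using hi by (simp add: integrable_iff_bounded)
      finally show ?thesis .
    qed
    show "(\<integral>\<^sup>+y. (W y)\<^sup>2 \<partial>lborel) < \<infinity>"
    proof -
      have "(\<integral>\<^sup>+y. (W y)\<^sup>2 \<partial>lborel) = (\<integral>\<^sup>+y. ennreal (norm ((V y)\<^sup>2)) * indicator \<Omega> y \<partial>lborel)"
      proof (rule nn_integral_cong_AE)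
        show "AE y in lborel. (W y)\<^sup>2 = ennreal (norm ((V y)\<^sup>2)) * indicator \<Omega> y"
          using W(3) by eventually_elim (auto simp: W(2) indicator_def ennreal_power)
      qed
      also have "\<dots> = (\<integral>\<^sup>+y. ennreal (norm ((V y)\<^sup>2)) \<partial>?M)"
        by (rule nn_integral_lebesgue_on_lborel[OF \<Omega>b, symmetric])
      also have "\<dots> < \<infinity>" using V by (simp add: square_integrable_def integrable_iff_bounded)
      finally show ?thesis .
    qed
    show "emeasure lborel \<Omega> < \<infinity>" using \<open>bounded \<Omega>\<close> by (rule emeasure_bounded_finite)
    show "(\<integral>\<^sup>+y. indicator \<Omega> y * Q (x - y) ^ 4 \<partial>lborel) \<le> B" if "x \<in> \<Omega>" for x
      unfolding Q_def by (rule B(2)[OF _ \<Omega>b]) (use diam[OF that] R_def in force)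
  qed (use U_le H(2) W(2) B(1) in \<open>auto simp: C_def\<close>)
  have "AE x in lborel. x \<in> \<Omega> \<longrightarrow> \<bar>u x\<bar> \<le> enn2real K"
    using K(2) U(3)
  proof eventually_elim
    case (elim x)
    show ?case
    proof
      assume "x \<in> \<Omega>"
      then have "ennreal \<bar>u x\<bar> \<le> K" using elim by simp
      then have "enn2real (ennreal \<bar>u x\<bar>) \<le> enn2real K" using K(1) by (intro enn2real_mono) auto
      then show "\<bar>u x\<bar> \<le> enn2real K" by simp
    qed
  qed
  then show ?thesis using \<Omega> by (auto simp: AE_restrict_space_iff AE_completion_iff)
qed

section \<open>The equation satisfied by the functions of the LOD space\<close>

text \<open>Induction on the number of functionals: on the kernel of one of them the others suffice, and a
vector on which this one is \<open>1\<close> accounts for the missing coefficient. The space \<open>S\<close> shrinks in the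
induction, so it is a parameter.\<close>

lemma functional_in_span:
  fixes S :: "('a \<Rightarrow> complex) set" and L :: "('a \<Rightarrow> complex) \<Rightarrow> complex" and l :: "'i \<Rightarrow> ('a \<Rightarrow> complex) \<Rightarrow> complex"
  assumes "finite I"
    and S: "\<And>u v c d. u \<in> S \<Longrightarrow> v \<in> S \<Longrightarrow> (\<lambda>x. c * u x + d * v x) \<in> S"
    and L: "\<And>u v c d. u \<in> S \<Longrightarrow> v \<in> S \<Longrightarrow> L (\<lambda>x. c * u x + d * v x) = c * L u + d * L v"
    and l: "\<And>i u v c d. i \<in> I \<Longrightarrow> u \<in> S \<Longrightarrow> v \<in> S \<Longrightarrow> l i (\<lambda>x. c * u x + d * v x) = c * l i u + d * l i v"
    and ker: "\<And>w. w \<in> S \<Longrightarrow> (\<And>i. i \<in> I \<Longrightarrow> l i w = 0) \<Longrightarrow> L w = 0"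
  shows "\<exists>c. \<forall>w\<in>S. L w = (\<Sum>i\<in>I. c i * l i w)"
  using assms
proof (induction I arbitrary: S rule: finite_induct)
  case empty
  then show ?case by auto
next
  case (insert i I)
  let ?S = "{w \<in> S. l i w = 0}"
  have "\<exists>c. \<forall>w\<in>?S. L w = (\<Sum>i\<in>I. c i * l i w)"
  proof (rule insert.IH)
    show "(\<lambda>x. c * u x + d * v x) \<in> ?S" if "u \<in> ?S" "v \<in> ?S" for u v c d
      using that insert.prems(1)[of u v c d] insert.prems(3)[of i u v c d] by simp
    show "L w = 0" if "w \<in> ?S" "\<And>i. i \<in> I \<Longrightarrow> l i w = 0" for w
      by (rule insert.prems(4)) (use that in auto)
  qed (use insert.prems(2,3) in auto)
  then obtain c where c: "\<And>w. w \<in> S \<Longrightarrow> l i w = 0 \<Longrightarrow> L w = (\<Sum>i\<in>I. c i * l i w)" by blast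
  show ?case
  proof (cases "\<exists>w0\<in>S. l i w0 \<noteq> 0")
    case False
    then have "\<forall>w\<in>S. L w = (\<Sum>j\<in>insert i I. (c(i := 0)) j * l j w)"
      using c insert.hyps by (auto intro!: sum.cong)
    then show ?thesis by blast
  next
    case True
    then obtain w1 where w1: "w1 \<in> S" "l i w1 \<noteq> 0" by blast
    define w0 where "w0 = (\<lambda>x. (1 / l i w1) * w1 x + 0 * w1 x)"
    have w0: "w0 \<in> S" "l i w0 = 1"
      unfolding w0_def by (rule insert.prems(1)[OF w1(1) w1(1)])
        (use insert.prems(3)[OF insertI1 w1(1) w1(1), of "1 / l i w1" 0] w1(2) in simp)
    define c0 where "c0 = L w0 - (\<Sum>j\<in>I. c j * l j w0)"
    have "L w = (\<Sum>j\<in>insert i I. (c(i := c0)) j * l j w)" if w: "w \<in> S" for w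
    proof -
      define w' where "w' = (\<lambda>x. 1 * w x + (- l i w) * w0 x)"
      have w': "w' \<in> S" "l i w' = 0"
        unfolding w'_def by (rule insert.prems(1)[OF w w0(1)])
          (use insert.prems(3)[OF insertI1 w w0(1), of 1 "- l i w"] w0(2) in simp)
      have "L w - l i w * L w0 = L w'"
        unfolding w'_def using insert.prems(2)[OF w w0(1), of 1 "- l i w"] by simp
      also have "\<dots> = (\<Sum>j\<in>I. c j * l j w')" by (rule c[OF w'])
      also have "\<dots> = (\<Sum>j\<in>I. c j * l j w - l i w * (c j * l j w0))"
      proof (rule sum.cong[OF refl])
        fix j assume "j \<in> I"
        then have eq: "l j w' = 1 * l j w + (- l i w) * l j w0"
          unfolding w'_def by (intro insert.prems(3) w w0) auto
        show "c j * l j w' = c j * l j w - l i w * (c j * l j w0)"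
          unfolding eq by (simp add: algebra_simps)
      qed
      also have "\<dots> = (\<Sum>j\<in>I. c j * l j w) - l i w * (\<Sum>j\<in>I. c j * l j w0)"
        by (simp add: sum_subtractf sum_distrib_left)
      finally have "L w = (\<Sum>j\<in>I. c j * l j w) + c0 * l i w" by (simp add: c0_def algebra_simps)
      moreover have "(\<Sum>j\<in>I. (c(i := c0)) j * l j w) = (\<Sum>j\<in>I. c j * l j w)"
        using insert.hyps by (intro sum.cong) auto
      ultimately show ?thesis using insert.hyps by simp
    qed
    then show ?thesis by blast
  qed
qed

lemma disjoint_refinement:
  assumes "finite \<T>" "\<And>K. K \<in> \<T> \<Longrightarrow> K \<in> sets M"
  shows "\<exists>D. (\<forall>K\<in>\<T>. D K \<subseteq> K \<and> D K \<in> sets M) \<and> disjoint_family_on D \<T> \<and> (\<Union>K\<in>\<T>. D K) = \<Union>\<T>"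
  using assms
proof (induction \<T> rule: finite_induct)
  case empty
  then show ?case by (auto simp: disjoint_family_on_def)
next
  case (insert K \<T>)
  then obtain D where D: "\<forall>K\<in>\<T>. D K \<subseteq> K \<and> D K \<in> sets M" "disjoint_family_on D \<T>" "(\<Union>K\<in>\<T>. D K) = \<Union>\<T>"
    by auto
  let ?D = "D(K := K - \<Union>\<T>)"
  have "\<Union>\<T> \<in> sets M" using insert by (intro sets.finite_Union) auto
  then have "\<forall>K'\<in>insert K \<T>. ?D K' \<subseteq> K' \<and> ?D K' \<in> sets M" using D(1) insert.prems by auto
  moreover have "disjoint_family_on ?D (insert K \<T>)"
    using D insert.hyps unfolding disjoint_family_on_def by (auto; blast)
  moreover have "(\<Union>K'\<in>insert K \<T>. ?D K') = \<Union>(insert K \<T>)"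
    using D(3) insert.hyps by auto
  ultimately show ?case by blast
qed

lemma continuous_on_closure_bounded:
  fixes p :: "'a::euclidean_space \<Rightarrow> complex"
  assumes "continuous_on (closure \<Omega>) p" "bounded \<Omega>"
  obtains B where "0 \<le> B" "\<And>x. x \<in> \<Omega> \<Longrightarrow> cmod (p x) \<le> B"
proof -
  have "compact (p ` closure \<Omega>)"
    using assms by (intro compact_continuous_image) (auto simp: compact_closure)
  then obtain B where B: "0 < B" "\<And>y. y \<in> p ` closure \<Omega> \<Longrightarrow> norm y \<le> B"
    using compact_imp_bounded bounded_pos by metis
  have "cmod (p x) \<le> B" if "x \<in> \<Omega>" for x
    using B(2)[of "p x"] that closure_subset[of \<Omega>] by auto
  then show ?thesis using that B(1) by (metis less_imp_le)
qed

lemma borel_measurable_cnj [measurable (raw)]: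
  "f \<in> borel_measurable M \<Longrightarrow> (\<lambda>x. cnj (f x)) \<in> borel_measurable M"
  by (rule borel_measurable_continuous_on[of cnj]) (intro continuous_intros)

lemma (in finite_measure) integrable_bounded_measurable:
  fixes f :: "'a \<Rightarrow> complex"
  assumes "f \<in> borel_measurable M" "\<And>x. x \<in> space M \<Longrightarrow> cmod (f x) \<le> B"
  shows "integrable M f"
  using assms by (intro integrable_const_bound[of _ B]) auto

text \<open>The projection is a definite description, so that its uniqueness has to be shown: a competitor
\<open>p\<close> is orthogonal to itself, hence \<open>0\<close> almost everywhere on \<open>\<Omega>\<close>, hence everywhere by continuity
and because the functions in \<open>P1_space\<close> vanish outside \<open>\<Omega>\<close>.\<close>

lemma L2_projection_eq_zero:
  assumes "open \<Omega>" "bounded \<Omega>" and w: "w \<in> borel_measurable (lebesgue_on \<Omega>)" "\<And>x. x \<in> \<Omega> \<Longrightarrow> cmod (w x) \<le> B"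
    and orth: "\<And>\<phi>. \<phi> \<in> P1_space \<Omega> \<T> \<Longrightarrow> L2_inner \<Omega> w \<phi> = 0"
  shows "L2_projection \<Omega> \<T> w = (\<lambda>x. 0)"
  unfolding L2_projection_def
proof (rule the_equality)
  let ?M = "lebesgue_on \<Omega>"
  have \<Omega>: "\<Omega> \<in> sets lebesgue" using \<open>open \<Omega>\<close> by simp
  have lm: "\<Omega> \<in> lmeasurable" using \<open>open \<Omega>\<close> \<open>bounded \<Omega>\<close> by (rule lmeasurable_open[rotated])
  interpret finite_measure ?M by (rule finite_measure_lebesgue_on[OF lm])
  have "(\<lambda>x. 0) \<in> P1_space \<Omega> \<T>"
    unfolding P1_space_def by (auto intro!: exI[of _ "\<lambda>x. 0"] exI[of _ 0] simp: module_hom_zero linear_0 linear_iff)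
  then show "(\<lambda>x. 0) \<in> P1_space \<Omega> \<T> \<and> (\<forall>\<phi>\<in>P1_space \<Omega> \<T>. L2_inner \<Omega> (\<lambda>x. w x - 0) \<phi> = 0)"
    using orth by simp
  fix p assume p: "p \<in> P1_space \<Omega> \<T> \<and> (\<forall>\<phi>\<in>P1_space \<Omega> \<T>. L2_inner \<Omega> (\<lambda>x. w x - p x) \<phi> = 0)"
  then have cont: "continuous_on (closure \<Omega>) p" and out: "\<And>x. x \<notin> \<Omega> \<Longrightarrow> p x = 0"
    by (auto simp: P1_space_def)
  have cont\<Omega>: "continuous_on \<Omega> p" using cont closure_subset by (rule continuous_on_subset)
  have pm: "p \<in> borel_measurable ?M"
    using continuous_imp_measurable_on_sets_lebesgue[OF cont\<Omega> \<Omega>] .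
  obtain A where A: "0 \<le> A" "\<And>x. x \<in> \<Omega> \<Longrightarrow> cmod (p x) \<le> A"
    using continuous_on_closure_bounded[OF cont \<open>bounded \<Omega>\<close>] by blast
  have wB: "0 \<le> B" if "x \<in> \<Omega>" for x using w(2)[OF that] norm_ge_zero order_trans by blast
  have i1: "integrable ?M (\<lambda>x. w x * cnj (p x))"
  proof (rule integrable_bounded_measurable)
    show "(\<lambda>x. w x * cnj (p x)) \<in> borel_measurable ?M" using w(1) pm by measurable
    show "cmod (w x * cnj (p x)) \<le> B * A" if "x \<in> space ?M" for x
      using that w(2) A(2) wB unfolding norm_mult by (intro mult_mono) auto
  qed
  have i2: "integrable ?M (\<lambda>x. p x * cnj (p x))"
  proof (rule integrable_bounded_measurable)
    show "(\<lambda>x. p x * cnj (p x)) \<in> borel_measurable ?M" using pm by measurable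
    show "cmod (p x * cnj (p x)) \<le> A * A" if "x \<in> space ?M" for x
      using that A unfolding norm_mult by (intro mult_mono) auto
  qed
  have "L2_inner \<Omega> w p - L2_inner \<Omega> p p = L2_inner \<Omega> (\<lambda>x. w x - p x) p"
    unfolding L2_inner_def using i1 i2 by (simp add: left_diff_distrib)
  then have "L2_inner \<Omega> p p = 0" using p orth by simp
  moreover have "L2_inner \<Omega> p p = of_real (LINT x|?M. (cmod (p x))\<^sup>2)"
    unfolding L2_inner_def by (simp only: complex_norm_square[symmetric] integral_complex_of_real)
  ultimately have z: "(LINT x|?M. (cmod (p x))\<^sup>2) = 0" by simp
  have "integrable ?M (\<lambda>x. (cmod (p x))\<^sup>2)"
    using integrable_norm[OF i2] by (simp add: norm_mult power2_eq_square)
  from integral_nonneg_eq_0_iff_AE[OF this] z have AE0: "AE x in ?M. p x = 0" by simp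
  have "{x \<in> \<Omega>. p x \<noteq> 0} = {}"
  proof (rule ccontr)
    assume ne: "{x \<in> \<Omega>. p x \<noteq> 0} \<noteq> {}"
    have "open (\<Omega> \<inter> p -` (- {0}))"
      using continuous_open_preimage[OF cont\<Omega> \<open>open \<Omega>\<close>, of "- {0}"] by (simp add: open_Compl)
    moreover have "\<Omega> \<inter> p -` (- {0}) = {x \<in> \<Omega>. p x \<noteq> 0}" by auto
    ultimately have "open {x \<in> \<Omega>. p x \<noteq> 0}" by simp
    moreover have "negligible {x \<in> \<Omega>. p x \<noteq> 0}"
    proof -
      have "AE x in lebesgue. x \<in> \<Omega> \<longrightarrow> p x = 0" using AE0 \<Omega> by (simp add: AE_restrict_space_iff)
      then have "{x \<in> space lebesgue. \<not> (x \<in> \<Omega> \<longrightarrow> p x = 0)} \<in> null_sets lebesgue"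
        by (simp only: completion.AE_iff_null_sets)
      then show ?thesis by (simp add: negligible_iff_null_sets)
    qed
    ultimately show False using ne open_not_negligible by blast
  qed
  then show "p = (\<lambda>x. 0)" using out by (auto simp: fun_eq_iff)
qed

text \<open>The functions \<open>1\<close>, \<open>x\<^sub>1\<close>, \<open>x\<^sub>2\<close>, restricted to the single triangles, span a finite-dimensional
space that contains all conforming \<open>P\<^sup>1\<close> functions.\<close>

definition affine_coordinate :: "nat \<Rightarrow> real \<times> real \<Rightarrow> real" where
  "affine_coordinate j x = (if j = 0 then 1 else if j = 1 then fst x else snd x)"

text \<open>The functional \<open>a_form \<Omega> b V _ v\<close> vanishes on the kernel of the projection, hence on the common
kernel of the integrals against finitely many bounded functions: the affine coordinates restricted
to the elements. It is therefore an integral against a combination \<open>g\<close> of these functions, which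
means that \<open>v\<close> solves an elliptic equation whose right-hand side is bounded. To avoid overlaps, the
elements are replaced by disjoint subsets with the same union.\<close>

lemma V_LOD_weak_equation:
  assumes "open \<Omega>" "bounded \<Omega>" and part: "simplicial_partition \<Omega> \<T>"
    and ip: "inner_product_on \<Omega> (H10 \<Omega>) (a_form \<Omega> b V)"
    and v: "v \<in> V_LOD \<Omega> b V \<T>"
  obtains g B where "g \<in> borel_measurable (lebesgue_on \<Omega>)" "\<And>x. x \<in> \<Omega> \<Longrightarrow> cmod (g x) \<le> B"
    "\<And>w. w \<in> test_functions \<Omega> \<Longrightarrow> a_form \<Omega> b V w v = (LINT x|lebesgue_on \<Omega>. w x * g x)"
proof -
  let ?M = "lebesgue_on \<Omega>"
  have \<Omega>: "\<Omega> \<in> sets lebesgue" using \<open>open \<Omega>\<close> by simp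
  have lm: "\<Omega> \<in> lmeasurable" using \<open>open \<Omega>\<close> \<open>bounded \<Omega>\<close> by (rule lmeasurable_open[rotated])
  interpret finite_measure ?M by (rule finite_measure_lebesgue_on[OF lm])
  have vH: "v \<in> H10 \<Omega>" using v by (simp add: V_LOD_def)
  have fin: "finite \<T>" and cover: "\<Union>\<T> = closure \<Omega>"
    using part by (auto simp: simplicial_partition_def triangulation_def)
  have "K \<in> sets borel" if "K \<in> \<T>" for K
    using part that by (auto simp: simplicial_partition_def intro!: borel_closed closed_simplex)
  then obtain D where D: "\<And>K. K \<in> \<T> \<Longrightarrow> D K \<subseteq> K" "\<And>K. K \<in> \<T> \<Longrightarrow> D K \<in> sets borel"
    "disjoint_family_on D \<T>" "(\<Union>K\<in>\<T>. D K) = closure \<Omega>"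
    using disjoint_refinement[OF fin, of borel] cover by metis
  obtain r where r: "\<And>x. x \<in> \<Omega> \<Longrightarrow> norm x \<le> r" using \<open>bounded \<Omega>\<close> by (auto simp: bounded_iff)
  define q :: "(real \<times> real) set \<times> nat \<Rightarrow> real \<times> real \<Rightarrow> complex"
    where "q = (\<lambda>(K, j) x. of_real (indicator (D K) x * affine_coordinate j x))"
  define I where "I = \<T> \<times> {0, 1, 2::nat}"
  have finI: "finite I" using fin by (simp add: I_def)
  have qm: "q i \<in> borel_measurable ?M" if "i \<in> I" for i
  proof -
    obtain K j where i: "i = (K, j)" "K \<in> \<T>" using \<open>i \<in> I\<close> by (auto simp: I_def)
    have [measurable]: "D K \<in> sets borel" by (rule D(2)[OF i(2)])
    have [measurable]: "affine_coordinate j \<in> borel_measurable borel"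
      unfolding affine_coordinate_def by (simp add: borel_prod[symmetric])
    have "q i \<in> borel_measurable borel" unfolding q_def i by simp
    then show ?thesis by (intro measurable_restrict_space1 measurable_completion) simp
  qed
  have q_bound: "cmod (q i x) \<le> max 1 r" if "x \<in> \<Omega>" for i x
  proof -
    have "\<bar>affine_coordinate j x\<bar> \<le> max 1 r" for j
      using r[OF that] norm_fst_le[of "fst x" "snd x"] norm_snd_le[of "snd x" "fst x"]
      by (auto simp: affine_coordinate_def)
    moreover have "0 \<le> max 1 r" by simp
    ultimately show ?thesis by (cases i) (auto simp: q_def indicator_def norm_mult)
  qed
  have iwq: "integrable ?M (\<lambda>x. w x * q i x)" if w: "w \<in> test_functions \<Omega>" and i: "i \<in> I" for w i
  proof -
    obtain C where C: "0 < C" "\<And>x. cmod (w x) \<le> C" using test_bounded[OF w] by blast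
    have "w \<in> borel_measurable ?M" using integral_lebesgue_on_test(1)[OF w \<Omega>] by (rule borel_measurable_integrable)
    then have "(\<lambda>x. w x * q i x) \<in> borel_measurable ?M" using qm[OF i] by (rule borel_measurable_times)
    moreover have "cmod (w x * q i x) \<le> C * max 1 r" if "x \<in> \<Omega>" for x
      unfolding norm_mult using C(1) by (intro mult_mono C(2) q_bound that) auto
    ultimately show ?thesis by (intro integrable_bounded_measurable[where B="C * max 1 r"]) auto
  qed
  define l where "l = (\<lambda>i w. LINT x|?M. w x * q i x)"
  have test_comb: "(\<lambda>x. c * u x + d * u' x) \<in> test_functions \<Omega>" if "u \<in> test_functions \<Omega>" "u' \<in> test_functions \<Omega>"
    for u u' :: "real \<times> real \<Rightarrow> complex" and c d
    by (intro test_add test_bounded_linear[OF that(1)] test_bounded_linear[OF that(2)] bounded_linear_mult_right)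
  have "\<exists>c. \<forall>w\<in>test_functions \<Omega>. a_form \<Omega> b V w v = (\<Sum>i\<in>I. c i * l i w)"
  proof (rule functional_in_span[OF finI test_comb])
    fix u u' :: "real \<times> real \<Rightarrow> complex" and c d
    assume u: "u \<in> test_functions \<Omega>" "u' \<in> test_functions \<Omega>"
    then have "u \<in> H10 \<Omega>" "u' \<in> H10 \<Omega>" using test_in_H10 \<open>open \<Omega>\<close> by blast+
    then show "a_form \<Omega> b V (\<lambda>x. c * u x + d * u' x) v = c * a_form \<Omega> b V u v + d * a_form \<Omega> b V u' v"
      using ip vH unfolding inner_product_on_def by blast
    show "l i (\<lambda>x. c * u x + d * u' x) = c * l i u + d * l i u'" if "i \<in> I" for i
    proof -
      have "l i (\<lambda>x. c * u x + d * u' x) = (LINT x|?M. c * (u x * q i x) + d * (u' x * q i x))"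
        unfolding l_def by (simp add: algebra_simps)
      also have "\<dots> = c * l i u + d * l i u'"
        unfolding l_def using iwq[OF u(1) that] iwq[OF u(2) that] by simp
      finally show ?thesis .
    qed
  next
    fix w assume w: "w \<in> test_functions \<Omega>" and l0: "\<And>i. i \<in> I \<Longrightarrow> l i w = 0"
    obtain C where C: "0 < C" "\<And>x. cmod (w x) \<le> C" using test_bounded[OF w] by blast
    have "L2_inner \<Omega> w \<phi> = 0" if \<phi>: "\<phi> \<in> P1_space \<Omega> \<T>" for \<phi>
    proof -
      have "\<exists>c1 c2 c0. \<forall>x\<in>K. \<phi> x = c0 + of_real (fst x) * c1 + of_real (snd x) * c2" if "K \<in> \<T>" for K
      proof -
        have "\<forall>K\<in>\<T>. \<exists>A c. linear A \<and> (\<forall>x\<in>K. \<phi> x = A x + c)"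
          using \<phi> unfolding P1_space_def mem_Collect_eq by (elim conjE)
        from bspec[OF this that] obtain A c where A: "linear A" "\<forall>x\<in>K. \<phi> x = A x + c"
          by (elim exE conjE)
        have A_eq: "A x = of_real (fst x) * A (1, 0) + of_real (snd x) * A (0, 1)" for x
        proof -
          have "A x = A (fst x *\<^sub>R (1, 0) + snd x *\<^sub>R (0, 1))"
            by (rule arg_cong[where f=A]) (simp add: prod_eq_iff)
          also have "\<dots> = of_real (fst x) * A (1, 0) + of_real (snd x) * A (0, 1)"
            unfolding linear_add[OF A(1)] linear_scale[OF A(1)] scaleR_conv_of_real ..
          finally show ?thesis .
        qed
        have "\<forall>x\<in>K. \<phi> x = c + of_real (fst x) * A (1, 0) + of_real (snd x) * A (0, 1)"
        proof
          fix x assume "x \<in> K"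
          then have "\<phi> x = c + A x" using A(2) by (simp add: add.commute)
          then show "\<phi> x = c + of_real (fst x) * A (1, 0) + of_real (snd x) * A (0, 1)"
            by (simp only: A_eq[of x] add.assoc)
        qed
        then show ?thesis by (intro exI)
      qed
      then obtain c0 c1 c2 where cc: "\<And>K x. K \<in> \<T> \<Longrightarrow> x \<in> K \<Longrightarrow>
          \<phi> x = c0 K + of_real (fst x) * c1 K + of_real (snd x) * c2 K"
        by metis
      have eq: "w x * cnj (\<phi> x) = (\<Sum>K\<in>\<T>. cnj (c0 K) * (w x * q (K, 0) x) + cnj (c1 K) * (w x * q (K, 1) x)
          + cnj (c2 K) * (w x * q (K, 2) x))" if x: "x \<in> \<Omega>" for x
      proof -
        have "x \<in> closure \<Omega>" using x closure_subset by blast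
        then obtain K where K: "K \<in> \<T>" "x \<in> D K" using D(4) by blast
        have "x \<notin> D K'" if "K' \<in> \<T>" "K' \<noteq> K" for K'
          using D(3) K that unfolding disjoint_family_on_def by blast
        then have "(\<Sum>K\<in>\<T>. cnj (c0 K) * (w x * q (K, 0) x) + cnj (c1 K) * (w x * q (K, 1) x)
            + cnj (c2 K) * (w x * q (K, 2) x))
          = (\<Sum>K'\<in>\<T>. if K' = K then cnj (c0 K) * (w x * q (K, 0) x) + cnj (c1 K) * (w x * q (K, 1) x)
            + cnj (c2 K) * (w x * q (K, 2) x) else 0)"
          by (intro sum.cong) (auto simp: q_def)
        also have "\<dots> = cnj (c0 K) * (w x * q (K, 0) x) + cnj (c1 K) * (w x * q (K, 1) x) + cnj (c2 K) * (w x * q (K, 2) x)"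
          using fin K(1) by simp
        also have "\<dots> = w x * cnj (\<phi> x)"
          using K(2) cc[OF K(1), of x] D(1)[OF K(1)] by (auto simp: q_def affine_coordinate_def algebra_simps)
        finally show ?thesis by simp
      qed
      have I3: "(K, 0) \<in> I" "(K, 1) \<in> I" "(K, 2) \<in> I" if "K \<in> \<T>" for K using that by (auto simp: I_def)
      have "L2_inner \<Omega> w \<phi> = (LINT x|?M. (\<Sum>K\<in>\<T>. cnj (c0 K) * (w x * q (K, 0) x) + cnj (c1 K) * (w x * q (K, 1) x)
          + cnj (c2 K) * (w x * q (K, 2) x)))"
        unfolding L2_inner_def using eq by (intro Bochner_Integration.integral_cong) auto
      also have "\<dots> = (\<Sum>K\<in>\<T>. LINT x|?M. cnj (c0 K) * (w x * q (K, 0) x) + cnj (c1 K) * (w x * q (K, 1) x)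
          + cnj (c2 K) * (w x * q (K, 2) x))"
        by (intro Bochner_Integration.integral_sum Bochner_Integration.integrable_add integrable_mult_right iwq[OF w] I3)
      also have "\<dots> = (\<Sum>K\<in>\<T>. cnj (c0 K) * l (K, 0) w + cnj (c1 K) * l (K, 1) w + cnj (c2 K) * l (K, 2) w)"
        using iwq[OF w I3(1)] iwq[OF w I3(2)] iwq[OF w I3(3)] by (intro sum.cong) (auto simp: l_def)
      also have "\<dots> = 0" using l0 I3 by simp
      finally show ?thesis .
    qed
    moreover have "w \<in> borel_measurable ?M" using integral_lebesgue_on_test(1)[OF w \<Omega>] by (rule borel_measurable_integrable)
    ultimately have "L2_projection \<Omega> \<T> w = (\<lambda>x. 0)"
      using C by (intro L2_projection_eq_zero[OF \<open>open \<Omega>\<close> \<open>bounded \<Omega>\<close>, where B=C]) auto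
    moreover have wH: "w \<in> H10 \<Omega>" using w \<open>open \<Omega>\<close> by (rule test_in_H10)
    ultimately have "w \<in> W_space \<Omega> \<T>" by (simp add: W_space_def)
    then have "a_form \<Omega> b V v w = 0" using v by (simp add: V_LOD_def)
    moreover have "a_form \<Omega> b V w v = cnj (a_form \<Omega> b V v w)"
      using ip vH wH unfolding inner_product_on_def by blast
    ultimately show "a_form \<Omega> b V w v = 0" by simp
  qed
  then obtain c where c: "\<And>w. w \<in> test_functions \<Omega> \<Longrightarrow> a_form \<Omega> b V w v = (\<Sum>i\<in>I. c i * l i w)" by blast
  show ?thesis
  proof
    show "(\<lambda>x. \<Sum>i\<in>I. c i * q i x) \<in> borel_measurable ?M"
      using qm by (intro borel_measurable_sum borel_measurable_times) auto
    show "cmod (\<Sum>i\<in>I. c i * q i x) \<le> (\<Sum>i\<in>I. cmod (c i) * max 1 r)" if "x \<in> \<Omega>" for x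
      by (rule sum_norm_le) (use q_bound[OF that] in \<open>auto simp: norm_mult intro!: mult_left_mono\<close>)
    fix w :: "real \<times> real \<Rightarrow> complex" assume w: "w \<in> test_functions \<Omega>"
    have "(LINT x|?M. w x * (\<Sum>i\<in>I. c i * q i x)) = (LINT x|?M. (\<Sum>i\<in>I. c i * (w x * q i x)))"
      by (simp add: sum_distrib_left ac_simps)
    also have "\<dots> = (\<Sum>i\<in>I. LINT x|?M. c i * (w x * q i x))"
      by (intro Bochner_Integration.integral_sum integrable_mult_right iwq[OF w])
    also have "\<dots> = (\<Sum>i\<in>I. c i * l i w)" by (simp add: l_def)
    finally show "a_form \<Omega> b V w v = (LINT x|?M. w x * (\<Sum>i\<in>I. c i * q i x))" using c[OF w] by simp
  qed
qed

lemma square_integrable_Lp: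
  fixes V :: "'a::euclidean_space \<Rightarrow> real"
  assumes "\<Omega> \<in> lmeasurable" "2 \<le> p" "V \<in> Lp_space p \<Omega>"
  shows "square_integrable (lebesgue_on \<Omega>) V"
proof -
  interpret finite_measure "lebesgue_on \<Omega>" by (rule finite_measure_lebesgue_on[OF assms(1)])
  have V: "V \<in> borel_measurable (lebesgue_on \<Omega>)" "integrable (lebesgue_on \<Omega>) (\<lambda>x. norm (V x) powr p)"
    using assms(3) by (auto simp: Lp_space_def)
  have "integrable (lebesgue_on \<Omega>) (\<lambda>x. (V x)\<^sup>2)"
  proof (rule Bochner_Integration.integrable_bound)
    show "integrable (lebesgue_on \<Omega>) (\<lambda>x. 1 + norm (V x) powr p)" using V by simp
    show "AE x in lebesgue_on \<Omega>. norm ((V x)\<^sup>2) \<le> norm (1 + norm (V x) powr p)"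
    proof (rule AE_I2)
      fix x
      show "norm ((V x)\<^sup>2) \<le> norm (1 + norm (V x) powr p)"
      proof (cases "\<bar>V x\<bar> \<le> 1")
        case True
        then have "(V x)\<^sup>2 \<le> 1" by (simp add: abs_square_le_1)
        then show ?thesis by (simp add: add_increasing2)
      next
        case False
        then have "\<bar>V x\<bar> powr 2 \<le> \<bar>V x\<bar> powr p" using assms(2) by (intro powr_mono) auto
        then show ?thesis by simp
      qed
    qed
  qed (use V in measurable)
  then show ?thesis using V by (simp add: square_integrable_def)
qed

text \<open>Since \<open>V\<close> is real-valued, real and imaginary part of \<open>v\<close> solve the equation separately; the
conjugate of the equation is used because the form is antilinear in its second argument.\<close>

lemma V_LOD_bounded:
  assumes "open \<Omega>" "bounded \<Omega>" and part: "simplicial_partition \<Omega> \<T>"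
    and V: "square_integrable (lebesgue_on \<Omega>) V"
    and ip: "inner_product_on \<Omega> (H10 \<Omega>) (a_form \<Omega> (\<lambda>x. 1) V)"
    and v: "v \<in> V_LOD \<Omega> (\<lambda>x. 1) V \<T>"
  shows "\<exists>C. AE x in lebesgue_on \<Omega>. cmod (v x) \<le> C"
proof -
  let ?M = "lebesgue_on \<Omega>"
  have \<Omega>: "\<Omega> \<in> sets lebesgue" using \<open>open \<Omega>\<close> by simp
  have lm: "\<Omega> \<in> lmeasurable" using \<open>open \<Omega>\<close> \<open>bounded \<Omega>\<close> by (rule lmeasurable_open[rotated])
  interpret finite_measure ?M by (rule finite_measure_lebesgue_on[OF lm])
  obtain g B where g: "g \<in> borel_measurable ?M" "\<And>x. x \<in> \<Omega> \<Longrightarrow> cmod (g x) \<le> B"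
    "\<And>w. w \<in> test_functions \<Omega> \<Longrightarrow> a_form \<Omega> (\<lambda>x. 1) V w v = (LINT x|?M. w x * g x)"
    using V_LOD_weak_equation[OF \<open>open \<Omega>\<close> \<open>bounded \<Omega>\<close> part ip v] by blast
  have vH: "v \<in> H10 \<Omega>" using v by (simp add: V_LOD_def)
  then have v1: "v \<in> sobolev_space 1 2 \<Omega>" by (simp only: H10_def mem_Collect_eq)
  note vD = sobolev_space_1_2D[OF \<open>open \<Omega>\<close> v1]
  define G where "G = (\<lambda>e. weak_deriv \<Omega> e v)"
  have GL: "G e \<in> Lp_space 2 \<Omega>" if "e \<in> Basis" for e using vD(3)[OF that] by (simp add: G_def)
  have L2_int: "integrable ?M (\<lambda>x. of_real (a x) * f x)" if a: "square_integrable ?M a" and f: "f \<in> Lp_space 2 \<Omega>"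
    for a :: "real \<times> real \<Rightarrow> real" and f :: "real \<times> real \<Rightarrow> complex"
  proof -
    have "square_integrable ?M (\<lambda>x. cmod (f x))" using f by (auto simp: Lp_space_2_iff square_integrable_def)
    from integrable_mult_square_integrable[OF a this]
    have i: "integrable ?M (\<lambda>x. a x * cmod (f x))" .
    show ?thesis
      by (rule Bochner_Integration.integrable_bound[OF i])
        (use a f in \<open>auto simp: norm_mult abs_mult square_integrable_def Lp_space_2_iff\<close>)
  qed

  have eqn: "(LINT x|?M. (\<Sum>e\<in>Basis. of_real (frechet_derivative w (at x) e) * G e x))
      = (LINT x|?M. of_real (w x) * (cnj (g x) - of_real (V x) * v x))"
    and int1: "integrable ?M (\<lambda>x. (\<Sum>e\<in>Basis. of_real (frechet_derivative w (at x) e) * G e x))"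
    and int2: "integrable ?M (\<lambda>x. of_real (w x) * (cnj (g x) - of_real (V x) * v x))"
    if w: "w \<in> test_functions \<Omega>" for w :: "real \<times> real \<Rightarrow> real"
  proof -
    let ?w = "\<lambda>x. complex_of_real (w x)"
    have wt: "?w \<in> test_functions \<Omega>" by (rule test_bounded_linear[OF w bounded_linear_of_real])
    have sqw: "square_integrable ?M w" by (rule square_integrable_test[OF w \<Omega>])
    have sqw': "square_integrable ?M (\<lambda>x. frechet_derivative w (at x) e)" if "e \<in> Basis" for e
      by (rule square_integrable_test[OF test_derivative[OF w that] \<Omega>])
    show int1: "integrable ?M (\<lambda>x. (\<Sum>e\<in>Basis. of_real (frechet_derivative w (at x) e) * G e x))"
      by (intro Bochner_Integration.integrable_sum L2_int sqw' GL)
    have AE_w: "AE x in ?M. weak_deriv \<Omega> e ?w x = of_real (frechet_derivative w (at x) e)" if "e \<in> Basis" for e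
      using weak_deriv_AE_eq[OF \<open>open \<Omega>\<close> has_weak_deriv_test[OF wt that \<open>open \<Omega>\<close>]]
      by (simp add: frechet_derivative_bounded_linear[OF test_smooth[OF w] bounded_linear_of_real])
    then have AE_w': "AE x in ?M. \<forall>e\<in>Basis. weak_deriv \<Omega> e ?w x = of_real (frechet_derivative w (at x) e)"
      by (subst AE_ball_countable) (auto simp: countable_finite)
    have grad: "cnj (grad_inner \<Omega> (\<lambda>x. 1) ?w v) = (LINT x|?M. (\<Sum>e\<in>Basis. of_real (frechet_derivative w (at x) e) * G e x))"
    proof -
      have mw: "weak_deriv \<Omega> e ?w \<in> borel_measurable ?M" if "e \<in> Basis" for e
        using sobolev_space_1_2D(3)[OF \<open>open \<Omega>\<close> _ that, of ?w] test_in_H10[OF wt \<open>open \<Omega>\<close>]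
        by (simp add: H10_def Lp_space_2_iff del: sobolev_space.simps One_nat_def)
      have mG: "weak_deriv \<Omega> e v \<in> borel_measurable ?M" if "e \<in> Basis" for e
        using GL[OF that] by (simp add: G_def Lp_space_2_iff)
      have mD: "(\<lambda>x. frechet_derivative w (at x) e) \<in> borel_measurable ?M" if "e \<in> Basis" for e
        using sqw'[OF that] by (rule square_integrable_measurable)
      have "grad_inner \<Omega> (\<lambda>x. 1) ?w v = (LINT x|?M. cnj (\<Sum>e\<in>Basis. of_real (frechet_derivative w (at x) e) * G e x))"
        unfolding grad_inner_def
      proof (rule integral_cong_AE)
        show "(\<lambda>x. \<Sum>e\<in>Basis. complex_of_real 1 * weak_deriv \<Omega> e ?w x * cnj (weak_deriv \<Omega> e v x)) \<in> borel_measurable ?M"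
          by (intro borel_measurable_sum borel_measurable_times borel_measurable_const borel_measurable_cnj mw mG)
        show "(\<lambda>x. cnj (\<Sum>e\<in>Basis. of_real (frechet_derivative w (at x) e) * G e x)) \<in> borel_measurable ?M"
          using borel_measurable_integrable[OF int1] by measurable
        show "AE x in ?M. (\<Sum>e\<in>Basis. complex_of_real 1 * weak_deriv \<Omega> e ?w x * cnj (weak_deriv \<Omega> e v x))
            = cnj (\<Sum>e\<in>Basis. of_real (frechet_derivative w (at x) e) * G e x)"
          using AE_w' by eventually_elim (simp add: G_def)
      qed
      also have "\<dots> = cnj (LINT x|?M. (\<Sum>e\<in>Basis. of_real (frechet_derivative w (at x) e) * G e x))"
        by (rule Bochner_Integration.integral_cnj)
      finally show ?thesis by (simp only: complex_cnj_cnj)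
    qed
    have iVv: "integrable ?M (\<lambda>x. of_real (w x) * (of_real (V x) * v x))"
    proof -
      obtain A where A: "0 < A" "\<And>x. norm (w x) \<le> A" using test_bounded[OF w] by blast
      have "square_integrable ?M (\<lambda>x. w x * V x)"
        using A square_integrable_measurable[OF sqw] by (intro square_integrable_bounded_mult[OF V, where B=A]) auto
      from L2_int[OF this vD(1)] show ?thesis by (simp add: mult.assoc)
    qed
    have ig: "integrable ?M (\<lambda>x. of_real (w x) * cnj (g x))"
    proof -
      have "g \<in> Lp_space 2 \<Omega>"
      proof -
        have "square_integrable ?M (\<lambda>x. cmod (g x))"
          using g by (intro square_integrable_bounded[where B=B]) (auto intro!: AE_I2)
        then show ?thesis using g(1) by (simp add: Lp_space_2_iff square_integrable_def)
      qed
      then have "(\<lambda>x. cnj (g x)) \<in> Lp_space 2 \<Omega>" by (simp add: Lp_space_2_iff borel_measurable_cnj)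
      then show ?thesis by (rule L2_int[OF sqw])
    qed
    show int2: "integrable ?M (\<lambda>x. of_real (w x) * (cnj (g x) - of_real (V x) * v x))"
      using Bochner_Integration.integrable_diff[OF ig iVv] by (simp add: right_diff_distrib)
    have "cnj (a_form \<Omega> (\<lambda>x. 1) V ?w v) = (LINT x|?M. of_real (w x) * cnj (g x))"
      unfolding g(3)[OF wt] Bochner_Integration.integral_cnj[symmetric] by simp
    moreover have "cnj (L2_inner \<Omega> (\<lambda>x. of_real (V x) * ?w x) v) = (LINT x|?M. of_real (w x) * (of_real (V x) * v x))"
      unfolding L2_inner_def Bochner_Integration.integral_cnj[symmetric] by (simp add: ac_simps)
    ultimately have "(LINT x|?M. (\<Sum>e\<in>Basis. of_real (frechet_derivative w (at x) e) * G e x))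
        = (LINT x|?M. of_real (w x) * cnj (g x)) - (LINT x|?M. of_real (w x) * (of_real (V x) * v x))"
      using grad by (simp only: a_form_def complex_cnj_add eq_diff_eq)
    also have "\<dots> = (LINT x|?M. of_real (w x) * (cnj (g x) - of_real (V x) * v x))"
      unfolding right_diff_distrib by (rule Bochner_Integration.integral_diff[OF ig iVv, symmetric])
    finally show "(LINT x|?M. (\<Sum>e\<in>Basis. of_real (frechet_derivative w (at x) e) * G e x))
        = (LINT x|?M. of_real (w x) * (cnj (g x) - of_real (V x) * v x))" .
  qed

  have component: "\<exists>C. AE x in ?M. \<bar>L (v x)\<bar> \<le> C"
    if L: "bounded_linear L" "\<And>z. \<bar>L z :: real\<bar> \<le> cmod z" for L
  proof -
    interpret L: bounded_linear L by (rule L(1))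
    have L_of_real: "L (of_real a * z) = a * L z" for a z
      using L.scaleR[of a z] by (simp add: scaleR_conv_of_real)
    obtain \<phi> :: "nat \<Rightarrow> real \<times> real \<Rightarrow> real" where \<phi>: "\<And>k. \<phi> k \<in> test_functions \<Omega>"
      "(\<lambda>k. LINT x|?M. (\<phi> k x - L (v x))\<^sup>2) \<longlonglongrightarrow> 0"
      "\<And>e. e \<in> Basis \<Longrightarrow>
         (\<lambda>k. LINT x|?M. (frechet_derivative (\<phi> k) (at x) e - L (weak_deriv \<Omega> e v x))\<^sup>2) \<longlonglongrightarrow> 0"
      using H10_approximation[OF \<open>open \<Omega>\<close> vH L] by blast
    have Lm: "L \<in> borel_measurable borel"
      by (intro borel_measurable_continuous_onI linear_continuous_on L)
    show ?thesis
    proof (rule weak_solution_bounded[OF \<open>open \<Omega>\<close> \<open>bounded \<Omega>\<close>])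
      show "square_integrable ?M (\<lambda>x. L (v x))" by (rule square_integrable_Lp_2[OF vD(1) L])
      show "square_integrable ?M ((\<lambda>e x. L (G e x)) e)" if "e \<in> Basis" for e
        using square_integrable_Lp_2[OF GL[OF that] L] by simp
      show "(\<lambda>x. L (cnj (g x)) - V x * L (v x)) \<in> borel_measurable ?M"
        by (intro borel_measurable_diff borel_measurable_times measurable_compose[OF borel_measurable_cnj[OF g(1)] Lm]
            square_integrable_measurable[OF V] square_integrable_measurable[OF square_integrable_Lp_2[OF vD(1) L]])
      show "AE x in ?M. \<bar>L (cnj (g x)) - V x * L (v x)\<bar> \<le> B + \<bar>V x\<bar> * \<bar>L (v x)\<bar>"
      proof (rule AE_I2)
        fix x assume "x \<in> space ?M"
        then have "\<bar>L (cnj (g x))\<bar> \<le> B" using L(2)[of "cnj (g x)"] g(2)[of x] by simp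
        then show "\<bar>L (cnj (g x)) - V x * L (v x)\<bar> \<le> B + \<bar>V x\<bar> * \<bar>L (v x)\<bar>"
          using abs_triangle_ineq4[of "L (cnj (g x))" "V x * L (v x)"] by (simp add: abs_mult)
      qed
      fix w :: "real \<times> real \<Rightarrow> real" assume w: "w \<in> test_functions \<Omega>"
      have "(LINT x|?M. (\<Sum>e\<in>Basis. frechet_derivative w (at x) e * L (G e x)))
          = (LINT x|?M. L (\<Sum>e\<in>Basis. of_real (frechet_derivative w (at x) e) * G e x))"
        by (simp add: L.sum L_of_real)
      also have "\<dots> = L (LINT x|?M. (\<Sum>e\<in>Basis. of_real (frechet_derivative w (at x) e) * G e x))"
        by (rule integral_bounded_linear[OF L(1) int1[OF w]])
      also have "\<dots> = L (LINT x|?M. of_real (w x) * (cnj (g x) - of_real (V x) * v x))"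
        by (simp only: eqn[OF w])
      also have "\<dots> = (LINT x|?M. L (of_real (w x) * (cnj (g x) - of_real (V x) * v x)))"
        by (rule integral_bounded_linear[OF L(1) int2[OF w], symmetric])
      also have "\<dots> = (LINT x|?M. w x * (L (cnj (g x)) - V x * L (v x)))"
        by (simp add: L_of_real L.diff)
      finally show "(LINT x|?M. (\<Sum>e\<in>Basis. frechet_derivative w (at x) e * (\<lambda>e x. L (G e x)) e x))
          = (LINT x|?M. w x * (L (cnj (g x)) - V x * L (v x)))" by simp
    qed (use V \<phi> in \<open>auto simp: G_def\<close>)
  qed
  obtain C1 where C1: "AE x in ?M. \<bar>Re (v x)\<bar> \<le> C1"
    using component[OF bounded_linear_Re abs_Re_le_cmod] by blast
  obtain C2 where C2: "AE x in ?M. \<bar>Im (v x)\<bar> \<le> C2"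
    using component[OF bounded_linear_Im abs_Im_le_cmod] by blast
  have "AE x in ?M. cmod (v x) \<le> C1 + C2"
    using C1 C2
  proof eventually_elim
    case (elim x)
    then show ?case using cmod_le[of "v x"] by linarith
  qed
  then show ?thesis by blast
qed

section \<open>Conservation of the discrete energy\<close>

lemma f_tilde_difference_quotient:
  assumes F: "\<And>x. (F has_real_derivative f x) (at x)"
  shows "f_tilde f x y * (x - y) = F x - F y"
    and "f_tilde f x y = (if x = y then f x else (F x - F y) / (x - y))"
proof -
  have "((\<lambda>s. f ((1 - s) * x + s * y) * (y - x)) has_integral F ((1 - 1) * x + 1 * y) - F ((1 - 0) * x + 0 * y)) {0..1}"
  proof (rule fundamental_theorem_of_calculus)
    fix s :: real
    have "((\<lambda>s. F ((1 - s) * x + s * y)) has_real_derivative f ((1 - s) * x + s * y) * (y - x)) (at s)"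
      by (rule DERIV_chain2[OF F]) (auto intro!: derivative_eq_intros simp: algebra_simps)
    then show "((\<lambda>s. F ((1 - s) * x + s * y)) has_vector_derivative f ((1 - s) * x + s * y) * (y - x)) (at s within {0..1})"
      by (simp add: has_real_derivative_iff_has_vector_derivative has_vector_derivative_at_within)
  qed simp
  from integral_unique[OF this]
  have "integral {0..1} (\<lambda>s. f ((1 - s) * x + s * y) * (y - x)) = F y - F x" by simp
  then have "f_tilde f x y * (y - x) = F y - F x"
    by (simp add: f_tilde_def)
  then show *: "f_tilde f x y * (x - y) = F x - F y" by (simp add: algebra_simps)
  show "f_tilde f x y = (if x = y then f x else (F x - F y) / (x - y))"
  proof (cases "x = y")
    case True
    then show ?thesis by (simp add: f_tilde_def algebra_simps)
  next
    case False
    then show ?thesis using * by (simp add: field_simps)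
  qed
qed

lemma f_tilde_bound:
  assumes f: "\<And>t. 0 \<le> t \<Longrightarrow> t \<le> R \<Longrightarrow> \<bar>f t\<bar> \<le> B" and F: "\<And>x. (F has_real_derivative f x) (at x)"
    and xy: "0 \<le> x" "x \<le> R" "0 \<le> y" "y \<le> R"
  shows "\<bar>f_tilde f x y\<bar> \<le> B"
proof (cases "x = y")
  case False
  have "\<bar>F x - F y\<bar> \<le> B * \<bar>x - y\<bar>"
    using field_differentiable_bound[of "{0..R}" F f B x y] f xy has_field_derivative_at_within[OF F]
    by auto
  then show ?thesis
    using False by (simp add: f_tilde_difference_quotient(2)[OF F] field_simps)
qed (use f xy in \<open>simp add: f_tilde_difference_quotient(2)[OF F]\<close>)

lemma Re_telescope: "Re ((p - 2 * q + r) * cnj (p - r)) = (cmod (p - q))\<^sup>2 - (cmod (q - r))\<^sup>2"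
  by (simp only: cmod_power2) (simp add: power2_eq_square algebra_simps)

lemma Re_average: "Re ((p + r) / 2 * cnj (p - r)) = ((cmod p)\<^sup>2 - (cmod r)\<^sup>2) / 2"
  by (simp only: cmod_power2) (simp add: power2_eq_square algebra_simps add_divide_distrib diff_divide_distrib)

lemma a_form_diagonal:
  "Re (a_form \<Omega> (\<lambda>x. 1) V v v) = (H1_seminorm \<Omega> v)\<^sup>2 + (LINT x|lebesgue_on \<Omega>. V x * (cmod (v x))\<^sup>2)"
proof -
  have "grad_inner \<Omega> (\<lambda>x. 1) v v = of_real (LINT x|lebesgue_on \<Omega>. (\<Sum>e\<in>Basis. (cmod (weak_deriv \<Omega> e v x))\<^sup>2))"
    unfolding grad_inner_def integral_complex_of_real[symmetric]
    by (simp only: of_real_1 mult_1 complex_norm_square[symmetric] of_real_sum)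
  moreover have "L2_inner \<Omega> (\<lambda>x. of_real (V x) * v x) v = of_real (LINT x|lebesgue_on \<Omega>. V x * (cmod (v x))\<^sup>2)"
    unfolding L2_inner_def integral_complex_of_real[symmetric]
    by (simp only: mult.assoc complex_norm_square[symmetric] of_real_mult)
  moreover have "0 \<le> (LINT x|lebesgue_on \<Omega>. (\<Sum>e\<in>Basis. (cmod (weak_deriv \<Omega> e v x))\<^sup>2))"
    by (intro Bochner_Integration.integral_nonneg sum_nonneg) simp
  ultimately show ?thesis by (simp add: a_form_def H1_seminorm_def)
qed

text \<open>The mixed terms \<open>ip p r\<close> and \<open>ip r p\<close> are conjugate to each other, so their difference is
purely imaginary.\<close>

lemma a_form_average:
  assumes ip: "inner_product_on \<Omega> X ip" and "p \<in> X" "r \<in> X"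
  shows "Re (ip (\<lambda>x. (p x + r x) / 2) p - ip (\<lambda>x. (p x + r x) / 2) r) = (Re (ip p p) - Re (ip r r)) / 2"
proof -
  have lin: "ip (\<lambda>x. c * u x + d * v x) w = c * ip u w + d * ip v w" if "u \<in> X" "v \<in> X" "w \<in> X" for u v w c d
    using ip that unfolding inner_product_on_def by blast
  have herm: "ip r p = cnj (ip p r)"
    using ip assms(2,3) unfolding inner_product_on_def by blast
  have "(\<lambda>x. (p x + r x) / 2) = (\<lambda>x. (1/2) * p x + (1/2) * r x)"
    by (simp add: fun_eq_iff add_divide_distrib)
  then have "ip (\<lambda>x. (p x + r x) / 2) w = (1/2) * ip p w + (1/2) * ip r w" if "w \<in> X" for w
    using lin[OF assms(2,3) that, of "1/2" "1/2"] by simp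
  then show ?thesis using assms(2,3) herm by simp
qed

text \<open>The scheme is tested with the values \<open>p\<close> and \<open>r\<close> at the time levels \<open>n + 1\<close> and \<open>n - 1\<close>, and
the real part of the difference is taken. The first term telescopes because
\<open>(p - q) - (q - r)\<close> is paired with \<open>(p - q) + (q - r)\<close>; the first-order term becomes \<open>\<i>\<close> times a real
number; the form is treated by \<open>a_form_average\<close>; and in the nonlinear term the difference quotient
\<open>f_tilde\<close> meets exactly the difference \<open>\<bar>p\<bar>\<^sup>2 - \<bar>r\<bar>\<^sup>2\<close>. Essential boundedness makes all
integrals converge, so that they can be split.\<close>

lemma energy_step:
  assumes \<Omega>: "\<Omega> \<in> lmeasurable"
    and V: "square_integrable (lebesgue_on \<Omega>) V"
    and F: "\<And>x. (F has_real_derivative f x) (at x)" and f: "continuous_on UNIV f"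
    and ip: "inner_product_on \<Omega> (H10 \<Omega>) (a_form \<Omega> (\<lambda>x. 1) V)"
    and X: "X \<subseteq> H10 \<Omega>" "\<And>v. v \<in> X \<Longrightarrow> v \<in> borel_measurable (lebesgue_on \<Omega>)"
      "\<And>v. v \<in> X \<Longrightarrow> \<exists>C. AE x in lebesgue_on \<Omega>. cmod (v x) \<le> C"
    and \<tau>: "0 < \<tau>"
    and u: "u (n + 1) \<in> X" "u n \<in> X" "u (n - 1) \<in> X"
    and scheme: "\<And>\<phi>. \<phi> \<in> X \<Longrightarrow> L2_inner \<Omega> (dt2 \<tau> u n) \<phi> + \<i> * L2_inner \<Omega> (dt_hat \<tau> u n) \<phi>
        + grad_inner \<Omega> (\<lambda>x. 1) (avg u n) \<phi>
        + L2_inner \<Omega> (\<lambda>x. of_real (V x) * avg u n x) \<phi>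
        + L2_inner \<Omega> (\<lambda>x. of_real (f_tilde f ((cmod (u (n + 1) x))\<^sup>2) ((cmod (u (n - 1) x))\<^sup>2))
            * avg u n x) \<phi> = 0"
  shows "energy \<Omega> V F \<tau> u n = energy \<Omega> V F \<tau> u (n - 1)"
proof -
  let ?M = "lebesgue_on \<Omega>"
  interpret finite_measure ?M by (rule finite_measure_lebesgue_on[OF \<Omega>])
  define p where "p = u (n + 1)"
  define q where "q = u n"
  define r where "r = u (n - 1)"
  have pqr: "p \<in> X" "q \<in> X" "r \<in> X" using u by (auto simp: p_def q_def r_def)
  note [measurable] = X(2)[OF pqr(1)] X(2)[OF pqr(2)] X(2)[OF pqr(3)]
  obtain Cp Cq Cr where C: "AE x in ?M. cmod (p x) \<le> Cp" "AE x in ?M. cmod (q x) \<le> Cq" "AE x in ?M. cmod (r x) \<le> Cr"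
    using X(3)[OF pqr(1)] X(3)[OF pqr(2)] X(3)[OF pqr(3)] by blast
  define C where "C = max 0 (max Cp (max Cq Cr))"
  have C0: "0 \<le> C" by (simp add: C_def)
  have bound: "AE x in ?M. cmod (p x) \<le> C \<and> cmod (q x) \<le> C \<and> cmod (r x) \<le> C"
    using C by eventually_elim (auto simp: C_def)

  define a where "a = (\<lambda>x. (p x + r x) / 2)"
  define N where "N = (\<lambda>x. f_tilde f ((cmod (p x))\<^sup>2) ((cmod (r x))\<^sup>2))"
  have avg: "avg u n = a" and dt2: "dt2 \<tau> u n = (\<lambda>x. (p x - 2 * q x + r x) / (of_real \<tau>)\<^sup>2)"
    and dth: "dt_hat \<tau> u n = (\<lambda>x. (p x - r x) / (2 * of_real \<tau>))"
    by (auto simp: avg_def dt2_def dt_hat_def a_def p_def q_def r_def)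

  have F_cont: "continuous_on UNIV F" using F by (meson DERIV_isCont continuous_at_imp_continuous_on)
  have [measurable]: "F \<in> borel_measurable borel" "f \<in> borel_measurable borel"
    using F_cont f by (auto intro: borel_measurable_continuous_onI)
  have N_meas [measurable]: "N \<in> borel_measurable ?M"
    unfolding N_def f_tilde_difference_quotient(2)[OF F] by measurable
  have "compact (f ` {0..C\<^sup>2})" using f by (intro compact_continuous_image) (auto intro: continuous_on_subset)
  then obtain Bf where Bf: "0 < Bf" "\<And>y. y \<in> f ` {0..C\<^sup>2} \<Longrightarrow> norm y \<le> Bf"
    using compact_imp_bounded bounded_pos by metis
  have "compact (F ` {0..C\<^sup>2})" using F_cont by (intro compact_continuous_image) (auto intro: continuous_on_subset)
  then obtain BF where BF: "0 < BF" "\<And>y. y \<in> F ` {0..C\<^sup>2} \<Longrightarrow> norm y \<le> BF"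
    using compact_imp_bounded bounded_pos by metis
  have N_bound: "AE x in ?M. \<bar>N x\<bar> \<le> Bf"
    using bound
  proof eventually_elim
    case (elim x)
    then have "(cmod (p x))\<^sup>2 \<le> C\<^sup>2" "(cmod (r x))\<^sup>2 \<le> C\<^sup>2" by (auto intro: power_mono)
    then show ?case
      unfolding N_def using Bf(2) by (intro f_tilde_bound[where R="C\<^sup>2" and F=F] F) auto
  qed

  have ibd: "integrable ?M g" if "g \<in> borel_measurable ?M" "AE x in ?M. cmod (g x) \<le> A" for g :: "_ \<Rightarrow> complex" and A
    using that by (intro integrable_const_bound[of _ A]) auto
  have iprod: "integrable ?M (\<lambda>x. v x * cnj (w x))"
    if v: "v \<in> borel_measurable ?M" "AE x in ?M. cmod (v x) \<le> A" and w: "w \<in> borel_measurable ?M" "AE x in ?M. cmod (w x) \<le> C"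
    for v w A
  proof (rule ibd)
    show "(\<lambda>x. v x * cnj (w x)) \<in> borel_measurable ?M" using v(1) w(1) by measurable
    show "AE x in ?M. cmod (v x * cnj (w x)) \<le> \<bar>A\<bar> * C"
      using v(2) w(2) by eventually_elim (auto simp: norm_mult intro!: mult_mono)
  qed
  have pb: "AE x in ?M. cmod (p x) \<le> C" and rb: "AE x in ?M. cmod (r x) \<le> C"
    using bound by (auto elim: eventually_mono)
  have inner_diff: "L2_inner \<Omega> v p - L2_inner \<Omega> v r = (LINT x|?M. v x * cnj (p x - r x))"
    and inner_int: "integrable ?M (\<lambda>x. v x * cnj (p x - r x))"
    if v: "v \<in> borel_measurable ?M" "AE x in ?M. cmod (v x) \<le> A" for v A
  proof -
    have i: "integrable ?M (\<lambda>x. v x * cnj (p x))" "integrable ?M (\<lambda>x. v x * cnj (r x))"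
      using iprod[OF v _ pb] iprod[OF v _ rb] by simp_all
    then show "integrable ?M (\<lambda>x. v x * cnj (p x - r x))"
      by (simp add: right_diff_distrib)
    show "L2_inner \<Omega> v p - L2_inner \<Omega> v r = (LINT x|?M. v x * cnj (p x - r x))"
      unfolding L2_inner_def using i by (simp add: right_diff_distrib)
  qed
  have sq_int: "integrable ?M (\<lambda>x. (cmod (v x))\<^sup>2)" if "v \<in> borel_measurable ?M" "AE x in ?M. cmod (v x) \<le> A" for v :: "_ \<Rightarrow> complex" and A
  proof (rule integrable_const_bound[of _ "A\<^sup>2"])
    show "AE x in ?M. norm ((cmod (v x))\<^sup>2) \<le> A\<^sup>2" using that(2) by eventually_elim (auto intro: power_mono)
  qed (use that(1) in measurable)

  have d2_bound: "AE x in ?M. cmod (dt2 \<tau> u n x) \<le> 4 * C / \<tau>\<^sup>2"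
    using bound
  proof eventually_elim
    case (elim x)
    have "cmod (p x - 2 * q x + r x) \<le> cmod (p x) + 2 * cmod (q x) + cmod (r x)"
      by (metis (no_types, opaque_lifting) add_right_mono norm_mult norm_numeral norm_triangle_ineq norm_triangle_ineq4 order_trans)
    then show ?case using elim \<tau> by (simp add: dt2 norm_divide norm_power divide_right_mono)
  qed
  have dh_bound: "AE x in ?M. cmod (dt_hat \<tau> u n x) \<le> C / \<tau>"
    using bound
  proof eventually_elim
    case (elim x)
    have "cmod (p x - r x) \<le> cmod (p x) + cmod (r x)" by (rule norm_triangle_ineq4)
    then have "cmod (p x - r x) / (2 * \<tau>) \<le> (2 * C) / (2 * \<tau>)"
      using elim \<tau> by (intro divide_right_mono) auto
    then show ?case using \<tau> by (simp add: dth norm_divide norm_mult)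
  qed
  have a_bound: "AE x in ?M. cmod (a x) \<le> C"
    using bound
  proof eventually_elim
    case (elim x)
    have "cmod (p x + r x) \<le> cmod (p x) + cmod (r x)" by (rule norm_triangle_ineq)
    then show ?case using elim by (simp add: a_def norm_divide)
  qed
  have Na_bound: "AE x in ?M. cmod (of_real (N x) * a x) \<le> Bf * C"
    using N_bound a_bound by eventually_elim (use Bf(1) in \<open>auto simp: norm_mult intro!: mult_mono\<close>)
  have m: "dt2 \<tau> u n \<in> borel_measurable ?M" "dt_hat \<tau> u n \<in> borel_measurable ?M"
    "(\<lambda>x. of_real (N x) * a x) \<in> borel_measurable ?M"
    unfolding dt2 dth a_def by measurable

  have T1: "Re (L2_inner \<Omega> (dt2 \<tau> u n) p - L2_inner \<Omega> (dt2 \<tau> u n) r)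
      = (L2_norm \<Omega> (dt \<tau> u n))\<^sup>2 - (L2_norm \<Omega> (dt \<tau> u (n - 1)))\<^sup>2"
  proof -
    have dtn: "dt \<tau> u n = (\<lambda>x. (p x - q x) / of_real \<tau>)" "dt \<tau> u (n - 1) = (\<lambda>x. (q x - r x) / of_real \<tau>)"
      by (auto simp: dt_def p_def q_def r_def)
    have nb: "cmod ((z - w) / of_real \<tau>) \<le> 2 * C / \<tau>" if "cmod z \<le> C" "cmod w \<le> C" for z w
    proof -
      have "cmod (z - w) \<le> 2 * C" using norm_triangle_ineq4[of z w] that by linarith
      then have "cmod (z - w) / \<tau> \<le> 2 * C / \<tau>" using \<tau> by (intro divide_right_mono) auto
      then show ?thesis using \<tau> by (simp add: norm_divide)
    qed
    have nd: "(cmod (z / of_real \<tau>))\<^sup>2 = (cmod z)\<^sup>2 / \<tau>\<^sup>2" for z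
      by (simp add: norm_divide power_divide)
    have b1: "AE x in ?M. cmod ((p x - q x) / of_real \<tau>) \<le> 2 * C / \<tau>" "AE x in ?M. cmod ((q x - r x) / of_real \<tau>) \<le> 2 * C / \<tau>"
      using bound by (eventually_elim, simp add: nb)+
    have i: "integrable ?M (\<lambda>x. (cmod ((p x - q x) / of_real \<tau>))\<^sup>2)" "integrable ?M (\<lambda>x. (cmod ((q x - r x) / of_real \<tau>))\<^sup>2)"
      by (rule sq_int[OF _ b1(1)], measurable) (rule sq_int[OF _ b1(2)], measurable)
    have "Re (L2_inner \<Omega> (dt2 \<tau> u n) p - L2_inner \<Omega> (dt2 \<tau> u n) r) = (LINT x|?M. Re (dt2 \<tau> u n x * cnj (p x - r x)))"
      using inner_diff[OF m(1) d2_bound] inner_int[OF m(1) d2_bound] by (simp only: integral_Re)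
    also have "\<dots> = (LINT x|?M. (cmod ((p x - q x) / of_real \<tau>))\<^sup>2 - (cmod ((q x - r x) / of_real \<tau>))\<^sup>2)"
    proof (rule Bochner_Integration.integral_cong[OF refl])
      fix x
      have "Re (dt2 \<tau> u n x * cnj (p x - r x)) = Re ((p x - 2 * q x + r x) * cnj (p x - r x)) / \<tau>\<^sup>2"
        by (simp add: dt2 flip: of_real_power)
      then show "Re (dt2 \<tau> u n x * cnj (p x - r x)) = (cmod ((p x - q x) / of_real \<tau>))\<^sup>2 - (cmod ((q x - r x) / of_real \<tau>))\<^sup>2"
        unfolding nd Re_telescope by (simp only: diff_divide_distrib)
    qed
    also have "\<dots> = (LINT x|?M. (cmod ((p x - q x) / of_real \<tau>))\<^sup>2) - (LINT x|?M. (cmod ((q x - r x) / of_real \<tau>))\<^sup>2)"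
      by (rule Bochner_Integration.integral_diff[OF i])
    also have "\<dots> = (L2_norm \<Omega> (dt \<tau> u n))\<^sup>2 - (L2_norm \<Omega> (dt \<tau> u (n - 1)))\<^sup>2"
      unfolding L2_norm_def dtn by (simp add: Bochner_Integration.integral_nonneg)
    finally show ?thesis .
  qed
  have T2: "Re (\<i> * L2_inner \<Omega> (dt_hat \<tau> u n) p - \<i> * L2_inner \<Omega> (dt_hat \<tau> u n) r) = 0"
  proof -
    have "\<i> * L2_inner \<Omega> (dt_hat \<tau> u n) p - \<i> * L2_inner \<Omega> (dt_hat \<tau> u n) r
        = \<i> * (LINT x|?M. dt_hat \<tau> u n x * cnj (p x - r x))"
      unfolding right_diff_distrib[symmetric] inner_diff[OF m(2) dh_bound] ..
    also have "(LINT x|?M. dt_hat \<tau> u n x * cnj (p x - r x)) = (LINT x|?M. of_real ((cmod (p x - r x))\<^sup>2 / (2 * \<tau>)))"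
    proof (rule Bochner_Integration.integral_cong[OF refl])
      fix x
      show "dt_hat \<tau> u n x * cnj (p x - r x) = of_real ((cmod (p x - r x))\<^sup>2 / (2 * \<tau>))"
        unfolding dth by (simp only: times_divide_eq_left complex_norm_square[symmetric] of_real_divide of_real_mult of_real_numeral)
    qed
    also have "\<dots> = of_real (LINT x|?M. (cmod (p x - r x))\<^sup>2 / (2 * \<tau>))" by (rule integral_complex_of_real)
    finally show ?thesis by simp
  qed
  have T3: "Re (a_form \<Omega> (\<lambda>x. 1) V a p - a_form \<Omega> (\<lambda>x. 1) V a r)
      = (Re (a_form \<Omega> (\<lambda>x. 1) V p p) - Re (a_form \<Omega> (\<lambda>x. 1) V r r)) / 2"
    unfolding a_def by (rule a_form_average[OF ip]) (use pqr X(1) in auto)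
  have F_int: "integrable ?M (\<lambda>x. F ((cmod (v x))\<^sup>2))" if "v \<in> borel_measurable ?M" "AE x in ?M. cmod (v x) \<le> C" for v :: "_ \<Rightarrow> complex"
  proof (rule integrable_const_bound[of _ BF])
    show "AE x in ?M. norm (F ((cmod (v x))\<^sup>2)) \<le> BF"
      using that(2)
    proof eventually_elim
      case (elim x)
      then have "(cmod (v x))\<^sup>2 \<le> C\<^sup>2" by (intro power_mono) auto
      then show ?case by (intro BF(2)) auto
    qed
  qed (use that(1) in measurable)
  have qb: "AE x in ?M. cmod (q x) \<le> C" using bound by (auto elim: eventually_mono)
  have mX: "p \<in> borel_measurable ?M" "q \<in> borel_measurable ?M" "r \<in> borel_measurable ?M" by measurable
  note Fi = F_int[OF mX(1) pb] F_int[OF mX(2) qb] F_int[OF mX(3) rb]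
  have T4: "Re (L2_inner \<Omega> (\<lambda>x. of_real (N x) * a x) p - L2_inner \<Omega> (\<lambda>x. of_real (N x) * a x) r)
      = ((LINT x|?M. F ((cmod (p x))\<^sup>2)) - (LINT x|?M. F ((cmod (r x))\<^sup>2))) / 2"
  proof -
    have "Re (L2_inner \<Omega> (\<lambda>x. of_real (N x) * a x) p - L2_inner \<Omega> (\<lambda>x. of_real (N x) * a x) r)
        = (LINT x|?M. Re (of_real (N x) * a x * cnj (p x - r x)))"
      using inner_diff[OF m(3) Na_bound] inner_int[OF m(3) Na_bound] by (simp only: integral_Re)
    also have "\<dots> = (LINT x|?M. (F ((cmod (p x))\<^sup>2) - F ((cmod (r x))\<^sup>2)) / 2)"
    proof (rule Bochner_Integration.integral_cong[OF refl])
      fix x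
      have "Re (of_real (N x) * a x * cnj (p x - r x)) = N x * Re ((p x + r x) / 2 * cnj (p x - r x))"
        unfolding a_def mult.assoc by (simp only: Re_complex_of_real Im_complex_of_real times_complex.sel mult_zero_left diff_zero)
      also have "\<dots> = (F ((cmod (p x))\<^sup>2) - F ((cmod (r x))\<^sup>2)) / 2"
        unfolding Re_average N_def by (simp add: f_tilde_difference_quotient(1)[OF F])
      finally show "Re (of_real (N x) * a x * cnj (p x - r x)) = (F ((cmod (p x))\<^sup>2) - F ((cmod (r x))\<^sup>2)) / 2" .
    qed
    also have "\<dots> = ((LINT x|?M. F ((cmod (p x))\<^sup>2)) - (LINT x|?M. F ((cmod (r x))\<^sup>2))) / 2"
      using Fi by simp
    finally show ?thesis .
  qed

  have sch: "L2_inner \<Omega> (dt2 \<tau> u n) \<phi> + \<i> * L2_inner \<Omega> (dt_hat \<tau> u n) \<phi> + a_form \<Omega> (\<lambda>x. 1) V a \<phi>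
      + L2_inner \<Omega> (\<lambda>x. of_real (N x) * a x) \<phi> = 0" if "\<phi> \<in> X" for \<phi>
    using scheme[OF that] unfolding avg by (simp add: a_form_def N_def p_def r_def add.assoc)
  have combine: "(A - A') + (B - B') + (D - D') + (E - E') = 0" if "A + B + D + E = 0" "A' + B' + D' + E' = 0"
    for A A' B B' D D' E E' :: complex
  proof -
    have "(A - A') + (B - B') + (D - D') + (E - E') = (A + B + D + E) - (A' + B' + D' + E')" by simp
    then show ?thesis using that by simp
  qed
  from arg_cong[OF combine[OF sch[OF pqr(1)] sch[OF pqr(3)]], of Re]
  have main: "(L2_norm \<Omega> (dt \<tau> u n))\<^sup>2 - (L2_norm \<Omega> (dt \<tau> u (n - 1)))\<^sup>2
      + (Re (a_form \<Omega> (\<lambda>x. 1) V p p) - Re (a_form \<Omega> (\<lambda>x. 1) V r r)) / 2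
      + ((LINT x|?M. F ((cmod (p x))\<^sup>2)) - (LINT x|?M. F ((cmod (r x))\<^sup>2))) / 2 = 0"
    by (simp only: plus_complex.sel T1 T2 T3 T4 zero_complex.sel add_0_right)

  have V_int: "integrable ?M (\<lambda>x. V x * (cmod (v x))\<^sup>2)" if v: "v \<in> borel_measurable ?M" "AE x in ?M. cmod (v x) \<le> C" for v :: "_ \<Rightarrow> complex"
  proof -
    have "square_integrable ?M (\<lambda>x. (cmod (v x))\<^sup>2)"
    proof (rule square_integrable_bounded[where B="C\<^sup>2"])
      show "AE x in ?M. \<bar>(cmod (v x))\<^sup>2\<bar> \<le> C\<^sup>2" using v(2) by eventually_elim (auto intro: power_mono)
    qed (use v(1) in measurable)
    then show ?thesis by (rule integrable_mult_square_integrable[OF V])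
  qed
  note Vi = V_int[OF mX(1) pb] V_int[OF mX(2) qb] V_int[OF mX(3) rb]
  have levels: "u (n + 1) = p" "u n = q" "u (n - 1) = r" "u (n - 1 + 1) = q"
    by (simp_all add: p_def q_def r_def)
  have split_V: "(LINT x|?M. V x * ((cmod (p x))\<^sup>2 + (cmod (q x))\<^sup>2))
        = (LINT x|?M. V x * (cmod (p x))\<^sup>2) + (LINT x|?M. V x * (cmod (q x))\<^sup>2)"
      "(LINT x|?M. V x * ((cmod (q x))\<^sup>2 + (cmod (r x))\<^sup>2))
        = (LINT x|?M. V x * (cmod (q x))\<^sup>2) + (LINT x|?M. V x * (cmod (r x))\<^sup>2)"
    unfolding distrib_left by (intro Bochner_Integration.integral_add Vi)+
  have split_F: "(LINT x|?M. F ((cmod (p x))\<^sup>2) + F ((cmod (q x))\<^sup>2))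
        = (LINT x|?M. F ((cmod (p x))\<^sup>2)) + (LINT x|?M. F ((cmod (q x))\<^sup>2))"
      "(LINT x|?M. F ((cmod (q x))\<^sup>2) + F ((cmod (r x))\<^sup>2))
        = (LINT x|?M. F ((cmod (q x))\<^sup>2)) + (LINT x|?M. F ((cmod (r x))\<^sup>2))"
    by (intro Bochner_Integration.integral_add Fi)+
  have "energy \<Omega> V F \<tau> u n - energy \<Omega> V F \<tau> u (n - 1)
      = (L2_norm \<Omega> (dt \<tau> u n))\<^sup>2 - (L2_norm \<Omega> (dt \<tau> u (n - 1)))\<^sup>2
      + (Re (a_form \<Omega> (\<lambda>x. 1) V p p) - Re (a_form \<Omega> (\<lambda>x. 1) V r r)) / 2
      + ((LINT x|?M. F ((cmod (p x))\<^sup>2)) - (LINT x|?M. F ((cmod (r x))\<^sup>2))) / 2"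
    unfolding energy_def levels split_V split_F a_form_diagonal by (simp add: field_simps)
  then show ?thesis using main by simp
qed

theorem theorem2:
  fixes \<Omega> :: "(real \<times> real) set"
    and T p \<gamma> :: real
    and b V :: "real \<times> real \<Rightarrow> real"
    and f F :: "real \<Rightarrow> real"
    and \<T> :: "(real \<times> real) set set"
  assumes "convex_polygonal_domain \<Omega>"
    and "0 < T"
    and "b = (\<lambda>x. 1)"
    and "2 \<le> p" and "V \<in> sobolev_space 2 p \<Omega>"
    and "C_k 2 f"
    and "\<And>x. (F has_real_derivative f x) (at x)"
    and "inner_product_on \<Omega> (H10 \<Omega>) (a_form \<Omega> b V)"
    and "simplicial_partition \<Omega> \<T>" and "quasi_uniform \<gamma> \<T>"
  shows "\<exists>\<tau>\<^sub>0>0. \<forall>N \<tau> u1H u.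
    0 < N \<and> \<tau> = T / real N \<and> \<tau> \<le> \<tau>\<^sub>0 \<and>
    crank_nicolson_solution \<Omega> b V f (V_LOD \<Omega> b V \<T>) \<tau> N u1H u \<longrightarrow>
    (\<forall>n\<in>{0..int N - 1}. energy \<Omega> V F \<tau> u n = energy \<Omega> V F \<tau> u 0)"
proof -
  let ?X = "V_LOD \<Omega> (\<lambda>x. 1) V \<T>"
  obtain P where P: "polytope P" "\<Omega> = interior P"
    using assms(1) by (auto simp: convex_polygonal_domain_def)
  have "open \<Omega>" using P by simp
  have "bounded \<Omega>" using P by (simp add: bounded_interior polytope_imp_bounded)
  have lm: "\<Omega> \<in> lmeasurable" using \<open>open \<Omega>\<close> \<open>bounded \<Omega>\<close> by (rule lmeasurable_open[rotated])
  have "V \<in> Lp_space p \<Omega>" using assms(5) by (simp add: numeral_2_eq_2)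
  then have V: "square_integrable (lebesgue_on \<Omega>) V" by (rule square_integrable_Lp[OF lm assms(4)])
  have f: "continuous_on UNIV f"
  proof -
    have "C_k 0 f" using assms(6) C_k_Suc_D by (metis numeral_2_eq_2)
    then show ?thesis by simp
  qed
  have ip: "inner_product_on \<Omega> (H10 \<Omega>) (a_form \<Omega> (\<lambda>x. 1) V)" using assms(3,8) by simp
  have XH: "?X \<subseteq> H10 \<Omega>" by (auto simp: V_LOD_def)
  have Xm: "v \<in> borel_measurable (lebesgue_on \<Omega>)" if "v \<in> ?X" for v
  proof -
    have "v \<in> sobolev_space 1 2 \<Omega>" using XH that by (auto simp only: H10_def mem_Collect_eq subset_iff)
    then show ?thesis using sobolev_space_1_2D(1)[OF \<open>open \<Omega>\<close>] by (simp add: Lp_space_2_iff del: sobolev_space.simps One_nat_def)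
  qed
  have Xb: "\<exists>C. AE x in lebesgue_on \<Omega>. cmod (v x) \<le> C" if "v \<in> ?X" for v
    by (rule V_LOD_bounded[OF \<open>open \<Omega>\<close> \<open>bounded \<Omega>\<close> assms(9) V ip that])
  have claim: "energy \<Omega> V F \<tau> u n = energy \<Omega> V F \<tau> u 0"
    if N: "0 < N" "\<tau> = T / real N" and sol: "crank_nicolson_solution \<Omega> (\<lambda>x. 1) V f ?X \<tau> N u1H u"
      and n: "n \<in> {0..int N - 1}" for N \<tau> u1H u n
  proof -
    have "0 < \<tau>" using N \<open>0 < T\<close> by simp
    have uX: "u k \<in> ?X" if "0 \<le> k" "k \<le> int N" for k
      using sol that by (cases "k = 0") (auto simp: crank_nicolson_solution_def)
    have "k \<le> int N - 1 \<longrightarrow> energy \<Omega> V F \<tau> u k = energy \<Omega> V F \<tau> u 0" if "0 \<le> k" for k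
      using that
    proof (induction k rule: int_ge_induct)
      case (step k)
      show ?case
      proof
        assume k: "k + 1 \<le> int N - 1"
        have kN: "k + 1 \<in> {0..int N - 1}" using k step.hyps by simp
        have "energy \<Omega> V F \<tau> u (k + 1) = energy \<Omega> V F \<tau> u (k + 1 - 1)"
        proof (rule energy_step[OF lm V assms(7) f ip XH Xm Xb \<open>0 < \<tau>\<close>])
          fix \<phi> assume "\<phi> \<in> ?X"
          then show "L2_inner \<Omega> (dt2 \<tau> u (k + 1)) \<phi> + \<i> * L2_inner \<Omega> (dt_hat \<tau> u (k + 1)) \<phi>
              + grad_inner \<Omega> (\<lambda>x. 1) (avg u (k + 1)) \<phi>
              + L2_inner \<Omega> (\<lambda>x. of_real (V x) * avg u (k + 1) x) \<phi>
              + L2_inner \<Omega> (\<lambda>x. of_real (f_tilde f ((cmod (u (k + 1 + 1) x))\<^sup>2) ((cmod (u (k + 1 - 1) x))\<^sup>2))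
                  * avg u (k + 1) x) \<phi> = 0"
            by (rule bspec[OF bspec[OF sol[unfolded crank_nicolson_solution_def, THEN conjunct2, THEN conjunct2,
                    THEN conjunct2, THEN conjunct2] kN]])
        qed (use uX k step.hyps in auto)
        then show "energy \<Omega> V F \<tau> u (k + 1) = energy \<Omega> V F \<tau> u 0" using step.IH k by simp
      qed
    qed simp
    from this[of n] n show ?thesis by (simp only: atLeastAtMost_iff)
  qed
  show ?thesis
    unfolding assms(3)
  proof (intro exI[of _ "1::real"] conjI zero_less_one allI impI ballI)
    fix N \<tau> u1H u n
    assume H: "0 < N \<and> \<tau> = T / real N \<and> \<tau> \<le> 1 \<and> crank_nicolson_solution \<Omega> (\<lambda>x. 1) V f ?X \<tau> N u1H u"
      and n: "n \<in> {0..int N - 1}"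
    show "energy \<Omega> V F \<tau> u n = energy \<Omega> V F \<tau> u 0"
      by (rule claim[OF conjunct1[OF H] conjunct1[OF conjunct2[OF H]]
            conjunct2[OF conjunct2[OF conjunct2[OF H]]] n])
  qed
qed

end
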